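(* Let $G=SL_n=SL_n(\mathbb C)\subset\mathrm{End}(\mathbb C^n)$ with its standard representation, and let $\Phi:SL_n\to\mathfrak{sl}_n$ be its generalized Cayley mapping. Then $\Phi(A)=A-\frac1n\mathrm{tr}(A)1_{\mathbb C^n}$, and $\Phi$ has mapping degree $n$ (which coincides with the degree of the smooth hypersurface $SL_n\subset\mathrm{End}(\mathbb C^n)$). $\Phi$ maps regular orbits in $SL_n$ to regular orbits in $\mathfrak{sl}_n$, and $$A(SL_n)=A(SL_n)^{SL_n}\otimes\mathrm{Harm}(SL_n)$$ (via multiplication), where $\mathrm{Harm}(SL_n)=\Phi^*(\mathrm{Harm}(\mathfrak{sl}_n))$. The set of $A\in SL_n$ at which the differential of $\Phi$ is singular is $$(SL_n\cap\mathfrak{sl}_n)^{-1}=\{A\in SL_n:\mathrm{tr}(A^{-1})=0\}.$$ Let $\chi\in A(SL_n)$ be given by $\chi(A)=\frac1n\mathrm{tr}(A)$. Then, identifying functions on $\mathfrak{sl}_n$ with their pullbacks under $\Phi$, $$A(SL_n)^{SL_n}=A(\mathfrak{sl}_n)^{SL_n}[\chi],\quad Q(SL_n)^{SL_n}=Q(\mathfrak{sl}_n)^{SL_n}[\chi],\quad Q(SL_n)=Q(\mathfrak{sl}_n)[\chi].$$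
   Context: The generalized Cayley mapping of the standard representation is the map $\Phi:SL_n\to\mathfrak{sl}_n$ defined by $\mathrm{tr}(\Phi(A)X)=\mathrm{tr}(AX)$ for all $X\in\mathfrak{sl}_n$, i.e. the restriction to $SL_n$ of the orthogonal projection $\mathrm{End}(\mathbb C^n)\to\mathfrak{sl}_n$ for the form $\mathrm{tr}(AB)$. It is a dominant morphism, so $\Phi^*$ embeds $A(\mathfrak{sl}_n)$ into $A(SL_n)$ and $Q(\mathfrak{sl}_n)$ into $Q(SL_n)$. The mapping degree is the number of preimages of a generic point. $A(\cdot)$ is the ring of regular functions, $Q(\cdot)$ the field of rational functions; superscript $SL_n$ denotes invariants under conjugation (adjoint action). $\mathrm{Harm}(\mathfrak{sl}_n)$ is the space of regular functions on $\mathfrak{sl}_n$ killed by all $SL_n$-invariant differential operators with constant coefficients and without constant term. An element of $SL_n$ or $\mathfrak{sl}_n$ is regular if its centralizer in $SL_n$ has dimension $n-1$; a regular orbit is the conjugacy class (adjoint orbit) of a regular element. *)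

theory Defs
  imports
    "HOL-Analysis.Analysis"
    "HOL-Computational_Algebra.Polynomial"
    "HOL-Computational_Algebra.Fraction_Field"
    "HOL-Library.Poly_Mapping"
begin

section \<open>Polynomial functions on the space of complex matrices\<close>

inductive poly_fun_le :: "nat \<Rightarrow> (complex^'n^'n \<Rightarrow> complex) \<Rightarrow> bool" where
  const: "poly_fun_le d (\<lambda>_. c)"
| coord: "poly_fun_le (Suc d) (\<lambda>A. A $ i $ j)"
| add: "poly_fun_le d f \<Longrightarrow> poly_fun_le d g \<Longrightarrow> poly_fun_le d (\<lambda>A. f A + g A)"
| mult: "poly_fun_le d f \<Longrightarrow> poly_fun_le e g \<Longrightarrow> poly_fun_le (d + e) (\<lambda>A. f A * g A)"

definition poly_fun :: "(complex^'n^'n \<Rightarrow> complex) \<Rightarrow> bool" where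
  "poly_fun f \<longleftrightarrow> (\<exists>d. poly_fun_le d f)"

definition poly_fun_degree :: "(complex^'n^'n \<Rightarrow> complex) \<Rightarrow> nat" where
  "poly_fun_degree f = (LEAST d. poly_fun_le d f)"

lemma poly_fun_le_mono: "poly_fun_le d f \<Longrightarrow> d \<le> e \<Longrightarrow> poly_fun_le e f"
  using poly_fun_le.mult[of d f "e - d" "\<lambda>_. 1"] by (simp add: poly_fun_le.const)

lemma poly_fun_const [intro, simp]: "poly_fun (\<lambda>_. c)"
  unfolding poly_fun_def using poly_fun_le.const by blast

lemma poly_fun_coord [intro, simp]: "poly_fun (\<lambda>A. A $ i $ j)"
  unfolding poly_fun_def using poly_fun_le.coord by blast

lemma poly_fun_add [intro]: "poly_fun f \<Longrightarrow> poly_fun g \<Longrightarrow> poly_fun (\<lambda>A. f A + g A)"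
  unfolding poly_fun_def
proof (elim exE)
  fix d e assume "poly_fun_le d f" "poly_fun_le e g"
  then have "poly_fun_le (max d e) f" "poly_fun_le (max d e) g"
    by (auto intro: poly_fun_le_mono)
  then show "\<exists>d. poly_fun_le d (\<lambda>A. f A + g A)" using poly_fun_le.add by blast
qed

lemma poly_fun_mult [intro]: "poly_fun f \<Longrightarrow> poly_fun g \<Longrightarrow> poly_fun (\<lambda>A. f A * g A)"
  unfolding poly_fun_def using poly_fun_le.mult by blast

lemma poly_fun_induct [consumes 1, case_names const coord add mult]:
  assumes "poly_fun f"
    and "\<And>c. P (\<lambda>_. c)" and "\<And>i j. P (\<lambda>A. A $ i $ j)"
    and "\<And>f g. poly_fun f \<Longrightarrow> P f \<Longrightarrow> poly_fun g \<Longrightarrow> P g \<Longrightarrow> P (\<lambda>A. f A + g A)"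
    and "\<And>f g. poly_fun f \<Longrightarrow> P f \<Longrightarrow> poly_fun g \<Longrightarrow> P g \<Longrightarrow> P (\<lambda>A. f A * g A)"
  shows "P f"
proof -
  obtain d where "poly_fun_le d f" using assms(1) unfolding poly_fun_def by blast
  then show ?thesis
  proof (induction rule: poly_fun_le.induct)
    case (add d f g)
    then show ?case using assms(4)[of f g] poly_fun_def by blast
  next
    case (mult d f e g)
    then show ?case using assms(5)[of f g] poly_fun_def by blast
  qed (use assms in auto)
qed

lemma poly_fun_sum: "(\<And>i. i \<in> I \<Longrightarrow> poly_fun (f i)) \<Longrightarrow> poly_fun (\<lambda>A. \<Sum>i\<in>I. f i A)"
  by (induction I rule: infinite_finite_induct) auto

lemma poly_fun_compose:
  assumes "poly_fun f" "\<And>i j. poly_fun (\<lambda>A. F A $ i $ j)"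
  shows "poly_fun (\<lambda>A. f (F A))"
  using assms(1) by (induction rule: poly_fun_induct) (use assms(2) in auto)

lemma poly_fun_conj:
  assumes "poly_fun f"
  shows "poly_fun (\<lambda>A. f (g ** A ** h))"
  by (rule poly_fun_compose[OF assms])
     (auto simp: matrix_matrix_mult_def intro!: poly_fun_sum poly_fun_mult)

lemma poly_fun_trace: "poly_fun (\<lambda>A. trace A)"
  unfolding trace_def by (auto intro: poly_fun_sum)


section \<open>Zariski topology, dimension, hypersurfaces, tangent spaces\<close>

definition zariski_closed :: "(complex^'n^'n) set \<Rightarrow> bool" where
  "zariski_closed Z \<longleftrightarrow> (\<exists>P. (\<forall>p\<in>P. poly_fun p) \<and> Z = {A. \<forall>p\<in>P. p A = 0})"

definition zariski_irreducible :: "(complex^'n^'n) set \<Rightarrow> bool" where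
  "zariski_irreducible Z \<longleftrightarrow> zariski_closed Z \<and> Z \<noteq> {} \<and>
    (\<forall>Y1 Y2. zariski_closed Y1 \<longrightarrow> zariski_closed Y2 \<longrightarrow> Z = Y1 \<union> Y2 \<longrightarrow> Y1 = Z \<or> Y2 = Z)"

text \<open>The Krull dimension of a closed set.\<close>

definition zariski_dim :: "(complex^'n^'n) set \<Rightarrow> enat" where
  "zariski_dim Z = Sup {enat d | d. \<exists>C :: nat \<Rightarrow> (complex^'n^'n) set.
     (\<forall>i\<le>d. zariski_irreducible (C i) \<and> C i \<subseteq> Z) \<and> (\<forall>i<d. C i \<subset> C (Suc i))}"

text \<open>\<open>P\<close> holds on a nonempty Zariski open subset of \<open>Y\<close>; this is only used for an irreducible
  \<open>Y\<close>, where such subsets are dense.\<close>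

definition generically_on :: "(complex^'n^'n) set \<Rightarrow> (complex^'n^'n \<Rightarrow> bool) \<Rightarrow> bool" where
  "generically_on Y P \<longleftrightarrow> (\<exists>Z. zariski_closed Z \<and> Y - Z \<noteq> {} \<and> (\<forall>y\<in>Y - Z. P y))"

definition has_mapping_degree ::
  "(complex^'n^'n \<Rightarrow> complex^'n^'n) \<Rightarrow> (complex^'n^'n) set \<Rightarrow> (complex^'n^'n) set \<Rightarrow> nat \<Rightarrow> bool"
where
  "has_mapping_degree F X Y d \<longleftrightarrow> F ` X \<subseteq> Y \<and>
     generically_on Y (\<lambda>y. finite {x \<in> X. F x = y} \<and> card {x \<in> X. F x = y} = d)"

definition vanishing_ideal :: "(complex^'n^'n) set \<Rightarrow> (complex^'n^'n \<Rightarrow> complex) set" where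
  "vanishing_ideal X = {p. poly_fun p \<and> (\<forall>A\<in>X. p A = 0)}"

definition reduced_equation :: "(complex^'n^'n \<Rightarrow> complex) \<Rightarrow> (complex^'n^'n) set \<Rightarrow> bool" where
  "reduced_equation p X \<longleftrightarrow> poly_fun p \<and> p \<noteq> (\<lambda>_. 0) \<and> X \<noteq> {} \<and> X = {A. p A = 0} \<and>
     vanishing_ideal X = {(\<lambda>A. p A * q A) | q. poly_fun q}"

definition smooth_hypersurface_of_degree :: "(complex^'n^'n) set \<Rightarrow> nat \<Rightarrow> bool" where
  "smooth_hypersurface_of_degree X d \<longleftrightarrow> (\<exists>p. reduced_equation p X \<and> poly_fun_degree p = d \<and>
     (\<forall>A\<in>X. frechet_derivative p (at A) \<noteq> (\<lambda>_. 0)))"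

definition tangent_space :: "(complex^'n^'n) set \<Rightarrow> complex^'n^'n \<Rightarrow> (complex^'n^'n) set" where
  "tangent_space X A = {V. \<forall>p\<in>vanishing_ideal X. frechet_derivative p (at A) V = 0}"

text \<open>The differential at \<open>A\<close> of the morphism \<open>X \<rightarrow> Y\<close> given by the restriction of \<open>F\<close>, as a map between
  the tangent spaces; it is only used for smooth \<open>X\<close> and \<open>Y\<close> of the same dimension.\<close>

definition singular_differential ::
  "(complex^'n^'n \<Rightarrow> complex^'n^'n) \<Rightarrow> (complex^'n^'n) set \<Rightarrow> (complex^'n^'n) set
    \<Rightarrow> complex^'n^'n \<Rightarrow> bool"
where
  "singular_differential F X Y A \<longleftrightarrow>
     \<not> bij_betw (frechet_derivative F (at A)) (tangent_space X A) (tangent_space Y (F A))"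


section \<open>The group, its Lie algebra and the generalized Cayley mapping\<close>

definition SL :: "(complex^'n^'n) set" where
  "SL = {A. det A = 1}"

definition sl :: "(complex^'n^'n) set" where
  "sl = {X. trace X = 0}"

text \<open>Defined on all matrices, as the orthogonal projection for the trace form.\<close>

definition cayley :: "complex^'n^'n \<Rightarrow> complex^'n^'n" where
  "cayley A = (THE B. B \<in> sl \<and> (\<forall>X\<in>sl. trace (B ** X) = trace (A ** X)))"

lemma trace_form_nondegenerate:
  fixes D :: "complex^'n^'n"
  assumes "D \<in> sl" "\<forall>X\<in>sl. trace (D ** X) = 0"
  shows "D = 0"
proof -
  define X where "X = (\<chi> i j. cnj (D $ j $ i))"
  have "trace X = cnj (trace D)" by (simp add: X_def trace_def)
  then have "trace (D ** X) = 0" using assms by (simp add: sl_def)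
  moreover have "trace (D ** X) = of_real (\<Sum>i\<in>UNIV. \<Sum>j\<in>UNIV. (cmod (D $ i $ j))\<^sup>2)"
    by (simp add: X_def trace_def matrix_matrix_mult_def complex_norm_square del: of_real_power)
  ultimately have "(\<Sum>i\<in>UNIV. \<Sum>j\<in>UNIV. (cmod (D $ i $ j))\<^sup>2) = 0" by (metis of_real_eq_0_iff)
  then show ?thesis
    by (simp add: sum_nonneg_eq_0_iff sum_nonneg vec_eq_iff)
qed

lemma matrix_sub_rdistrib: "(A - B) ** C = A ** C - B ** C" for A B C :: "complex^'n^'n"
  by (simp add: vec_eq_iff matrix_matrix_mult_def algebra_simps sum_subtractf)

lemma trace_minus_mat_mult:
  fixes A X :: "complex^'n^'n"
  shows "trace ((A - mat c) ** X) = trace (A ** X) - c * trace X"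
proof -
  have "trace (mat c ** X) = c * trace X"
    by (simp add: trace_def matrix_matrix_mult_def mat_def if_distrib sum_distrib_left
        if_distribR sum.delta cong: if_cong)
  then show ?thesis
    by (simp add: matrix_sub_rdistrib trace_sub)
qed

lemma cayley_eq: "cayley A = A - mat (1 / of_nat CARD('n) * trace A)" for A :: "complex^'n^'n"
  unfolding cayley_def
proof (rule the_equality, intro conjI)
  let ?B = "A - mat (1 / of_nat CARD('n) * trace A)"
  show B: "?B \<in> sl" by (simp add: sl_def trace_sub) (simp add: trace_def mat_def)
  show *: "\<forall>X\<in>sl. trace (?B ** X) = trace (A ** X)"
    unfolding trace_minus_mat_mult by (simp add: sl_def)
  fix C assume C: "C \<in> sl \<and> (\<forall>X\<in>sl. trace (C ** X) = trace (A ** X))"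
  have "C - ?B \<in> sl" using B C by (simp add: sl_def trace_sub)
  moreover have "\<forall>X\<in>sl. trace ((C - ?B) ** X) = 0"
    using * C by (simp add: matrix_sub_rdistrib trace_sub)
  ultimately show "C = ?B" using trace_form_nondegenerate by force
qed

lemma cayley_in_sl: "cayley A \<in> sl"
  unfolding cayley_eq sl_def by (simp add: trace_sub) (simp add: trace_def mat_def)

lemma SL_inverse:
  assumes "g \<in> SL"
  shows "g ** matrix_inv g = mat 1" "matrix_inv g ** g = mat 1"
proof -
  have "invertible g" using assms by (simp add: SL_def invertible_det_nz)
  then have "\<exists>h. g ** h = mat 1 \<and> h ** g = mat 1" by (simp add: invertible_def)
  from someI_ex[OF this] show "g ** matrix_inv g = mat 1" "matrix_inv g ** g = mat 1"
    by (simp_all add: matrix_inv_def)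
qed

lemma SL_conj:
  assumes "g \<in> SL" "A \<in> SL"
  shows "matrix_inv g ** A ** g \<in> SL"
proof -
  have "det (matrix_inv g) * det g = 1" using SL_inverse(2)[OF assms(1)] by (metis det_I det_mul)
  with assms show ?thesis by (simp add: SL_def det_mul)
qed

lemma sl_conj:
  assumes "g \<in> SL" "X \<in> sl"
  shows "matrix_inv g ** X ** g \<in> sl"
proof -
  have "trace (matrix_inv g ** X ** g) = trace X"
    by (metis trace_mul_sym matrix_mul_assoc SL_inverse(1)[OF assms(1)] matrix_mul_lid)
  with assms show ?thesis by (simp add: sl_def)
qed

definition conj_orbit :: "complex^'n^'n \<Rightarrow> (complex^'n^'n) set" where
  "conj_orbit A = {g ** A ** matrix_inv g | g. g \<in> SL}"

definition regular_element :: "complex^'n^'n \<Rightarrow> bool" where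
  "regular_element A \<longleftrightarrow> zariski_dim {g \<in> SL. g ** A = A ** g} = enat (CARD('n) - 1)"

definition regular_orbits :: "(complex^'n^'n) set \<Rightarrow> (complex^'n^'n) set set" where
  "regular_orbits X = {conj_orbit A | A. A \<in> X \<and> regular_element A}"


section \<open>Rings of regular functions\<close>

definition regular_functions :: "(complex^'n^'n) set \<Rightarrow> (complex^'n^'n \<Rightarrow> complex) set" where
  "regular_functions X = {restrict p X | p. poly_fun p}"

lemma regular_functionsE:
  assumes "f \<in> regular_functions X"
  obtains p where "poly_fun p" "f = restrict p X"
  using assms unfolding regular_functions_def by blast

lemma restrict_regular: "poly_fun p \<Longrightarrow> restrict p X \<in> regular_functions X"
  unfolding regular_functions_def by blast

lemma regular_functions_add:
  "f \<in> regular_functions X \<Longrightarrow> g \<in> regular_functions X \<Longrightarrow> (\<lambda>A\<in>X. f A + g A) \<in> regular_functions X"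
proof (elim regular_functionsE)
  fix p q assume *: "poly_fun p" "f = restrict p X" "poly_fun q" "g = restrict q X"
  then have "(\<lambda>A\<in>X. f A + g A) = restrict (\<lambda>A. p A + q A) X" by (auto simp: restrict_def)
  with * show ?thesis by (metis poly_fun_add restrict_regular)
qed

lemma regular_functions_mult:
  "f \<in> regular_functions X \<Longrightarrow> g \<in> regular_functions X \<Longrightarrow> (\<lambda>A\<in>X. f A * g A) \<in> regular_functions X"
proof (elim regular_functionsE)
  fix p q assume *: "poly_fun p" "f = restrict p X" "poly_fun q" "g = restrict q X"
  then have "(\<lambda>A\<in>X. f A * g A) = restrict (\<lambda>A. p A * q A) X" by (auto simp: restrict_def)
  with * show ?thesis by (metis poly_fun_mult restrict_regular)
qed

lemma regular_functions_const: "(\<lambda>A\<in>X. c) \<in> regular_functions X"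
  by (simp add: restrict_regular)

lemma regular_functions_uminus:
  assumes "f \<in> regular_functions X"
  shows "(\<lambda>A\<in>X. - f A) \<in> regular_functions X"
proof -
  have "(\<lambda>A\<in>X. - f A) = (\<lambda>A\<in>X. (\<lambda>A\<in>X. - 1) A * f A)" by (auto simp: restrict_def)
  then show ?thesis using regular_functions_mult[OF regular_functions_const assms] by metis
qed

lemma regular_functions_diff:
  assumes "f \<in> regular_functions X" "g \<in> regular_functions X"
  shows "(\<lambda>A\<in>X. f A - g A) \<in> regular_functions X"
proof -
  have "(\<lambda>A\<in>X. f A - g A) = (\<lambda>A\<in>X. f A + (\<lambda>A\<in>X. - g A) A)" by (auto simp: restrict_def)
  then show ?thesis using regular_functions_add[OF assms(1) regular_functions_uminus[OF assms(2)]] by metis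
qed

lemma regular_functions_restrict: "f \<in> regular_functions X \<Longrightarrow> restrict f X = f"
  by (auto elim!: regular_functionsE)

typedef ('n::finite) SL_fun = "regular_functions (SL :: (complex^'n^'n) set)"
  morphisms SL_eval Abs_SL_fun
  using regular_functions_const by blast

typedef ('n::finite) sl_fun = "regular_functions (sl :: (complex^'n^'n) set)"
  morphisms sl_eval Abs_sl_fun
  using regular_functions_const by blast

setup_lifting type_definition_SL_fun
setup_lifting type_definition_sl_fun

lift_definition SL_const :: "complex \<Rightarrow> ('n::finite) SL_fun" is "\<lambda>c. \<lambda>A\<in>SL. c"
  by (rule regular_functions_const)

lift_definition sl_const :: "complex \<Rightarrow> ('n::finite) sl_fun" is "\<lambda>c. \<lambda>X\<in>sl. c"
  by (rule regular_functions_const)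

lemma one_in_SL: "mat 1 \<in> SL"
  by (simp add: SL_def)

lemma zero_in_sl: "0 \<in> sl"
  by (simp add: sl_def trace_def)

instantiation SL_fun :: (finite) comm_ring_1
begin
lift_definition zero_SL_fun :: "'a SL_fun" is "\<lambda>A\<in>SL. 0" by (rule regular_functions_const)
lift_definition one_SL_fun :: "'a SL_fun" is "\<lambda>A\<in>SL. 1" by (rule regular_functions_const)
lift_definition plus_SL_fun :: "'a SL_fun \<Rightarrow> 'a SL_fun \<Rightarrow> 'a SL_fun"
  is "\<lambda>f g. \<lambda>A\<in>SL. f A + g A" by (rule regular_functions_add)
lift_definition minus_SL_fun :: "'a SL_fun \<Rightarrow> 'a SL_fun \<Rightarrow> 'a SL_fun"
  is "\<lambda>f g. \<lambda>A\<in>SL. f A - g A" by (rule regular_functions_diff)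
lift_definition uminus_SL_fun :: "'a SL_fun \<Rightarrow> 'a SL_fun"
  is "\<lambda>f. \<lambda>A\<in>SL. - f A" by (rule regular_functions_uminus)
lift_definition times_SL_fun :: "'a SL_fun \<Rightarrow> 'a SL_fun \<Rightarrow> 'a SL_fun"
  is "\<lambda>f g. \<lambda>A\<in>SL. f A * g A" by (rule regular_functions_mult)
instance
proof
  show "(0 :: 'a SL_fun) \<noteq> 1"
    by transfer (use one_in_SL in \<open>auto simp: restrict_def fun_eq_iff\<close>)
qed (transfer, (auto simp: restrict_def fun_eq_iff algebra_simps elim!: regular_functionsE; fail))+
end

instantiation sl_fun :: (finite) comm_ring_1
begin
lift_definition zero_sl_fun :: "'a sl_fun" is "\<lambda>X\<in>sl. 0" by (rule regular_functions_const)
lift_definition one_sl_fun :: "'a sl_fun" is "\<lambda>X\<in>sl. 1" by (rule regular_functions_const)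
lift_definition plus_sl_fun :: "'a sl_fun \<Rightarrow> 'a sl_fun \<Rightarrow> 'a sl_fun"
  is "\<lambda>f g. \<lambda>X\<in>sl. f X + g X" by (rule regular_functions_add)
lift_definition minus_sl_fun :: "'a sl_fun \<Rightarrow> 'a sl_fun \<Rightarrow> 'a sl_fun"
  is "\<lambda>f g. \<lambda>X\<in>sl. f X - g X" by (rule regular_functions_diff)
lift_definition uminus_sl_fun :: "'a sl_fun \<Rightarrow> 'a sl_fun"
  is "\<lambda>f. \<lambda>X\<in>sl. - f X" by (rule regular_functions_uminus)
lift_definition times_sl_fun :: "'a sl_fun \<Rightarrow> 'a sl_fun \<Rightarrow> 'a sl_fun"
  is "\<lambda>f g. \<lambda>X\<in>sl. f X * g X" by (rule regular_functions_mult)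
instance
proof
  show "(0 :: 'a sl_fun) \<noteq> 1"
    by transfer (use zero_in_sl in \<open>auto simp: restrict_def fun_eq_iff\<close>)
qed (transfer, (auto simp: restrict_def fun_eq_iff algebra_simps elim!: regular_functionsE; fail))+
end

text \<open>Both rings are integral domains: two points of the variety lie on a rational curve in it.\<close>

lemma poly_fun_on_curve:
  assumes "poly_fun f"
  shows "\<exists>q m. \<forall>t A. (\<forall>i j. A $ i $ j * poly d t = poly (P i j) t) \<longrightarrow> f A * poly d t ^ m = poly q t"
  using assms
proof (induction rule: poly_fun_induct)
  case (const c)
  show ?case by (rule exI[of _ "[:c:]"], rule exI[of _ 0]) simp
next
  case (coord i j)
  show ?case by (rule exI[of _ "P i j"], rule exI[of _ 1]) simp
next
  case (add f g)
  then obtain q m q' m' where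
    *: "\<And>t A. (\<forall>i j. A $ i $ j * poly d t = poly (P i j) t) \<Longrightarrow> f A * poly d t ^ m = poly q t"
       "\<And>t A. (\<forall>i j. A $ i $ j * poly d t = poly (P i j) t) \<Longrightarrow> g A * poly d t ^ m' = poly q' t"
    by metis
  show ?case
  proof (rule exI[of _ "q * d ^ m' + q' * d ^ m"], rule exI[of _ "m + m'"], intro allI impI)
    fix t and A :: "complex^'a^'a"
    assume "\<forall>i j. A $ i $ j * poly d t = poly (P i j) t"
    from *[OF this, symmetric] show "(f A + g A) * poly d t ^ (m + m') = poly (q * d ^ m' + q' * d ^ m) t"
      by (simp add: power_add algebra_simps)
  qed
next
  case (mult f g)
  then obtain q m q' m' where
    *: "\<And>t A. (\<forall>i j. A $ i $ j * poly d t = poly (P i j) t) \<Longrightarrow> f A * poly d t ^ m = poly q t"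
       "\<And>t A. (\<forall>i j. A $ i $ j * poly d t = poly (P i j) t) \<Longrightarrow> g A * poly d t ^ m' = poly q' t"
    by metis
  show ?case
  proof (rule exI[of _ "q * q'"], rule exI[of _ "m + m'"], intro allI impI)
    fix t and A :: "complex^'a^'a"
    assume "\<forall>i j. A $ i $ j * poly d t = poly (P i j) t"
    from *[OF this, symmetric] show "(f A * g A) * poly d t ^ (m + m') = poly (q * q') t"
      by (simp add: power_add algebra_simps)
  qed
qed

lemma poly_fun_on_curve':
  fixes f :: "complex^'n^'n \<Rightarrow> complex"
  assumes "poly_fun f"
  shows "\<exists>q m. \<forall>t. poly d t \<noteq> 0 \<longrightarrow>
    f (\<chi> i j. poly (P i j) t / poly d t) * poly d t ^ m = poly q t"
proof -
  obtain q m where *: "\<And>t A. (\<forall>i j. A $ i $ j * poly d t = poly (P i j) t) \<Longrightarrow>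
      f A * poly d t ^ m = poly q t"
    using poly_fun_on_curve[OF assms, of d P] by blast
  show ?thesis by (rule exI[of _ q], rule exI[of _ m], intro allI impI, rule *) simp
qed

lemma poly_fun_nonvanishing_product:
  fixes P :: "'n::finite \<Rightarrow> 'n \<Rightarrow> complex poly"
  assumes C: "C = (\<lambda>t. \<chi> i j. poly (P i j) t / poly d t)"
    and f: "poly_fun f" "f (C a) \<noteq> 0" "poly d a \<noteq> 0"
    and g: "poly_fun g" "g (C b) \<noteq> 0" "poly d b \<noteq> 0"
  shows "\<exists>t. poly d t \<noteq> 0 \<and> f (C t) * g (C t) \<noteq> 0"
proof -
  obtain q m where q: "\<And>t. poly d t \<noteq> 0 \<Longrightarrow> f (C t) * poly d t ^ m = poly q t"
    using poly_fun_on_curve'[OF f(1), of d P] unfolding C by blast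
  obtain r k where r: "\<And>t. poly d t \<noteq> 0 \<Longrightarrow> g (C t) * poly d t ^ k = poly r t"
    using poly_fun_on_curve'[OF g(1), of d P] unfolding C by blast
  have "poly q a \<noteq> 0" using q[OF f(3)] f by (metis mult_eq_0_iff power_not_zero)
  moreover have "poly r b \<noteq> 0" using r[OF g(3)] g by (metis mult_eq_0_iff power_not_zero)
  ultimately have "d * q * r \<noteq> 0" using f(3) by auto
  then have "finite {t. poly (d * q * r) t = 0}" by (rule poly_roots_finite)
  then obtain t where "poly (d * q * r) t \<noteq> 0"
    using infinite_UNIV_char_0[where 'a=complex] by (metis (mono_tags) UNIV_eq_I mem_Collect_eq)
  then have t: "poly d t \<noteq> 0" "poly q t \<noteq> 0" "poly r t \<noteq> 0" by auto
  with q[OF t(1)] r[OF t(1)] have "f (C t) * g (C t) \<noteq> 0" by (metis mult_eq_0_iff)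
  with t show ?thesis by blast
qed

lemma poly_fun_prod: "(\<And>i. i \<in> I \<Longrightarrow> poly_fun (f i)) \<Longrightarrow> poly_fun (\<lambda>A. \<Prod>i\<in>I. f i A)"
  by (induction I rule: infinite_finite_induct) auto

lemma poly_fun_det: "poly_fun (\<lambda>A. det A)"
  unfolding det_def by (intro poly_fun_sum poly_fun_mult poly_fun_const poly_fun_prod poly_fun_coord)

lemma poly_fun_nonvanishing_product_SL:
  fixes A B :: "complex^'n^'n"
  assumes "poly_fun f" "poly_fun g" "A \<in> SL" "B \<in> SL" "f A \<noteq> 0" "g B \<noteq> 0"
  obtains C where "C \<in> SL" "f C * g C \<noteq> 0"
proof -
  define L :: "'n \<Rightarrow> 'n \<Rightarrow> complex poly" where "L = (\<lambda>i j. [:A $ i $ j, B $ i $ j - A $ i $ j:])"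
  define M where "M = (\<lambda>t. (\<chi> i j. poly (L i j) t) :: complex^'n^'n)"
  obtain d m where "\<And>t. poly 1 t \<noteq> 0 \<Longrightarrow>
      det (\<chi> i j. poly (L i j) t / poly 1 t) * poly 1 t ^ m = poly d t"
    using poly_fun_on_curve'[OF poly_fun_det, of 1 L] by blast
  then have d: "poly d t = det (M t)" for t by (simp add: M_def)
  define k :: 'n where "k = undefined"
  define P where "P = (\<lambda>i j. if i = k then L i j else d * L i j)"
  define C where "C = (\<lambda>t. (\<chi> i j. poly (P i j) t / poly d t) :: complex^'n^'n)"
  have C: "C t = (\<chi> i. if i = k then (1 / poly d t) *s (M t $ i) else M t $ i)" if "poly d t \<noteq> 0" for t
    using that by (auto simp: C_def P_def M_def vec_eq_iff)
  have CSL: "C t \<in> SL" if "poly d t \<noteq> 0" for t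
  proof -
    have "det (C t) = 1 / poly d t * det (\<chi> i. if i = k then M t $ i else M t $ i)"
      unfolding C[OF that] by (rule det_row_mul)
    then show ?thesis using that by (simp add: SL_def d)
  qed
  have M: "M 0 = A" "M 1 = B" by (auto simp: M_def L_def vec_eq_iff)
  with assms have d01: "poly d 0 = 1" "poly d 1 = 1" by (auto simp: d SL_def)
  have "C 0 = A" "C 1 = B" using C[of 0] C[of 1] by (simp_all add: M d01 vec_eq_iff)
  with assms obtain t where "poly d t \<noteq> 0" "f (C t) * g (C t) \<noteq> 0"
    using poly_fun_nonvanishing_product[OF C_def, of f 0 g 1] d01 by auto
  with CSL that show thesis by blast
qed

lemma poly_fun_nonvanishing_product_sl:
  fixes A B :: "complex^'n^'n"
  assumes "poly_fun f" "poly_fun g" "A \<in> sl" "B \<in> sl" "f A \<noteq> 0" "g B \<noteq> 0"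
  obtains C where "C \<in> sl" "f C * g C \<noteq> 0"
proof -
  define L :: "'n \<Rightarrow> 'n \<Rightarrow> complex poly" where "L = (\<lambda>i j. [:A $ i $ j, B $ i $ j - A $ i $ j:])"
  define C where "C = (\<lambda>t. (\<chi> i j. poly (L i j) t / poly 1 t) :: complex^'n^'n)"
  have "trace (C t) = trace A + t * (trace B - trace A)" for t
    by (simp add: C_def L_def trace_def sum.distrib sum_subtractf flip: sum_distrib_left)
  then have "C t \<in> sl" for t using assms by (simp add: sl_def)
  moreover have "C 0 = A" "C 1 = B" by (auto simp: C_def L_def vec_eq_iff)
  ultimately show thesis using assms that
    using poly_fun_nonvanishing_product[OF C_def, of f 0 g 1] by auto
qed

instance SL_fun :: (finite) idom
proof
  fix a b :: "'a SL_fun"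
  assume "a \<noteq> 0" "b \<noteq> 0"
  then show "a * b \<noteq> 0"
  proof transfer
    fix f g :: "complex^'a^'a \<Rightarrow> complex"
    assume "f \<in> regular_functions SL" "g \<in> regular_functions SL"
    then obtain p q where p: "poly_fun p" "f = restrict p SL" and q: "poly_fun q" "g = restrict q SL"
      by (metis regular_functionsE)
    assume "f \<noteq> (\<lambda>A\<in>SL. 0)" "g \<noteq> (\<lambda>A\<in>SL. 0)"
    then obtain A B where "A \<in> SL" "p A \<noteq> 0" "B \<in> SL" "q B \<noteq> 0"
      unfolding p q by (auto simp: restrict_def fun_eq_iff split: if_splits)
    then obtain C where "C \<in> SL" "p C * q C \<noteq> 0"
      using poly_fun_nonvanishing_product_SL p q by blast
    then have "(\<lambda>A\<in>SL. f A * g A) C \<noteq> (\<lambda>A\<in>SL. 0) C" unfolding p q by simp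
    then show "(\<lambda>A\<in>SL. f A * g A) \<noteq> (\<lambda>A\<in>SL. 0)" by metis
  qed
qed

instance sl_fun :: (finite) idom
proof
  fix a b :: "'a sl_fun"
  assume "a \<noteq> 0" "b \<noteq> 0"
  then show "a * b \<noteq> 0"
  proof transfer
    fix f g :: "complex^'a^'a \<Rightarrow> complex"
    assume "f \<in> regular_functions sl" "g \<in> regular_functions sl"
    then obtain p q where p: "poly_fun p" "f = restrict p sl" and q: "poly_fun q" "g = restrict q sl"
      by (metis regular_functionsE)
    assume "f \<noteq> (\<lambda>A\<in>sl. 0)" "g \<noteq> (\<lambda>A\<in>sl. 0)"
    then obtain A B where "A \<in> sl" "p A \<noteq> 0" "B \<in> sl" "q B \<noteq> 0"
      unfolding p q by (auto simp: restrict_def fun_eq_iff split: if_splits)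
    then obtain C where "C \<in> sl" "p C * q C \<noteq> 0"
      using poly_fun_nonvanishing_product_sl p q by blast
    then have "(\<lambda>A\<in>sl. f A * g A) C \<noteq> (\<lambda>A\<in>sl. 0) C" unfolding p q by simp
    then show "(\<lambda>A\<in>sl. f A * g A) \<noteq> (\<lambda>A\<in>sl. 0)" by metis
  qed
qed


section \<open>Conjugation action and pullback along the Cayley mapping\<close>

text \<open>For \<open>g \<in> SL\<close>, \<open>(g \<cdot> f)(A) = f(g\<^sup>-\<^sup>1 A g)\<close>.\<close>

definition SL_act :: "complex^'n^'n \<Rightarrow> ('n::finite) SL_fun \<Rightarrow> 'n SL_fun" where
  "SL_act g f = Abs_SL_fun (\<lambda>A\<in>SL. SL_eval f (matrix_inv g ** A ** g))"

definition sl_act :: "complex^'n^'n \<Rightarrow> ('n::finite) sl_fun \<Rightarrow> 'n sl_fun" where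
  "sl_act g f = Abs_sl_fun (\<lambda>X\<in>sl. sl_eval f (matrix_inv g ** X ** g))"

definition pullback :: "('n::finite) sl_fun \<Rightarrow> 'n SL_fun" where
  "pullback f = Abs_SL_fun (\<lambda>A\<in>SL. sl_eval f (cayley A))"

lemma SL_eval_SL_act: "g \<in> SL \<Longrightarrow> SL_eval (SL_act g f) = (\<lambda>A\<in>SL. SL_eval f (matrix_inv g ** A ** g))"
  unfolding SL_act_def
proof (rule Abs_SL_fun_inverse)
  assume g: "g \<in> SL"
  obtain p where p: "poly_fun p" "SL_eval f = restrict p SL"
    using SL_eval[of f] by (metis regular_functionsE)
  then have "(\<lambda>A\<in>SL. SL_eval f (matrix_inv g ** A ** g)) = restrict (\<lambda>A. p (matrix_inv g ** A ** g)) SL"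
    using SL_conj[OF g] by (auto simp: restrict_def)
  then show "(\<lambda>A\<in>SL. SL_eval f (matrix_inv g ** A ** g)) \<in> regular_functions SL"
    using poly_fun_conj[OF p(1)] restrict_regular by metis
qed

lemma sl_eval_sl_act: "g \<in> SL \<Longrightarrow> sl_eval (sl_act g f) = (\<lambda>X\<in>sl. sl_eval f (matrix_inv g ** X ** g))"
  unfolding sl_act_def
proof (rule Abs_sl_fun_inverse)
  assume g: "g \<in> SL"
  obtain p where p: "poly_fun p" "sl_eval f = restrict p sl"
    using sl_eval[of f] by (metis regular_functionsE)
  then have "(\<lambda>X\<in>sl. sl_eval f (matrix_inv g ** X ** g)) = restrict (\<lambda>X. p (matrix_inv g ** X ** g)) sl"
    using sl_conj[OF g] by (auto simp: restrict_def)
  then show "(\<lambda>X\<in>sl. sl_eval f (matrix_inv g ** X ** g)) \<in> regular_functions sl"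
    using poly_fun_conj[OF p(1)] restrict_regular by metis
qed

lemma SL_eval_pullback: "SL_eval (pullback f) = (\<lambda>A\<in>SL. sl_eval f (cayley A))"
  unfolding pullback_def
proof (rule Abs_SL_fun_inverse)
  obtain p where p: "poly_fun p" "sl_eval f = restrict p sl"
    using sl_eval[of f] by (metis regular_functionsE)
  have "poly_fun (\<lambda>A. cayley A $ i $ j)" for i j :: 'a
  proof -
    have "cayley A $ i $ j = A $ i $ j + (if i = j then - 1 / of_nat CARD('a) else 0) * trace A"
      for A :: "complex^'a^'a" by (simp add: cayley_eq mat_def)
    then show ?thesis
      by (simp only:) (intro poly_fun_add poly_fun_mult poly_fun_const poly_fun_coord poly_fun_trace)
  qed
  then have "poly_fun (\<lambda>A. p (cayley A))" by (rule poly_fun_compose[OF p(1)])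
  moreover have "(\<lambda>A\<in>SL. sl_eval f (cayley A)) = restrict (\<lambda>A. p (cayley A)) SL"
    unfolding p by (simp add: restrict_def cayley_in_sl)
  ultimately show "(\<lambda>A\<in>SL. sl_eval f (cayley A)) \<in> regular_functions SL"
    using restrict_regular by metis
qed

lift_definition chi :: "('n::finite) SL_fun" is "\<lambda>A\<in>SL. 1 / of_nat CARD('n) * trace A"
  by (intro restrict_regular poly_fun_mult poly_fun_const poly_fun_trace)

definition SL_invariants :: "('n::finite) SL_fun set" where
  "SL_invariants = {f. \<forall>g\<in>SL. SL_act g f = f}"

definition sl_invariants :: "('n::finite) sl_fun set" where
  "sl_invariants = {f. \<forall>g\<in>SL. sl_act g f = f}"

text \<open>The map induced on fraction fields by an injective ring homomorphism.\<close>

definition map_fract :: "('a::idom \<Rightarrow> 'b::idom) \<Rightarrow> 'a fract \<Rightarrow> 'b fract" where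
  "map_fract h x = (THE y. \<exists>a b. b \<noteq> 0 \<and> x = Fract a b \<and> y = Fract (h a) (h b))"

lemma map_fract_Fract:
  assumes "\<And>a b. h (a * b) = h a * h b" "inj h" "h 0 = 0" "b \<noteq> 0"
  shows "map_fract h (Fract a b) = Fract (h a) (h b)"
  unfolding map_fract_def
proof (rule the_equality)
  fix y assume "\<exists>a' b'. b' \<noteq> 0 \<and> Fract a b = Fract a' b' \<and> y = Fract (h a') (h b')"
  then obtain a' b' where *: "b' \<noteq> 0" "Fract a b = Fract a' b'" "y = Fract (h a') (h b')" by blast
  have "h b \<noteq> 0" "h b' \<noteq> 0" using assms *(1) by (metis injD)+
  moreover have "h a * h b' = h a' * h b"
    using * assms(4) by (metis assms(1) eq_fract(1))
  ultimately show "y = Fract (h a) (h b)" using * by (simp add: eq_fract)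
qed (use assms in blast)

definition SL_fract_invariants :: "('n::finite) SL_fun fract set" where
  "SL_fract_invariants = {x. \<forall>g\<in>SL. map_fract (SL_act g) x = x}"

definition sl_fract_invariants :: "('n::finite) sl_fun fract set" where
  "sl_fract_invariants = {x. \<forall>g\<in>SL. map_fract (sl_act g) x = x}"

definition adjoin :: "'a::comm_ring_1 set \<Rightarrow> 'a \<Rightarrow> 'a set" where
  "adjoin R x = {poly p x | p. \<forall>i. coeff p i \<in> R}"


section \<open>Harmonic functions\<close>

definition dir_deriv :: "complex^'n^'n \<Rightarrow> ('n::finite) sl_fun \<Rightarrow> 'n sl_fun" where
  "dir_deriv V f = Abs_sl_fun (\<lambda>X\<in>sl. deriv (\<lambda>t. sl_eval f (X + map_matrix ((*) t) V)) 0)"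

lemma poly_fun_dir_deriv:
  assumes "poly_fun p"
  shows "\<exists>q. poly_fun q \<and> (\<forall>X. ((\<lambda>t. p (X + map_matrix ((*) t) V)) has_field_derivative q X) (at 0))"
  using assms
proof (induction rule: poly_fun_induct)
  case (const c)
  show ?case by (rule exI[of _ "\<lambda>_. 0"]) auto
next
  case (coord i j)
  show ?case by (rule exI[of _ "\<lambda>_. V $ i $ j"]) (auto intro!: derivative_eq_intros)
next
  case (add f g)
  then obtain q r where *: "poly_fun q" "poly_fun r"
    "\<And>X. ((\<lambda>t. f (X + map_matrix ((*) t) V)) has_field_derivative q X) (at 0)"
    "\<And>X. ((\<lambda>t. g (X + map_matrix ((*) t) V)) has_field_derivative r X) (at 0)" by blast
  then show ?case by (intro exI[of _ "\<lambda>X. q X + r X"]) (auto intro!: DERIV_add)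
next
  case (mult f g)
  then obtain q r where *: "poly_fun q" "poly_fun r"
    "\<And>X. ((\<lambda>t. f (X + map_matrix ((*) t) V)) has_field_derivative q X) (at 0)"
    "\<And>X. ((\<lambda>t. g (X + map_matrix ((*) t) V)) has_field_derivative r X) (at 0)" by blast
  have "X + map_matrix ((*) 0) V = X" for X by (simp add: vec_eq_iff)
  with DERIV_mult[OF *(3,4)] show ?case
    by (intro exI[of _ "\<lambda>X. q X * g X + r X * f X"])
       (use * mult.hyps in \<open>auto intro!: poly_fun_add poly_fun_mult\<close>)
qed

lemma sl_eval_dir_deriv:
  assumes V: "V \<in> sl"
  shows "sl_eval (dir_deriv V f) = (\<lambda>X\<in>sl. deriv (\<lambda>t. sl_eval f (X + map_matrix ((*) t) V)) 0)"
  unfolding dir_deriv_def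
proof (rule Abs_sl_fun_inverse)
  obtain p where p: "poly_fun p" "sl_eval f = restrict p sl"
    using sl_eval[of f] by (metis regular_functionsE)
  obtain q where q: "poly_fun q"
    "\<And>X. ((\<lambda>t. p (X + map_matrix ((*) t) V)) has_field_derivative q X) (at 0)"
    using poly_fun_dir_deriv[OF p(1)] by blast
  have "X + map_matrix ((*) t) V \<in> sl" if "X \<in> sl" for X t
    using that V by (simp add: sl_def trace_def sum.distrib flip: sum_distrib_left)
  then have "(\<lambda>X\<in>sl. deriv (\<lambda>t. sl_eval f (X + map_matrix ((*) t) V)) 0) = restrict q sl"
    unfolding p using DERIV_imp_deriv[OF q(2)] by (auto simp: restrict_def)
  then show "(\<lambda>X\<in>sl. deriv (\<lambda>t. sl_eval f (X + map_matrix ((*) t) V)) 0) \<in> regular_functions sl"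
    using q(1) restrict_regular by metis
qed

text \<open>The differential operators on \<open>sl\<close> with constant coefficients and without constant term form
  the non-unital algebra generated by the derivatives in constant directions.\<close>

inductive_set const_coeff_ops :: "('n::finite sl_fun \<Rightarrow> 'n sl_fun) set" where
  deriv: "V \<in> sl \<Longrightarrow> dir_deriv V \<in> const_coeff_ops"
| add: "D \<in> const_coeff_ops \<Longrightarrow> E \<in> const_coeff_ops \<Longrightarrow> (\<lambda>f. D f + E f) \<in> const_coeff_ops"
| scale: "D \<in> const_coeff_ops \<Longrightarrow> (\<lambda>f. sl_const c * D f) \<in> const_coeff_ops"
| comp: "D \<in> const_coeff_ops \<Longrightarrow> E \<in> const_coeff_ops \<Longrightarrow> D \<circ> E \<in> const_coeff_ops"

definition invariant_op :: "('n::finite sl_fun \<Rightarrow> 'n sl_fun) \<Rightarrow> bool" where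
  "invariant_op D \<longleftrightarrow> (\<forall>g\<in>SL. \<forall>f. D (sl_act g f) = sl_act g (D f))"

definition sl_harmonic :: "('n::finite) sl_fun set" where
  "sl_harmonic = {f. \<forall>D\<in>const_coeff_ops. invariant_op D \<longrightarrow> D f = 0}"

definition SL_harmonic :: "('n::finite) SL_fun set" where
  "SL_harmonic = pullback ` sl_harmonic"


section \<open>Tensor decompositions\<close>

text \<open>For a \<open>\<complex>\<close>-algebra with structure map \<open>k\<close> and subspaces \<open>U\<close>, \<open>W\<close>, the space \<open>U \<otimes> W\<close> is the quotient of
  the free vector space on \<open>U \<times> W\<close> (finitely supported functions) by the bilinearity relations.\<close>

inductive_set tensor_relations ::
  "(complex \<Rightarrow> 'a::comm_ring_1) \<Rightarrow> 'a set \<Rightarrow> 'a set \<Rightarrow> ('a \<times> 'a \<Rightarrow>\<^sub>0 complex) set"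
  for k U W
where
  add_left: "u \<in> U \<Longrightarrow> u' \<in> U \<Longrightarrow> w \<in> W \<Longrightarrow>
    Poly_Mapping.single (u + u', w) 1 - Poly_Mapping.single (u, w) 1 - Poly_Mapping.single (u', w) 1
      \<in> tensor_relations k U W"
| add_right: "u \<in> U \<Longrightarrow> w \<in> W \<Longrightarrow> w' \<in> W \<Longrightarrow>
    Poly_Mapping.single (u, w + w') 1 - Poly_Mapping.single (u, w) 1 - Poly_Mapping.single (u, w') 1
      \<in> tensor_relations k U W"
| scale_left: "u \<in> U \<Longrightarrow> w \<in> W \<Longrightarrow>
    Poly_Mapping.single (k c * u, w) 1 - Poly_Mapping.single (u, w) c \<in> tensor_relations k U W"
| scale_right: "u \<in> U \<Longrightarrow> w \<in> W \<Longrightarrow>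
    Poly_Mapping.single (u, k c * w) 1 - Poly_Mapping.single (u, w) c \<in> tensor_relations k U W"
| zero: "0 \<in> tensor_relations k U W"
| add: "x \<in> tensor_relations k U W \<Longrightarrow> y \<in> tensor_relations k U W \<Longrightarrow>
    x + y \<in> tensor_relations k U W"
| scale: "x \<in> tensor_relations k U W \<Longrightarrow> Poly_Mapping.map ((*) c) x \<in> tensor_relations k U W"

definition mult_map :: "(complex \<Rightarrow> 'a::comm_ring_1) \<Rightarrow> ('a \<times> 'a \<Rightarrow>\<^sub>0 complex) \<Rightarrow> 'a" where
  "mult_map k x = (\<Sum>(u, w)\<in>Poly_Mapping.keys x. k (Poly_Mapping.lookup x (u, w)) * (u * w))"

definition subspace_over :: "(complex \<Rightarrow> 'a::comm_ring_1) \<Rightarrow> 'a set \<Rightarrow> bool" where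
  "subspace_over k U \<longleftrightarrow> 0 \<in> U \<and> (\<forall>u\<in>U. \<forall>v\<in>U. u + v \<in> U) \<and> (\<forall>c. \<forall>u\<in>U. k c * u \<in> U)"

text \<open>Multiplication induces an isomorphism from \<open>U \<otimes> W\<close> onto \<open>A\<close>.\<close>

definition is_tensor_product_via_mult ::
  "(complex \<Rightarrow> 'a::comm_ring_1) \<Rightarrow> 'a set \<Rightarrow> 'a set \<Rightarrow> 'a set \<Rightarrow> bool"
where
  "is_tensor_product_via_mult k A U W \<longleftrightarrow> subspace_over k U \<and> subspace_over k W \<and>
     mult_map k ` {x. Poly_Mapping.keys x \<subseteq> U \<times> W} = A \<and>
     {x. Poly_Mapping.keys x \<subseteq> U \<times> W \<and> mult_map k x = 0} = tensor_relations k U W"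

end

theory Submission
  imports
    Defs
    "HOL-Library.Function_Algebras"
    "HOL-Computational_Algebra.Fundamental_Theorem_Algebra"
begin

text \<open>Write \<open>A = Y + t\<close> with \<open>Y = \<Phi>(A)\<close> traceless and \<open>t = \<chi>(A)\<close>. Then \<open>A\<close> lies in \<open>SL\<close> iff \<open>t\<close> is a root of
  the polynomial \<open>det (Y + t) - 1\<close>, which is monic of degree \<open>n\<close> in \<open>t\<close> and has \<open>n\<close> distinct roots for generic
  \<open>Y\<close> (for instance for \<open>Y = 0\<close>). Division by this polynomial shows that the functions on \<open>SL\<close> are free over
  those on \<open>sl\<close> with basis \<open>1, \<chi>, \<dots>, \<chi>\<^sup>n\<^sup>-\<^sup>1\<close>; uniqueness of the coordinates restricts this to invariants and
  extends it to fractions, and it reduces the tensor decomposition to the one on \<open>sl\<close>.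

  There, harmonic functions are the orthogonal complement of the ideal \<open>J\<close> generated by the invariants
  without constant term, for the Fischer form, in which multiplication by a linear form is adjoint to a
  derivative; induction on the degree shows that invariants times harmonics span. For the independence it is
  enough that functions on all matrices are free over the invariants: in a relation between harmonic
  functions, restricting the coefficients to a line through the origin and comparing lowest terms gives a
  nontrivial linear combination of harmonic functions lying in \<open>J\<close>, hence zero. The invariants are
  polynomials in the coefficients of the characteristic polynomial since a matrix with a cyclic vector is
  conjugate to its companion matrix; freeness holds since, for a suitable weight, the leading monomials of
  these coefficients have disjoint supports.\<close>

text \<open>Freeness over the invariants is proved on all matrices rather than on \<open>sl\<close>,
  because there the entries are independent variables and the monomials form a basis; functions on
  \<open>sl\<close> are carried over by composition with \<open>cayley\<close>. The weight of an
  entry is the square of i + j, since a linear weight could not tell permutations apart: the sum of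
  i + \<pi> i over T depends only on T. Squaring is strictly convex, so it singles out the
  permutation with all i + \<pi> i equal.

  The Fischer form is sesquilinear, because positivity is what gives orthogonal projections and
  turns \<open>ip (D h) (D h) = 0\<close> into \<open>D h = 0\<close>. The price is that the adjoint
  of g is its conjugate transpose, and this is harmless because \<open>SL\<close> is closed under
  conjugate transposition.

  The remaining claims rest on scalar matrices being central and forming the kernel of \<Phi>: A and
  \<Phi>(A) have the same centralizer, and the differential degenerates exactly where the tangent
  space contains the scalars.\<close>

lemma poly_fun_diff [intro]:
  assumes "poly_fun f" "poly_fun g" shows "poly_fun (\<lambda>A. f A - g A)"
proof -
  have "poly_fun (\<lambda>A. f A + (- 1) * g A)" using assms by (intro poly_fun_add poly_fun_mult poly_fun_const)
  then show ?thesis by simp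
qed

lemma poly_fun_uminus [intro]: "poly_fun f \<Longrightarrow> poly_fun (\<lambda>A. - f A)"
  using poly_fun_diff[of "\<lambda>_. 0" f] by simp

lemma poly_fun_power [intro]: "poly_fun f \<Longrightarrow> poly_fun (\<lambda>A. f A ^ k)"
  by (induction k) auto

lemma poly_fun_matrix_mult:
  assumes "\<And>i j. poly_fun (\<lambda>X. F X $ i $ j)" "\<And>i j. poly_fun (\<lambda>X. G X $ i $ j)"
  shows "poly_fun (\<lambda>X. (F X ** G X) $ i $ j)"
  using assms by (auto simp: matrix_matrix_mult_def intro!: poly_fun_sum)

lemma poly_fun_compose_det:
  fixes F :: "complex^'n^'n \<Rightarrow> complex^'n^'n"
  assumes "\<And>i j. poly_fun (\<lambda>X. F X $ i $ j)"
  shows "poly_fun (\<lambda>X. det (F X))"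
  using poly_fun_compose[OF poly_fun_det assms] .

lemma poly_fun_cayley_coord: "poly_fun (\<lambda>A. cayley A $ i $ j)"
proof -
  have "cayley A $ i $ j = A $ i $ j + (if i = j then - 1 / of_nat CARD('a) else 0) * trace A"
    for A :: "complex^'a^'a" by (simp add: cayley_eq mat_def)
  then show ?thesis
    by (simp only:) (intro poly_fun_add poly_fun_mult poly_fun_const poly_fun_coord poly_fun_trace)
qed

lemma poly_fun_cayley: "poly_fun p \<Longrightarrow> poly_fun (\<lambda>A. p (cayley A))"
  by (rule poly_fun_compose) (auto intro: poly_fun_cayley_coord)

text \<open>If \<open>f\<close> and \<open>g\<close> were each nonzero somewhere, their restrictions
  to the line through the two points would be nonzero polynomials in one variable, with a common
  non-root. Identities therefore need checking only where some auxiliary \<open>g\<close> is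
  nonzero.\<close>

lemma poly_fun_vanishing_dense:
  fixes f g :: "complex^'n^'n \<Rightarrow> complex"
  assumes "poly_fun f" "poly_fun g" "\<And>A. f A * g A = 0" "g B \<noteq> 0"
  shows "f A = 0"
proof (rule ccontr)
  assume "f A \<noteq> 0"
  define L :: "'n \<Rightarrow> 'n \<Rightarrow> complex poly" where "L = (\<lambda>i j. [:A $ i $ j, B $ i $ j - A $ i $ j:])"
  define C where "C = (\<lambda>t. (\<chi> i j. poly (L i j) t / poly 1 t) :: complex^'n^'n)"
  have "C 0 = A" "C 1 = B" by (auto simp: C_def L_def vec_eq_iff)
  then show False
    using poly_fun_nonvanishing_product[OF C_def, of f 0 g 1] assms \<open>f A \<noteq> 0\<close> by auto
qed

lemma poly_fun_vanishing_dense_sl: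
  fixes f g :: "complex^'n^'n \<Rightarrow> complex"
  assumes "poly_fun f" "poly_fun g" "\<And>A. A \<in> sl \<Longrightarrow> f A * g A = 0" "B \<in> sl" "g B \<noteq> 0" "A \<in> sl"
  shows "f A = 0"
  using poly_fun_nonvanishing_product_sl[of f g A B] assms by metis


section \<open>Polynomial families\<close>

text \<open>The uniform degree bound lets \<open>p (X + mat s)\<close> be expanded as a sum of fixed
  length in powers of \<open>s\<close>, whose coefficients are again polynomial functions of
  \<open>X\<close>.\<close>

definition poly_family :: "(complex \<Rightarrow> complex^'n^'n \<Rightarrow> complex) \<Rightarrow> bool" where
  "poly_family h \<longleftrightarrow> (\<exists>P d. (\<forall>k. poly_fun (\<lambda>X. coeff (P X) k)) \<and> (\<forall>X. degree (P X) \<le> d) \<and>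
     (\<forall>s X. h s X = poly (P X) s))"

lemma poly_family_fun:
  assumes "poly_fun p" shows "poly_family (\<lambda>s X. p X)"
proof -
  have "poly_fun (\<lambda>X. coeff [:p X:] k)" for k by (cases k) (use assms in auto)
  then show ?thesis unfolding poly_family_def
    by (intro exI[of _ "\<lambda>X. [:p X:]"] exI[of _ 0]) auto
qed

lemma poly_family_var: "poly_family (\<lambda>s X. s)"
  unfolding poly_family_def
  by (intro exI[of _ "\<lambda>X. [:0, 1:]"] exI[of _ 1]) auto

lemma poly_family_add:
  assumes "poly_family g" "poly_family h"
  shows "poly_family (\<lambda>s X. g s X + h s X)"
proof -
  obtain P d Q e where *: "\<And>k. poly_fun (\<lambda>X. coeff (P X) k)" "\<And>X. degree (P X) \<le> d" "\<forall>s X. g s X = poly (P X) s"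
    "\<And>k. poly_fun (\<lambda>X. coeff (Q X) k)" "\<And>X. degree (Q X) \<le> e" "\<forall>s X. h s X = poly (Q X) s"
    using assms unfolding poly_family_def by metis
  have "degree (P X + Q X) \<le> max d e" for X
    by (intro degree_add_le) (use *(2)[of X] *(5)[of X] in auto)
  with * show ?thesis unfolding poly_family_def
    by (intro exI[of _ "\<lambda>X. P X + Q X"] exI[of _ "max d e"]) auto
qed

lemma poly_family_mult:
  assumes "poly_family g" "poly_family h"
  shows "poly_family (\<lambda>s X. g s X * h s X)"
proof -
  obtain P d Q e where *: "\<And>k. poly_fun (\<lambda>X. coeff (P X) k)" "\<And>X. degree (P X) \<le> d" "\<forall>s X. g s X = poly (P X) s"
    "\<And>k. poly_fun (\<lambda>X. coeff (Q X) k)" "\<And>X. degree (Q X) \<le> e" "\<forall>s X. h s X = poly (Q X) s"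
    using assms unfolding poly_family_def by metis
  have "degree (P X * Q X) \<le> d + e" for X
    using degree_mult_le[of "P X" "Q X"] *(2)[of X] *(5)[of X] by linarith
  with * show ?thesis unfolding poly_family_def
    by (intro exI[of _ "\<lambda>X. P X * Q X"] exI[of _ "d + e"])
       (auto simp: coeff_mult intro!: poly_fun_sum poly_fun_mult)
qed

lemma poly_family_compose:
  assumes "poly_fun p" "\<And>i j. poly_family (\<lambda>s X. F s X $ i $ j)"
  shows "poly_family (\<lambda>s X. p (F s X))"
  using assms(1) by (induction rule: poly_fun_induct)
    (use assms(2) in \<open>auto intro: poly_family_add poly_family_mult poly_family_fun\<close>)

lemma poly_family_shift:
  assumes "poly_fun p" shows "poly_family (\<lambda>s X. p (X + mat s))"
proof (rule poly_family_compose[OF assms])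
  fix i j :: 'a
  have "poly_family (\<lambda>s X. (X::complex^'a^'a) $ i $ j + (if i = j then 1 else 0) * s)"
    by (intro poly_family_add poly_family_mult poly_family_fun poly_family_var poly_fun_coord poly_fun_const)
  also have "(\<lambda>s X. (X::complex^'a^'a) $ i $ j + (if i = j then 1 else 0) * s) = (\<lambda>s X. (X + mat s) $ i $ j)"
    by (auto simp: mat_def fun_eq_iff)
  finally show "poly_family (\<lambda>s X. (X + mat s :: complex^'a^'a) $ i $ j)" .
qed

lemma poly_familyE:
  assumes "poly_family h"
  obtains P d where "\<And>k. poly_fun (\<lambda>X. coeff (P X) k)" "\<And>X. degree (P X) \<le> d" "\<And>s X. h s X = poly (P X) s"
  using assms unfolding poly_family_def by metis

lemma poly_degree_le_sum:
  fixes s :: complex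
  assumes "degree p \<le> d" shows "poly p s = (\<Sum>k\<le>d. coeff p k * s ^ k)"
proof -
  have "poly p s = poly (\<Sum>k\<le>d. monom (coeff p k) k) s" using poly_as_sum_of_monoms'[OF assms] by simp
  then show ?thesis by (simp add: poly_sum poly_monom)
qed


section \<open>Coefficients of the characteristic polynomial\<close>

text \<open>The sum of the principal minors of size \<open>k\<close>, that is, the elementary
  symmetric function of the eigenvalues. It is spelled out term by term because its leading monomial
  is needed later.\<close>

definition esym :: "nat \<Rightarrow> complex^'n^'n \<Rightarrow> complex" where
  "esym k X = (\<Sum>T\<in>{T. card T = k}. \<Sum>\<pi>\<in>{\<pi>. \<pi> permutes T}. of_int (sign \<pi>) * (\<Prod>i\<in>T. X $ i $ \<pi> i))"

lemma poly_fun_esym [intro]: "poly_fun (esym k)"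
  unfolding esym_def by (intro poly_fun_sum poly_fun_mult poly_fun_const poly_fun_prod poly_fun_coord)

text \<open>Each Leibniz term is expanded over the set T of factors taken from \<open>X\<close>. The
  remaining factors are all \<open>t\<close> when \<pi> fixes the complement of T, and otherwise one
  of them is 0; so only the permutations of T survive.\<close>

lemma det_shift_eq:
  fixes X :: "complex^'n^'n"
  shows "det (X + mat t) = (\<Sum>k\<le>CARD('n). esym k X * t ^ (CARD('n) - k))"
proof -
  let ?g = "\<lambda>p T. of_int (sign p) * ((\<Prod>i\<in>T. X $ i $ p i) * t ^ (CARD('n) - card T))"
  have step: "(\<Prod>i\<in>UNIV. (X + mat t) $ i $ p i) =
     (\<Sum>T\<in>UNIV. if p permutes T then (\<Prod>i\<in>T. X $ i $ p i) * t ^ (CARD('n) - card T) else 0)"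
    if "p permutes UNIV" for p
  proof -
    have "(\<Prod>i\<in>UNIV. (X + mat t) $ i $ p i) = (\<Prod>i\<in>UNIV. X $ i $ p i + (if i = p i then t else 0))"
      by (simp add: mat_def)
    also have "\<dots> = (\<Sum>T\<in>Pow UNIV. (\<Prod>i\<in>T. X $ i $ p i) * (\<Prod>i\<in>UNIV - T. if i = p i then t else 0))"
      by (rule prod_add) simp
    also have "\<dots> = (\<Sum>T\<in>UNIV. if p permutes T then (\<Prod>i\<in>T. X $ i $ p i) * t ^ (CARD('n) - card T) else 0)"
    proof (rule sum.cong)
      fix T :: "'n set"
      have iff: "p permutes T \<longleftrightarrow> (\<forall>i\<in>UNIV - T. i = p i)"
        using that unfolding permutes_def by (metis DiffE DiffI UNIV_I)
      show "(\<Prod>i\<in>T. X $ i $ p i) * (\<Prod>i\<in>UNIV - T. if i = p i then t else 0) =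
        (if p permutes T then (\<Prod>i\<in>T. X $ i $ p i) * t ^ (CARD('n) - card T) else 0)"
      proof (cases "p permutes T")
        case True
        then have "(\<Prod>i\<in>UNIV - T. if i = p i then t else 0) = (\<Prod>i\<in>UNIV - T. t)"
          using iff by (intro prod.cong) auto
        then show ?thesis using True by (simp add: card_Diff_subset)
      next
        case False
        then have "(\<Prod>i\<in>UNIV - T. if i = p i then t else 0) = 0"
          using iff by (auto intro!: prod_zero)
        then show ?thesis using False by simp
      qed
    qed simp
    finally show ?thesis .
  qed
  have "det (X + mat t) = (\<Sum>p\<in>{p. p permutes UNIV}. of_int (sign p) *
     (\<Sum>T\<in>UNIV. if p permutes T then (\<Prod>i\<in>T. X $ i $ p i) * t ^ (CARD('n) - card T) else 0))"
    unfolding det_def by (rule sum.cong) (auto simp del: vector_add_component simp add: step)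
  also have "\<dots> = (\<Sum>p\<in>{p. p permutes UNIV}. \<Sum>T\<in>UNIV. if p permutes T then ?g p T else 0)"
    by (auto simp: sum_distrib_left intro!: sum.cong)
  also have "\<dots> = (\<Sum>T\<in>UNIV. \<Sum>p\<in>{p. p permutes UNIV}. if p permutes T then ?g p T else 0)"
    by (rule sum.swap)
  also have "\<dots> = (\<Sum>T\<in>UNIV. \<Sum>p\<in>{p. p permutes T}. ?g p T)"
  proof (rule sum.cong)
    fix T :: "'n set"
    have "(\<Sum>p\<in>{p. p permutes UNIV}. if p permutes T then ?g p T else 0) = (\<Sum>p\<in>{p \<in> {p. p permutes UNIV}. p permutes T}. ?g p T)"
      by (rule sum.inter_filter[symmetric]) (rule finite_permutations, simp)
    also have "{p \<in> {p. p permutes UNIV}. p permutes T} = {p. p permutes T}"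
      using permutes_subset[of _ T UNIV] by auto
    finally show "(\<Sum>p\<in>{p. p permutes UNIV}. if p permutes T then ?g p T else 0) = (\<Sum>p\<in>{p. p permutes T}. ?g p T)" .
  qed simp
  also have "\<dots> = (\<Sum>k\<le>CARD('n). \<Sum>T\<in>{T \<in> UNIV. card T = k}. \<Sum>p\<in>{p. p permutes T}. ?g p T)"
    by (rule sum.group[symmetric]) (auto simp: card_mono)
  also have "\<dots> = (\<Sum>k\<le>CARD('n). esym k X * t ^ (CARD('n) - k))"
    unfolding esym_def by (rule sum.cong) (auto simp: sum_distrib_right sum_distrib_left mult_ac intro!: sum.cong)
  finally show ?thesis .
qed

lemma esym_0 [simp]: "esym 0 X = 1"
proof -
  have "{T::'a set. card T = 0} = {{}}" by auto
  then show ?thesis by (simp add: esym_def)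
qed

lemma esym_gt: 
  fixes X :: "complex^'n^'n" 
  assumes "k > CARD('n)" shows "esym k X = 0"
proof -
  have "{T::'n set. card T = k} = {}" using assms by (auto simp: not_le[symmetric] card_mono)
  then show ?thesis by (simp add: esym_def)
qed

lemma esym_1: "esym 1 X = trace X"
proof -
  have "esym 1 X = (\<Sum>T\<in>(\<lambda>i. {i}) ` UNIV. \<Sum>\<pi>\<in>{\<pi>. \<pi> permutes T}. of_int (sign \<pi>) * (\<Prod>i\<in>T. X $ i $ \<pi> i))"
    unfolding esym_def by (rule sum.cong) (auto simp: card_1_singleton_iff)
  also have "\<dots> = (\<Sum>i\<in>UNIV. X $ i $ i)"
    by (subst sum.reindex) (auto simp: inj_on_def)
  finally show ?thesis by (simp add: trace_def)
qed

lemma esym_scale: "esym k (map_matrix ((*) t) X) = t ^ k * esym k X"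
  unfolding esym_def sum_distrib_left
  by (intro sum.cong refl) (auto simp: prod.distrib)

text \<open>The polynomial det (X + t), whose roots are the negatives of the eigenvalues; this sign
  convention fits the decomposition A = Y + t.\<close>

definition charp :: "complex^'n^'n \<Rightarrow> complex poly" where
  "charp X = (\<Sum>k\<le>CARD('n). monom (esym (CARD('n) - k) X) k)"

lemma coeff_charp: "coeff (charp (X::complex^'n^'n)) k = (if k \<le> CARD('n) then esym (CARD('n) - k) X else 0)"
  by (simp add: charp_def coeff_sum)

lemma poly_charp: "poly (charp X) t = det (X + mat t)" for X :: "complex^'n^'n"
proof -
  have "poly (charp X) t = (\<Sum>k\<le>CARD('n). esym (CARD('n) - k) X * t ^ k)"
    by (simp add: charp_def poly_sum poly_monom)
  also have "\<dots> = (\<Sum>k\<le>CARD('n). esym k X * t ^ (CARD('n) - k))"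
    by (rule sum.reindex_bij_witness[of _ "\<lambda>k. CARD('n) - k" "\<lambda>k. CARD('n) - k"]) auto
  finally show ?thesis by (simp add: det_shift_eq)
qed

lemma degree_charp: "degree (charp (X::complex^'n^'n)) = CARD('n)"
  by (rule antisym) (auto intro!: degree_le le_degree simp: coeff_charp)

lemma trace_mat: "trace (mat c :: complex^'n^'n) = of_nat CARD('n) * c"
  by (simp add: trace_def mat_def)

lemma mat_mult_left: "mat c ** X = map_matrix ((*) c) X" for X :: "complex^'n^'n"
  by (simp add: vec_eq_iff matrix_matrix_mult_def mat_def if_distrib if_distribR sum.delta cong: if_cong)

lemma mat_mult_right: "X ** mat c = map_matrix ((*) c) X" for X :: "complex^'n^'n"
  by (simp add: vec_eq_iff matrix_matrix_mult_def mat_def if_distrib if_distribR sum.delta mult.commute cong: if_cong)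

lemma matrix_add_rdistrib': "(A + B) ** C = A ** C + B ** C" for A B C :: "complex^'n^'n"
  by (simp add: vec_eq_iff matrix_matrix_mult_def algebra_simps sum.distrib)

lemma conj_shift:
  fixes X P Q :: "complex^'n^'n"
  assumes "Q ** P = mat 1"
  shows "Q ** (X + mat c) ** P = Q ** X ** P + mat c"
proof -
  have "Q ** mat c ** P = mat c ** (Q ** P)"
    by (simp only: mat_mult_left mat_mult_right[of Q c]) (simp add: vec_eq_iff matrix_matrix_mult_def sum_distrib_left mult.assoc)
  then show ?thesis by (simp add: matrix_add_ldistrib matrix_add_rdistrib' assms)
qed

lemma charp_conj:
  fixes X P Q :: "complex^'n^'n"
  assumes "P ** Q = mat 1" "Q ** P = mat 1"
  shows "charp (Q ** X ** P) = charp X"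
proof -
  have "det Q * det P = 1" by (metis assms(2) det_I det_mul)
  then have "poly (charp (Q ** X ** P)) t = poly (charp X) t" for t
    by (simp add: poly_charp flip: conj_shift[OF assms(2)]) (simp add: det_mul)
  then show ?thesis by (simp flip: poly_eq_poly_eq_iff add: fun_eq_iff)
qed

lemma esym_conj:
  fixes X P Q :: "complex^'n^'n"
  assumes "P ** Q = mat 1" "Q ** P = mat 1"
  shows "esym k (Q ** X ** P) = esym k X"
proof (cases "k \<le> CARD('n)")
  case True
  then have "esym k Y = coeff (charp Y) (CARD('n) - k)" for Y :: "complex^'n^'n" by (simp add: coeff_charp)
  then show ?thesis using charp_conj[OF assms] by metis
qed (simp add: esym_gt)


section \<open>The companion matrix\<close>

text \<open>The index type carries no order, so one numbering by 0, ..., n - 1 is fixed. Companion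
  matrices, Krylov vectors and the weight all refer to it.\<close>

definition idx :: "'n::finite \<Rightarrow> nat" where
  "idx = (SOME f. bij_betw f UNIV {0..<CARD('n)})"

lemma idx_bij: "bij_betw (idx :: 'n::finite \<Rightarrow> nat) UNIV {..<CARD('n)}"
proof -
  have "\<exists>f. bij_betw f (UNIV :: 'n set) {0..<CARD('n)}" by (rule ex_bij_betw_finite_nat) simp
  then show ?thesis unfolding idx_def lessThan_atLeast0 by (rule someI_ex)
qed

definition el :: "nat \<Rightarrow> 'n::finite" where
  "el = inv_into UNIV idx"

lemma idx_less [simp]: "idx (i :: 'n::finite) < CARD('n)"
  using bij_betwE[OF idx_bij] by auto

lemma idx_inj [simp]: "idx i = idx j \<longleftrightarrow> i = j"
  using bij_betw_imp_inj_on[OF idx_bij] by (auto simp: inj_on_def)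

lemma idx_el [simp]: "k < CARD('n) \<Longrightarrow> idx (el k :: 'n::finite) = k"
  unfolding el_def using bij_betw_inv_into_right[OF idx_bij] by auto

lemma el_idx [simp]: "el (idx i) = i"
  unfolding el_def using bij_betw_inv_into_left[OF idx_bij] by auto

lemma sum_idx: "(\<Sum>i\<in>(UNIV :: 'n::finite set). f (idx i)) = (\<Sum>k<CARD('n). f k)"
  by (rule sum.reindex_bij_betw[OF idx_bij])

lemma zero_less_CARD [simp]: "0 < CARD('n::finite)"
  by (simp add: card_gt_0_iff)

text \<open>The companion matrix of the monic polynomial with lower coefficients \<open>a 0\<close>,
  ..., \<open>a (n - 1)\<close>: multiplication by t in the basis 1, t, ..., with the reduction of
  the top power in the last column.\<close>

definition compm :: "(nat \<Rightarrow> complex) \<Rightarrow> complex^'n^'n" where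
  "compm a = (\<chi> i j. if Suc (idx j) = CARD('n) then - a (idx i) else if idx i = Suc (idx j) then 1 else 0)"

definition mvpow :: "complex^'n^'n \<Rightarrow> nat \<Rightarrow> complex^'n \<Rightarrow> complex^'n" where
  "mvpow X k v = ((\<lambda>w. X *v w) ^^ k) v"

lemma mvpow_0 [simp]: "mvpow X 0 v = v" and mvpow_Suc: "mvpow X (Suc k) v = X *v mvpow X k v"
  by (simp_all add: mvpow_def)

lemma mvpow_Suc': "mvpow X (Suc k) v = mvpow X k (X *v v)"
  by (simp add: mvpow_def funpow_swap1)

lemma mvpow_add: "mvpow X k (v + w) = mvpow X k v + mvpow X k w"
  by (induction k) (simp_all add: mvpow_Suc matrix_vector_right_distrib)

lemma mvpow_scale: "mvpow X k (c *s v) = c *s mvpow X k v"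
  by (induction k) (simp_all add: mvpow_Suc vector_scalar_commute)

lemma mvpow_zero [simp]: "mvpow X k 0 = 0"
  using mvpow_scale[of X k 0 0] by simp

section \<open>The Cayley-Hamilton theorem\<close>

text \<open>The adjugate in the form given by Cramer's rule; each entry is a determinant and hence a
  polynomial function.\<close>

definition adjg :: "complex^'n^'n \<Rightarrow> complex^'n^'n" where
  "adjg A = (\<chi> i j. det ((\<chi> k l. if l = i then (if k = j then 1 else 0) else A $ k $ l) :: complex^'n^'n))"

lemma poly_fun_adjg: "poly_fun (\<lambda>A. adjg A $ i $ j)"
proof -
  have "poly_fun (\<lambda>A. det ((\<chi> k l. if l = i then (if k = j then 1 else 0) else A $ k $ l) :: complex^'a^'a))"
  proof (rule poly_fun_compose_det)
    fix k l :: 'a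
    show "poly_fun (\<lambda>A. (\<chi> k l. if l = i then (if k = j then 1 else 0) else A $ k $ l) $ k $ l)"
      by (cases "l = i") auto
  qed
  then show ?thesis by (simp add: adjg_def)
qed

text \<open>Cramer's rule gives the identity for invertible matrices; multiplied by det, it holds
  everywhere, and density removes the factor.\<close>

lemma adjg_mult: "A ** adjg A = mat (det A)" for A :: "complex^'n^'n"
proof -
  have "(A ** adjg A) $ i $ j - mat (det A) $ i $ j = 0" for i j
  proof (rule poly_fun_vanishing_dense[where f = "\<lambda>A. (A ** adjg A) $ i $ j - mat (det A) $ i $ j" and g = det and B = "mat 1"])
    have "poly_fun (\<lambda>A :: complex^'n^'n. (if i = j then 1 else 0) * det A)"
      by (intro poly_fun_mult poly_fun_const poly_fun_det)
    then have "poly_fun (\<lambda>A :: complex^'n^'n. (mat (det A) :: complex^'n^'n) $ i $ j)" by (simp add: mat_def if_distrib if_distribR cong: if_cong)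
    then show "poly_fun (\<lambda>A. (A ** adjg A) $ i $ j - mat (det A) $ i $ j)"
      by (intro poly_fun_diff poly_fun_matrix_mult poly_fun_coord poly_fun_adjg)
    fix A :: "complex^'n^'n"
    show "((A ** adjg A) $ i $ j - mat (det A) $ i $ j) * det A = 0"
    proof (cases "det A = 0")
      case False
      define b :: "complex^'n" where "b = axis j 1"
      define x where "x = (\<chi> k. det (\<chi> i l. if l = k then b $ i else A $ i $ l) / det A)"
      have "A *v x = b" using cramer[OF False, of x b] x_def by simp
      moreover have "x $ k = adjg A $ k $ j / det A" for k
        by (simp add: x_def adjg_def b_def axis_def cong: if_cong)
      ultimately have "(\<Sum>k\<in>UNIV. A $ i $ k * (adjg A $ k $ j / det A)) = b $ i"
        by (auto simp: matrix_vector_mult_def)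
      then have "(A ** adjg A) $ i $ j / det A = b $ i"
        by (simp add: matrix_matrix_mult_def sum_divide_distrib)
      then show ?thesis using False by (auto simp: b_def axis_def mat_def field_simps)
    qed simp
  qed (auto simp: poly_fun_det)
  then show ?thesis by (simp add: vec_eq_iff)
qed

text \<open>Column j of (X + t) adjg (X + t) = det (X + t), compared by powers of t, gives a
  recursion for the coefficient vectors of the adjugate. Applying alternating powers of
  \<open>X\<close> to it makes the sum telescope; the alternating signs come from using X + t
  instead of t - X.\<close>

lemma cayley_hamilton_axis:
  fixes X :: "complex^'n^'n"
  shows "(\<Sum>k\<le>CARD('n). ((- 1) ^ k * coeff (charp X) k) *s mvpow X k (axis j 1)) = 0"
proof -
  have "\<exists>B. \<forall>t. adjg (X + mat t) $ i $ j = poly B t" for i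
    using poly_family_shift[OF poly_fun_adjg[of i j]] unfolding poly_family_def by metis
  then obtain B where B: "\<And>i t. adjg (X + mat t) $ i $ j = poly (B i) t" by metis
  \<comment> \<open>Large enough to contain all terms of the sum and to make the last vector
    \<open>b (Suc N)\<close> vanish.\<close>
  define N where "N = CARD('n) + Max (range (\<lambda>i. degree (B i)))"
  have N: "degree (B i) < N" for i
  proof -
    have "degree (B i) \<le> Max (range (\<lambda>i. degree (B i)))" by (rule Max_ge) auto
    then show ?thesis using zero_less_CARD[where 'n = 'n] unfolding N_def by linarith
  qed
  \<comment> \<open>The shift by \<open>pCons 0\<close> turns multiplication by t into an index
    shift and makes \<open>b 0\<close> zero, so that both ends of the telescoping sum
    vanish.\<close>
  define b where "b k = (\<chi> i. coeff (pCons 0 (B i)) k)" for k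
  define v :: "complex^'n" where "v = axis j 1"
  have eq: "(\<Sum>l\<in>UNIV. smult (X $ i $ l) (B l)) + pCons 0 (B i) = smult (v $ i) (charp X)" for i
  proof -
    have "poly ((\<Sum>l\<in>UNIV. smult (X $ i $ l) (B l)) + pCons 0 (B i)) t = poly (smult (v $ i) (charp X)) t" for t
    proof -
      have m: "mat c $ i $ j = v $ i * c" for c :: complex
        by (simp add: v_def axis_def mat_def)
      have "((X + mat t) ** adjg (X + mat t)) $ i $ j = mat (det (X + mat t)) $ i $ j"
        by (simp only: adjg_mult)
      then show ?thesis unfolding m matrix_add_rdistrib' mat_mult_left
        by (simp add: matrix_matrix_mult_def B poly_sum poly_charp)
    qed
    then show ?thesis by (simp flip: poly_eq_poly_eq_iff add: fun_eq_iff)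
  qed
  have rel: "X *v b (Suc k) + b k = coeff (charp X) k *s v" for k
  proof -
    have "(\<Sum>l\<in>UNIV. X $ i $ l * coeff (B l) k) + coeff (pCons 0 (B i)) k = v $ i * coeff (charp X) k" for i
      using arg_cong[OF eq[of i], of "\<lambda>p. coeff p k"] by (simp add: coeff_sum)
    then show ?thesis by (simp add: vec_eq_iff matrix_vector_mult_def b_def mult.commute)
  qed
  define T where "T k = (- 1) ^ k *s mvpow X k (b k)" for k
  have "(\<Sum>k\<le>CARD('n). ((- 1) ^ k * coeff (charp X) k) *s mvpow X k v) =
    (\<Sum>k\<le>N. ((- 1) ^ k * coeff (charp X) k) *s mvpow X k v)"
    by (rule sum.mono_neutral_left) (auto simp: N_def coeff_charp)
  also have "\<dots> = (\<Sum>k\<le>N. T k - T (Suc k))"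
  proof (rule sum.cong)
    fix k
    have "((- 1) ^ k * coeff (charp X) k) *s mvpow X k v = (- 1) ^ k *s mvpow X k (coeff (charp X) k *s v)"
      by (simp add: mvpow_scale vector_smult_assoc)
    also have "\<dots> = (- 1) ^ k *s (mvpow X (Suc k) (b (Suc k)) + mvpow X k (b k))"
      by (simp add: mvpow_add mvpow_Suc' flip: rel)
    also have "\<dots> = T k - T (Suc k)"
      by (simp add: T_def vec_eq_iff algebra_simps)
    finally show "((- 1) ^ k * coeff (charp X) k) *s mvpow X k v = T k - T (Suc k)" .
  qed simp
  also have "\<dots> = T 0 - T (Suc N)" by (rule sum_telescope)
  also have "b 0 = 0" by (simp add: b_def vec_eq_iff)
  then have "T 0 = 0" by (simp add: T_def)
  also have "b (Suc N) = 0" by (simp add: b_def vec_eq_iff coeff_eq_0 N)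
  then have "T (Suc N) = 0" by (simp add: T_def)
  finally show ?thesis by (simp add: v_def)
qed

text \<open>The coefficients of det (t - X), obtained from those of det (X + t) by a sign.\<close>

definition acoef :: "complex^'n^'n \<Rightarrow> nat \<Rightarrow> complex" where
  "acoef X k = (- 1) ^ (CARD('n) + k) * coeff (charp X) k"

lemma mvpow_CARD:
  fixes X :: "complex^'n^'n"
  shows "mvpow X CARD('n) (axis j 1) = (\<Sum>k<CARD('n). (- acoef X k) *s mvpow X k (axis j 1))"
proof -
  have "(\<Sum>k\<le>CARD('n). ((- 1) ^ k * coeff (charp X) k) *s mvpow X k (axis j 1)) =
     (- 1) ^ CARD('n) *s mvpow X CARD('n) (axis j 1) + (\<Sum>k<CARD('n). ((- 1) ^ k * coeff (charp X) k) *s mvpow X k (axis j 1))"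
    by (simp add: lessThan_Suc_atMost[symmetric] coeff_charp)
  then have "(- 1) ^ CARD('n) *s ((- 1) ^ CARD('n) *s mvpow X CARD('n) (axis j 1) +
      (\<Sum>k<CARD('n). ((- 1) ^ k * coeff (charp X) k) *s mvpow X k (axis j 1))) = 0"
    by (simp add: cayley_hamilton_axis)
  then have "mvpow X CARD('n) (axis j 1) + (\<Sum>k<CARD('n). acoef X k *s mvpow X k (axis j 1)) = 0"
    by (simp add: vector_add_ldistrib vector_smult_assoc acoef_def power_add mult.assoc
        flip: power_mult_distrib) (simp add: vec_eq_iff sum_distrib_left mult.assoc flip: power_mult_distrib)
  then show ?thesis by (simp add: eq_neg_iff_add_eq_0 vec_eq_iff sum_negf)
qed

section \<open>Invariant polynomials\<close>

text \<open>The columns are e, X e, X (X e), ... for the first coordinate vector e, so the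
  determinant is nonzero exactly when e is cyclic for \<open>X\<close>.\<close>

definition krylov :: "complex^'n^'n \<Rightarrow> complex^'n^'n" where
  "krylov X = (\<chi> i j. mvpow X (idx j) (axis (el 0) 1) $ i)"

lemma poly_fun_mvpow: "poly_fun (\<lambda>X. mvpow X k v $ i)"
proof (induction k arbitrary: i)
  case (Suc k)
  then show ?case by (auto simp: mvpow_Suc matrix_vector_mult_def intro!: poly_fun_sum)
qed simp

lemma poly_fun_det_krylov: "poly_fun (\<lambda>X. det (krylov X))"
  by (rule poly_fun_compose_det) (simp add: krylov_def poly_fun_mvpow)

text \<open>\<open>X\<close> sends each Krylov column to the next one; for the last column the
  Cayley-Hamilton relation supplies the coefficients.\<close>

lemma krylov_conj: "X ** krylov X = krylov X ** compm (acoef X)" for X :: "complex^'n^'n"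
proof -
  let ?v = "axis (el 0) 1 :: complex^'n"
  have "(X ** krylov X) $ i $ j = (krylov X ** compm (acoef X)) $ i $ j" for i j
  proof -
    have l: "(X ** krylov X) $ i $ j = mvpow X (Suc (idx j)) ?v $ i"
      by (simp add: mvpow_Suc matrix_matrix_mult_def krylov_def matrix_vector_mult_def)
    have r: "(krylov X ** compm (acoef X)) $ i $ j = (\<Sum>l\<in>UNIV. mvpow X (idx l) ?v $ i * compm (acoef X) $ l $ j)"
      by (simp add: matrix_matrix_mult_def krylov_def)
    show ?thesis
    proof (cases "Suc (idx j) = CARD('n)")
      case True
      have "(\<Sum>l\<in>UNIV. mvpow X (idx l) ?v $ i * compm (acoef X) $ l $ j) =
        (\<Sum>l\<in>(UNIV::'n set). - acoef X (idx l) * mvpow X (idx l) ?v $ i)"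
        using True by (simp add: compm_def mult.commute)
      also have "\<dots> = (\<Sum>k<CARD('n). - acoef X k * mvpow X k ?v $ i)"
        by (rule sum_idx)
      also have "\<dots> = mvpow X (Suc (idx j)) ?v $ i"
        unfolding True by (simp add: mvpow_CARD)
      finally show ?thesis using l r by simp
    next
      case False
      then have s: "Suc (idx j) < CARD('n)" using idx_less[of j] by linarith
      then have "idx l = Suc (idx j) \<longleftrightarrow> l = el (Suc (idx j))" for l :: 'n by (metis el_idx idx_el)
      then have "(\<Sum>l\<in>UNIV. mvpow X (idx l) ?v $ i * compm (acoef X) $ l $ j) =
        (\<Sum>l\<in>(UNIV::'n set). if l = el (Suc (idx j)) then mvpow X (idx l) ?v $ i else 0)"
        using False by (intro sum.cong) (auto simp: compm_def)
      then show ?thesis using l r s by simp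
    qed
  qed
  then show ?thesis by (simp add: vec_eq_iff)
qed

text \<open>A matrix for which the first coordinate vector is cyclic, the nonvanishing point
  required by the density argument: the nilpotent shift runs through the coordinate vectors.\<close>

lemma det_krylov_compm: "det (krylov (compm (\<lambda>_. 0) :: complex^'n^'n)) = 1"
proof -
  have "k < CARD('n) \<Longrightarrow> mvpow (compm (\<lambda>_. 0) :: complex^'n^'n) k (axis (el 0) 1) = axis (el k) 1" for k
  proof (induction k)
    case (Suc k)
    then have "mvpow (compm (\<lambda>_. 0) :: complex^'n^'n) (Suc k) (axis (el 0) 1) =
      (compm (\<lambda>_. 0) :: complex^'n^'n) *v axis (el k) 1" by (simp add: mvpow_Suc)
    also have "\<dots> = axis (el (Suc k)) 1"
    proof -
      have "idx i = Suc k \<longleftrightarrow> i = el (Suc k)" for i :: 'n using Suc.prems by (metis el_idx idx_el)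
      then show ?thesis using Suc.prems
        by (simp add: vec_eq_iff matrix_vector_mult_def axis_def compm_def if_distrib cong: if_cong)
    qed
    finally show ?case .
  qed simp
  then have "krylov (compm (\<lambda>_. 0) :: complex^'n^'n) = mat 1"
    by (auto simp: krylov_def vec_eq_iff mat_def axis_def)
  then show ?thesis by simp
qed

lemma det_mat: "det (mat c :: complex^'n^'n) = c ^ CARD('n)"
  by (subst det_diagonal) (auto simp: mat_def)

lemma matrix_inv_eqI:
  fixes g h :: "complex^'n^'n"
  assumes "g ** h = mat 1" "h ** g = mat 1"
  shows "matrix_inv g = h"
proof -
  have "\<exists>h. g ** h = mat 1 \<and> h ** g = mat 1" using assms by blast
  from someI_ex[OF this] have "matrix_inv g ** g = mat 1" by (simp add: matrix_inv_def)
  then have "matrix_inv g = matrix_inv g ** (g ** h)" by (simp add: assms)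
  also have "\<dots> = h" using \<open>matrix_inv g ** g = mat 1\<close> by (simp add: matrix_mul_assoc)
  finally show ?thesis .
qed

text \<open>Multiplying \<open>K\<close> by an n-th root of 1 / det K brings it into
  \<open>SL\<close>; scalars are central, so conjugation is unchanged.\<close>

lemma SL_conj_GL:
  fixes K L :: "complex^'n^'n"
  assumes "K ** L = mat 1" "L ** K = mat 1"
  obtains g where "g \<in> SL" "\<And>X. matrix_inv g ** X ** g = L ** X ** K"
proof -
  have "det L * det K = 1" using assms by (metis det_I det_mul)
  then have "det K \<noteq> 0" by auto
  obtain c where c: "1 / det K = c ^ CARD('n)" using exists_complex_root[of "CARD('n)" "1 / det K"] by auto
  then have "c \<noteq> 0" using \<open>det K \<noteq> 0\<close> by (metis divide_eq_0_iff one_neq_zero power_0_left zero_less_CARD less_irrefl)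
  define g where "g = mat c ** K"
  have "g \<in> SL" using c \<open>det K \<noteq> 0\<close> by (simp add: SL_def g_def det_mul det_mat flip: c)
  have inv: "matrix_inv g = L ** mat (1 / c)"
  proof (rule matrix_inv_eqI)
    have "mat c ** mat (1 / c) = (mat 1 :: complex^'n^'n)" "mat (1 / c) ** mat c = (mat 1 :: complex^'n^'n)"
      using \<open>c \<noteq> 0\<close> by (simp_all add: mat_mult_left vec_eq_iff) (simp_all add: mat_def)
    note c = this
    have "g ** (L ** mat (1 / c)) = mat c ** (K ** L) ** mat (1 / c)"
      by (simp add: g_def matrix_mul_assoc)
    then show "g ** (L ** mat (1 / c)) = mat 1" by (simp add: assms c)
    have "L ** mat (1 / c) ** g = L ** (mat (1 / c) ** mat c) ** K"
      by (simp add: g_def matrix_mul_assoc)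
    then show "L ** mat (1 / c) ** g = mat 1" by (simp only: assms c matrix_mul_rid)
  qed
  have "matrix_inv g ** X ** g = L ** X ** K" for X
  proof -
    have "mat (1 / c) ** X ** mat c = X"
      using \<open>c \<noteq> 0\<close> by (simp add: mat_mult_left mat_mult_right vec_eq_iff)
    then have "L ** (mat (1 / c) ** X ** mat c) ** K = L ** X ** K" by simp
    then show ?thesis unfolding inv by (simp add: g_def matrix_mul_assoc)
  qed
  with \<open>g \<in> SL\<close> that show thesis by blast
qed

inductive symring :: "(complex^'n^'n \<Rightarrow> complex) \<Rightarrow> bool" where
  const: "symring (\<lambda>_. c)"
| esym: "symring (esym k)"
| add: "symring f \<Longrightarrow> symring g \<Longrightarrow> symring (\<lambda>X. f X + g X)"
| mult: "symring f \<Longrightarrow> symring g \<Longrightarrow> symring (\<lambda>X. f X * g X)"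

lemma symring_poly_fun: "symring f \<Longrightarrow> poly_fun f"
  by (induction rule: symring.induct) auto

lemma symring_sum: "(\<And>i. i \<in> I \<Longrightarrow> symring (f i)) \<Longrightarrow> symring (\<lambda>X. \<Sum>i\<in>I. f i X)"
  by (induction I rule: infinite_finite_induct) (auto intro: symring.intros)

lemma symring_conj:
  fixes P Q :: "complex^'n^'n"
  assumes "symring f" "P ** Q = mat 1" "Q ** P = mat 1" shows "f (Q ** X ** P) = f X"
  using assms(1) by (induction rule: symring.induct) (simp_all add: esym_conj[OF assms(2,3)])

text \<open>Where the first coordinate vector is cyclic, X is conjugate to the companion matrix
  \<open>compm (acoef X)\<close>, so \<open>p\<close> takes the same value at both; density extends
  this to every X. The entries of the companion matrix are 0, 1 or signed values of
  \<open>esym\<close>, which makes the right-hand side visibly symmetric.\<close>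

lemma invariant_symring:
  fixes p :: "complex^'n^'n \<Rightarrow> complex"
  assumes "poly_fun p" and inv: "\<And>g X. g \<in> SL \<Longrightarrow> p (matrix_inv g ** X ** g) = p X"
  shows "symring p"
proof -
  have co: "symring (\<lambda>X :: complex^'n^'n. compm (acoef X) $ i $ j :: complex)" for i j :: 'n
  proof -
    have "symring (\<lambda>X :: complex^'n^'n. - ((- 1) ^ (CARD('n) + idx i)) * esym (CARD('n) - idx i) X)"
      by (intro symring.intros)
    moreover have "idx i \<le> CARD('n)" using idx_less[of i] by linarith
    ultimately show ?thesis
      by (cases "Suc (idx j) = CARD('n)"; cases "idx i = Suc (idx j)")
         (simp_all add: compm_def acoef_def coeff_charp symring.const)
  qed
  have pc: "symring (\<lambda>X :: complex^'n^'n. p (compm (acoef X)))"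
    using assms(1) by (induction rule: poly_fun_induct) (auto intro: symring.intros co)
  have "p X - p (compm (acoef X)) = 0" for X
  proof (rule poly_fun_vanishing_dense[where f = "\<lambda>X. p X - p (compm (acoef X))" and g = "\<lambda>X. det (krylov X)" and B = "compm (\<lambda>_. 0)"])
    show "poly_fun (\<lambda>X. p X - p (compm (acoef X)))"
      using assms(1) symring_poly_fun[OF pc] by auto
    show "(p X - p (compm (acoef X))) * det (krylov X) = 0" for X
    proof (cases "det (krylov X) = 0")
      case False
      then obtain L where L: "krylov X ** L = mat 1" "L ** krylov X = mat 1"
        using invertible_det_nz[of "krylov X"] unfolding invertible_def by blast
      obtain g where g: "g \<in> SL" "\<And>Y. matrix_inv g ** Y ** g = L ** Y ** krylov X"
        using SL_conj_GL[OF L] by blast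
      have "L ** X ** krylov X = L ** (krylov X ** compm (acoef X))"
        by (simp add: krylov_conj flip: matrix_mul_assoc)
      also have "\<dots> = compm (acoef X)" by (simp add: matrix_mul_assoc L)
      finally have "p X = p (compm (acoef X))" using inv[OF g(1), of X] g(2) by metis
      then show ?thesis by simp
    qed simp
  qed (auto simp: poly_fun_det_krylov det_krylov_compm)
  then have "p = (\<lambda>X. p (compm (acoef X)))" by auto
  then show ?thesis using pc by simp
qed


section \<open>Monomials\<close>

type_synonym 'n expo = "'n \<times> 'n \<Rightarrow> nat"

definition mfun :: "'n expo \<Rightarrow> complex^'n^'n \<Rightarrow> complex" where
  "mfun \<alpha> X = (\<Prod>p\<in>UNIV. (X $ fst p $ snd p) ^ \<alpha> p)"

definition mdeg :: "'n::finite expo \<Rightarrow> nat" where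
  "mdeg \<alpha> = (\<Sum>p\<in>UNIV. \<alpha> p)"

text \<open>For this weight the lightest monomial of the \<open>m + 1\<close>-st coefficient of the characteristic polynomial is
  the antidiagonal one, the product of the entries with \<open>i + j = m\<close> (indices from 0), and these monomials
  have pairwise disjoint supports.\<close>

definition mwt :: "'n::finite expo \<Rightarrow> nat" where
  "mwt \<alpha> = (\<Sum>p\<in>UNIV. \<alpha> p * (idx (fst p) + idx (snd p))\<^sup>2)"

lemma mfun_add: "mfun (\<alpha> + \<beta>) X = mfun \<alpha> X * mfun \<beta> X"
  by (simp add: mfun_def power_add prod.distrib)

lemma mdeg_add: "mdeg (\<alpha> + \<beta>) = mdeg \<alpha> + mdeg \<beta>"
  by (simp add: mdeg_def sum.distrib)

lemma mwt_add: "mwt (\<alpha> + \<beta>) = mwt \<alpha> + mwt \<beta>"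
  by (simp add: mwt_def sum.distrib algebra_simps)

lemma mfun_0 [simp]: "mfun 0 = (\<lambda>_. 1)"
  by (simp add: mfun_def fun_eq_iff)

lemma poly_fun_mfun [intro]: "poly_fun (mfun \<alpha>)"
  unfolding mfun_def by (intro poly_fun_prod poly_fun_power poly_fun_coord)

lemma mfun_scale: "mfun \<alpha> (map_matrix ((*) t) X) = t ^ mdeg \<alpha> * mfun \<alpha> X"
  by (simp add: mfun_def mdeg_def power_mult_distrib prod.distrib power_sum)

lemma mfun_separate:
  fixes \<alpha> \<beta> :: "'n::finite expo"
  assumes "\<alpha> \<noteq> \<beta>"
  obtains Y where "mfun \<alpha> Y \<noteq> mfun \<beta> Y"
proof -
  from assms obtain q where q: "\<alpha> q \<noteq> \<beta> q" by (meson ext)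
  define Y :: "complex^'n^'n" where "Y = (\<chi> i j. if (i, j) = q then 2 else 1)"
  have "mfun \<gamma> Y = 2 ^ \<gamma> q" for \<gamma> :: "'n expo"
  proof -
    have "mfun \<gamma> Y = (\<Prod>p\<in>UNIV. if p = q then 2 ^ \<gamma> p else 1)"
      unfolding mfun_def Y_def by (rule prod.cong) auto
    then show ?thesis by simp
  qed
  moreover have "(2::complex) ^ \<alpha> q \<noteq> 2 ^ \<beta> q"
  proof
    assume "(2::complex) ^ \<alpha> q = 2 ^ \<beta> q"
    then have "cmod (2 ^ \<alpha> q) = cmod (2 ^ \<beta> q)" by simp
    then have "(2::real) ^ \<alpha> q = 2 ^ \<beta> q" by (simp add: norm_power)
    with q show False by simp
  qed
  ultimately show thesis using that[of Y] by simp
qed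

text \<open>Monomials are multiplicative for the entrywise product of matrices, so this is Dedekind's
  independence of characters.\<close>

lemma mfun_independent:
  fixes S :: "'n::finite expo set"
  assumes "finite S" "\<And>X. (\<Sum>\<alpha>\<in>S. z \<alpha> * mfun \<alpha> X) = 0" "\<alpha> \<in> S"
  shows "z \<alpha> = 0"
  using assms
proof (induction "card S" arbitrary: S z \<alpha>)
  case (Suc m)
  have *: "z \<beta> = 0" if "\<beta> \<in> S" "\<gamma> \<in> S" and ne: "\<beta> \<noteq> \<gamma>" for \<beta> \<gamma>
  proof -
    obtain Y where Y: "mfun \<beta> Y \<noteq> mfun \<gamma> Y" using mfun_separate[OF ne] .
    have "z \<beta> * (mfun \<beta> Y - mfun \<gamma> Y) = 0"
    proof (rule Suc.hyps(1)[of "S - {\<gamma>}" "\<lambda>\<beta>. z \<beta> * (mfun \<beta> Y - mfun \<gamma> Y)" \<beta>])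
      show "m = card (S - {\<gamma>})" using Suc.hyps(2) that Suc.prems(1) by simp
      fix X :: "complex^'n^'n"
      have mult: "mfun \<delta> (\<chi> i j. X $ i $ j * Y $ i $ j) = mfun \<delta> X * mfun \<delta> Y" for \<delta> :: "'n expo"
        by (simp add: mfun_def power_mult_distrib prod.distrib)
      have "(\<Sum>\<delta>\<in>S. z \<delta> * (mfun \<delta> Y - mfun \<gamma> Y) * mfun \<delta> X) =
        (\<Sum>\<delta>\<in>S. z \<delta> * mfun \<delta> (\<chi> i j. X $ i $ j * Y $ i $ j)) - mfun \<gamma> Y * (\<Sum>\<delta>\<in>S. z \<delta> * mfun \<delta> X)"
        by (simp add: mult sum_distrib_left algebra_simps sum_subtractf)
      also have "\<dots> = 0" by (simp only: Suc.prems(2)) simp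
      finally show "(\<Sum>\<delta>\<in>S - {\<gamma>}. z \<delta> * (mfun \<delta> Y - mfun \<gamma> Y) * mfun \<delta> X) = 0"
        using Suc.prems(1) that by (simp add: sum.remove[of S \<gamma>])
    qed (use Suc.prems that in auto)
    then show ?thesis using Y by simp
  qed
  show ?case
  proof (cases "\<exists>\<gamma>\<in>S. \<gamma> \<noteq> \<alpha>")
    case False
    then have "S = {\<alpha>}" using Suc.prems(3) by blast
    moreover have "mfun \<alpha> (\<chi> i j. 1) = 1" by (simp add: mfun_def)
    ultimately show ?thesis using Suc.prems(2)[of "\<chi> i j. 1"] by simp
  qed (use * Suc.prems in blast)
qed simp

section \<open>Monomials as a basis of the polynomial functions\<close>

interpretation fv: vector_space "\<lambda>(c::complex) (f :: complex^'n^'n \<Rightarrow> complex) X. c * f X"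
  by unfold_locales (auto simp: algebra_simps fun_eq_iff)

lemma inj_mfun: "inj (mfun :: 'n::finite expo \<Rightarrow> _)"
  by (rule injI) (metis mfun_separate)

lemma independent_mfun: "fv.independent (range (mfun :: 'n::finite expo \<Rightarrow> _))"
  unfolding fv.independent_explicit_finite_subsets
proof (intro allI impI ballI)
  fix S :: "(complex^'n^'n \<Rightarrow> complex) set" and u v
  assume S: "S \<subseteq> range mfun" "finite S" "(\<Sum>v\<in>S. (\<lambda>X. u v * v X)) = 0" "v \<in> S"
  obtain T where T: "S = mfun ` T" "finite T"
    using finite_subset_image[OF S(2,1)] by auto
  then obtain \<alpha> where \<alpha>: "v = mfun \<alpha>" "\<alpha> \<in> T" using S(4) by auto
  have "(\<Sum>\<alpha>\<in>T. u (mfun \<alpha>) * mfun \<alpha> X) = 0" for X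
  proof -
    have "(\<Sum>\<alpha>\<in>T. u (mfun \<alpha>) * mfun \<alpha> X) = (\<Sum>v\<in>S. u v * v X)"
      unfolding T(1) by (subst sum.reindex) (auto intro: inj_on_subset[OF inj_mfun])
    also have "\<dots> = (\<Sum>v\<in>S. (\<lambda>X. u v * v X)) X" by (induction S rule: infinite_finite_induct) auto
    finally show ?thesis using S(3) by simp
  qed
  from mfun_independent[OF T(2) this \<alpha>(2)] show "u v = 0" by (simp add: \<alpha>)
qed

lemma fv_span_mult:
  assumes "f \<in> fv.span A" "g \<in> fv.span B" "\<And>a b. a \<in> A \<Longrightarrow> b \<in> B \<Longrightarrow> (\<lambda>X. a X * b X) \<in> fv.span C"
  shows "(\<lambda>X. f X * g X) \<in> fv.span C"
proof -
  have 1: "(\<lambda>X. a X * g X) \<in> fv.span C" if "a \<in> A" for a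
    using assms(2)
  proof (induction rule: fv.span_induct_alt)
    case base
    show ?case using fv.span_zero[of C] by (simp add: zero_fun_def)
  next
    case (step c x y)
    have "(\<lambda>X. c * (a X * x X)) + (\<lambda>X. a X * y X) \<in> fv.span C"
      by (intro fv.span_add step fv.span_scale assms(3) that)
    moreover have "(\<lambda>X. c * (a X * x X)) + (\<lambda>X. a X * y X) = (\<lambda>X. a X * ((\<lambda>X. c * x X) + y) X)"
      by (simp add: fun_eq_iff algebra_simps)
    ultimately show ?case by simp
  qed
  show ?thesis using assms(1)
  proof (induction rule: fv.span_induct_alt)
    case base
    show ?case using fv.span_zero[of C] by (simp add: zero_fun_def)
  next
    case (step c x y)
    have "(\<lambda>X. c * (x X * g X)) + (\<lambda>X. y X * g X) \<in> fv.span C"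
      by (intro fv.span_add step fv.span_scale 1)
    moreover have "(\<lambda>X. c * (x X * g X)) + (\<lambda>X. y X * g X) = (\<lambda>X. ((\<lambda>X. c * x X) + y) X * g X)"
      by (simp add: fun_eq_iff algebra_simps)
    ultimately show ?case by simp
  qed
qed

lemma poly_fun_span_mfun:
  fixes p :: "complex^'n^'n \<Rightarrow> complex"
  assumes "poly_fun p" shows "p \<in> fv.span (range mfun)"
  using assms
proof (induction rule: poly_fun_induct)
  case (const c)
  have "(\<lambda>X. c * mfun 0 X) \<in> fv.span (range (mfun :: 'n expo \<Rightarrow> _))"
    by (intro fv.span_scale fv.span_base rangeI)
  then show ?case by simp
next
  case (coord i j)
  have "mfun (\<lambda>p. if p = (i, j) then 1 else 0) X = X $ i $ j" for X
  proof -
    have "mfun (\<lambda>p. if p = (i, j) then 1 else 0) X = (\<Prod>p\<in>UNIV. if p = (i, j) then X $ fst p $ snd p else 1)"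
      unfolding mfun_def by (rule prod.cong) auto
    then show ?thesis by simp
  qed
  then have "(\<lambda>X. X $ i $ j) = mfun (\<lambda>p. if p = (i, j) then 1 else 0)" by auto
  then show ?case by (metis fv.span_base rangeI)
next
  case (add f g)
  then show ?case using fv.span_add[of f _ g] by (simp add: plus_fun_def)
next
  case (mult f g)
  show ?case
  proof (rule fv_span_mult[OF mult.IH])
    fix a b :: "complex^'n^'n \<Rightarrow> complex"
    assume "a \<in> range mfun" "b \<in> range mfun"
    then obtain \<alpha> \<beta> where "a = mfun \<alpha>" "b = mfun \<beta>" by auto
    then have "(\<lambda>X. a X * b X) = mfun (\<alpha> + \<beta>)" by (simp add: mfun_add fun_eq_iff)
    then show "(\<lambda>X. a X * b X) \<in> fv.span (range mfun)" by (metis fv.span_base rangeI)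
  qed
qed


section \<open>Leading monomials\<close>

text \<open>The lightest monomial leads, so error terms are heavier. Keeping the degree fixed bounds
  the weights, and hence an induction towards heavier monomials terminates.\<close>

definition heavier :: "nat \<Rightarrow> nat \<Rightarrow> (complex^'n^'n \<Rightarrow> complex) set" where
  "heavier d w = fv.span (mfun ` {\<alpha>. mdeg \<alpha> = d \<and> w < mwt \<alpha>})"

definition leading :: "(complex^'n^'n \<Rightarrow> complex) \<Rightarrow> 'n expo \<Rightarrow> complex \<Rightarrow> bool" where
  "leading f \<alpha> z \<longleftrightarrow> (\<lambda>X. f X - z * mfun \<alpha> X) \<in> heavier (mdeg \<alpha>) (mwt \<alpha>)"

lemma heavier_mult:
  assumes "f \<in> heavier d w" "g \<in> heavier d' w'"
  shows "(\<lambda>X. f X * g X) \<in> heavier (d + d') (w + w')"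
  unfolding heavier_def
proof (rule fv_span_mult[OF assms[unfolded heavier_def]])
  fix a b :: "complex^'a^'a \<Rightarrow> complex"
  assume "a \<in> mfun ` {\<alpha>. mdeg \<alpha> = d \<and> w < mwt \<alpha>}" "b \<in> mfun ` {\<alpha>. mdeg \<alpha> = d' \<and> w' < mwt \<alpha>}"
  then obtain \<alpha> \<beta> where *: "a = mfun \<alpha>" "b = mfun \<beta>" "mdeg \<alpha> = d" "w < mwt \<alpha>" "mdeg \<beta> = d'" "w' < mwt \<beta>"
    by auto
  then have "(\<lambda>X. a X * b X) = mfun (\<alpha> + \<beta>)" by (simp add: mfun_add fun_eq_iff)
  moreover have "mdeg (\<alpha> + \<beta>) = d + d'" "w + w' < mwt (\<alpha> + \<beta>)" using * by (auto simp: mdeg_add mwt_add)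
  ultimately show "(\<lambda>X. a X * b X) \<in> fv.span (mfun ` {\<alpha>. mdeg \<alpha> = d + d' \<and> w + w' < mwt \<alpha>})"
    by (metis (mono_tags, lifting) fv.span_base image_eqI mem_Collect_eq)
qed

lemma heavier_mfun_mult:
  assumes "g \<in> heavier d' w'"
  shows "(\<lambda>X. mfun \<alpha> X * g X) \<in> heavier (mdeg \<alpha> + d') (mwt \<alpha> + w')"
  unfolding heavier_def
proof (rule fv_span_mult[OF fv.span_base[of "mfun \<alpha>" "{mfun \<alpha>}"] assms[unfolded heavier_def]])
  fix a b :: "complex^'a^'a \<Rightarrow> complex"
  assume "a \<in> {mfun \<alpha>}" "b \<in> mfun ` {\<alpha>. mdeg \<alpha> = d' \<and> w' < mwt \<alpha>}"
  then obtain \<beta> where *: "a = mfun \<alpha>" "b = mfun \<beta>" "mdeg \<beta> = d'" "w' < mwt \<beta>"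
    by auto
  then have "(\<lambda>X. a X * b X) = mfun (\<alpha> + \<beta>)" by (simp add: mfun_add fun_eq_iff)
  moreover have "mdeg (\<alpha> + \<beta>) = mdeg \<alpha> + d'" "mwt \<alpha> + w' < mwt (\<alpha> + \<beta>)" using * by (auto simp: mdeg_add mwt_add)
  ultimately show "(\<lambda>X. a X * b X) \<in> fv.span (mfun ` {\<gamma>. mdeg \<gamma> = mdeg \<alpha> + d' \<and> mwt \<alpha> + w' < mwt \<gamma>})"
    by (metis (mono_tags, lifting) fv.span_base image_eqI mem_Collect_eq)
qed simp

lemma heavier_add: "f \<in> heavier d w \<Longrightarrow> g \<in> heavier d w \<Longrightarrow> (\<lambda>X. f X + g X) \<in> heavier d w"
  using fv.span_add[of f _ g] unfolding heavier_def by (simp add: plus_fun_def)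

lemma heavier_scale: "f \<in> heavier d w \<Longrightarrow> (\<lambda>X. c * f X) \<in> heavier d w"
  unfolding heavier_def by (rule fv.span_scale)

lemma leading_mult:
  assumes "leading f \<alpha> z" "leading g \<beta> y"
  shows "leading (\<lambda>X. f X * g X) (\<alpha> + \<beta>) (z * y)"
proof -
  have "(\<lambda>X. (f X - z * mfun \<alpha> X) * (g X - y * mfun \<beta> X) + z * (mfun \<alpha> X * (g X - y * mfun \<beta> X)) +
      y * (mfun \<beta> X * (f X - z * mfun \<alpha> X))) \<in> heavier (mdeg (\<alpha> + \<beta>)) (mwt (\<alpha> + \<beta>))"
    using heavier_mult[OF assms[unfolded leading_def]] heavier_mfun_mult[OF assms(2)[unfolded leading_def], of \<alpha>]
      heavier_mfun_mult[OF assms(1)[unfolded leading_def], of \<beta>]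
    by (intro heavier_add heavier_scale) (auto simp: mdeg_add mwt_add add.commute)
  then show ?thesis unfolding leading_def by (simp add: mfun_add algebra_simps)
qed

lemma leading_mfun: "leading (mfun \<alpha>) \<alpha> 1"
  unfolding leading_def heavier_def using fv.span_zero by (simp add: zero_fun_def)

lemma leading_one: "leading (\<lambda>X. 1) (\<lambda>p. 0) 1"
proof -
  have "mfun (\<lambda>p :: 'a \<times> 'a. 0) = (\<lambda>_. 1)" by (simp add: mfun_def fun_eq_iff)
  then show ?thesis using leading_mfun[of "\<lambda>p :: 'a \<times> 'a. 0"] by simp
qed

lemma leading_power: "leading f \<alpha> z \<Longrightarrow> leading (\<lambda>X. f X ^ k) (\<lambda>p. k * \<alpha> p) (z ^ k)"
proof (induction k)
  case 0
  show ?case using leading_one by simp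
next
  case (Suc k)
  then show ?case using leading_mult[of f \<alpha> z "\<lambda>X. f X ^ k" "\<lambda>p. k * \<alpha> p" "z ^ k"]
    by (simp add: plus_fun_def)
qed

lemma leading_prod:
  assumes "finite Q" "\<And>q. q \<in> Q \<Longrightarrow> leading (f q) (\<alpha> q) (z q)"
  shows "leading (\<lambda>X. \<Prod>q\<in>Q. f q X) (\<lambda>p. \<Sum>q\<in>Q. \<alpha> q p) (\<Prod>q\<in>Q. z q)"
  using assms
proof (induction Q)
  case empty
  show ?case using leading_one by simp
next
  case (insert q Q)
  then show ?case using leading_mult[of "f q" "\<alpha> q" "z q" "\<lambda>X. \<Prod>q\<in>Q. f q X"]
    by (simp add: plus_fun_def)
qed

section \<open>Weights of permutation monomials and the antidiagonals\<close>

lemma sum_nat_ge: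
  assumes "finite (S :: nat set)" shows "\<Sum>{..<card S} \<le> \<Sum>S"
  using assms
proof (induction rule: finite_linorder_max_induct)
  case (insert b A)
  then have "A \<subseteq> {..<b}" "b \<notin> A" by auto
  then have "card A \<le> b" using card_mono[of "{..<b}" A] by simp
  with insert \<open>b \<notin> A\<close> show ?case by simp
qed simp

text \<open>With \<open>x\<^sub>i = i + \<pi> i\<close> one has \<open>\<Sum> x\<^sub>i\<^sup>2 = \<Sum> (x\<^sub>i - m)\<^sup>2 + 2 m \<Sum> x\<^sub>i - (m + 1) m\<^sup>2\<close>, and
  \<open>\<Sum> x\<^sub>i = 2 \<Sum> i \<ge> m (m + 1)\<close>.\<close>

lemma weight_bound:
  fixes T :: "'n::finite set"
  assumes "\<pi> permutes T" "card T = Suc m"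
  shows "Suc m * m\<^sup>2 \<le> (\<Sum>i\<in>T. (idx i + idx (\<pi> i))\<^sup>2)"
    "(\<Sum>i\<in>T. (idx i + idx (\<pi> i))\<^sup>2) \<le> Suc m * m\<^sup>2 \<Longrightarrow> i \<in> T \<Longrightarrow> idx i + idx (\<pi> i) = m"
proof -
  define x where "x i = int (idx i + idx (\<pi> i))" for i
  have "\<Sum>{..<card (idx ` T)} \<le> \<Sum>(idx ` T)" by (rule sum_nat_ge) simp
  moreover have "card (idx ` T) = Suc m" by (simp add: card_image inj_on_def assms)
  moreover have "\<Sum>(idx ` T) = (\<Sum>i\<in>T. idx i)" by (subst sum.reindex) (auto simp: inj_on_def)
  ultimately have s: "\<Sum>{..<Suc m} \<le> (\<Sum>i\<in>T. idx i)" by simp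
  have "2 * \<Sum>{..<Suc m} = m * (m + 1)" by (induction m) auto
  with s have s: "m * (m + 1) \<le> 2 * (\<Sum>i\<in>T. idx i)" by linarith
  have "(\<Sum>i\<in>T. idx (\<pi> i)) = (\<Sum>i\<in>T. idx i)"
    using sum.permute[OF assms(1), of idx] by simp
  moreover have "(\<Sum>i\<in>T. x i) = int ((\<Sum>i\<in>T. idx i) + (\<Sum>i\<in>T. idx (\<pi> i)))" by (simp add: x_def sum.distrib)
  ultimately have "(\<Sum>i\<in>T. x i) = int (2 * (\<Sum>i\<in>T. idx i))" by simp
  then have s: "int m * (int m + 1) \<le> (\<Sum>i\<in>T. x i)" using s by (metis of_nat_1 of_nat_add of_nat_le_iff of_nat_mult)
  have "(\<Sum>i\<in>T. (x i)\<^sup>2) = (\<Sum>i\<in>T. (x i - m)\<^sup>2 + 2 * int m * x i - (int m)\<^sup>2)"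
    by (rule sum.cong) (auto simp: power2_eq_square algebra_simps)
  also have "\<dots> = (\<Sum>i\<in>T. (x i - m)\<^sup>2) + 2 * int m * (\<Sum>i\<in>T. x i) - (int m + 1) * (int m)\<^sup>2"
    by (simp add: sum.distrib sum_subtractf sum_distrib_left assms(2))
  finally have e: "(\<Sum>i\<in>T. (x i)\<^sup>2) = (\<Sum>i\<in>T. (x i - m)\<^sup>2) + 2 * int m * (\<Sum>i\<in>T. x i) - (int m + 1) * (int m)\<^sup>2" .
  have "2 * int m * (int m * (int m + 1)) \<le> 2 * int m * (\<Sum>i\<in>T. x i)"
    by (rule mult_left_mono[OF s]) simp
  then have g: "(\<Sum>i\<in>T. (x i - m)\<^sup>2) + (int m + 1) * (int m)\<^sup>2 \<le> (\<Sum>i\<in>T. (x i)\<^sup>2)"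
    unfolding e by (simp add: power2_eq_square algebra_simps)
  have c: "int (\<Sum>i\<in>T. (idx i + idx (\<pi> i))\<^sup>2) = (\<Sum>i\<in>T. (x i)\<^sup>2)" by (simp add: x_def)
  have c': "int (Suc m * m\<^sup>2) = (int m + 1) * (int m)\<^sup>2" by (simp add: algebra_simps)
  have nn: "0 \<le> (\<Sum>i\<in>T. (x i - m)\<^sup>2)" by (rule sum_nonneg) simp
  show "Suc m * m\<^sup>2 \<le> (\<Sum>i\<in>T. (idx i + idx (\<pi> i))\<^sup>2)"
    using g nn c c' by linarith
  assume "(\<Sum>i\<in>T. (idx i + idx (\<pi> i))\<^sup>2) \<le> Suc m * m\<^sup>2" "i \<in> T"
  then have "(\<Sum>i\<in>T. (x i - m)\<^sup>2) = 0" using g nn c c' by linarith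
  then have "(x i - m)\<^sup>2 = 0" using \<open>i \<in> T\<close> by (subst (asm) sum_nonneg_eq_0_iff) auto
  then show "idx i + idx (\<pi> i) = m" by (simp add: x_def)
qed

text \<open>The exponent of the antidiagonal monomial number \<open>idx q\<close>. Since
  \<open>idx q\<close> stays below n, entries with i + j \<ge> n belong to none of these
  monomials.\<close>

definition mu :: "'n::finite \<Rightarrow> 'n expo" where
  "mu q p = (if idx (fst p) + idx (snd p) = idx q then 1 else 0)"

definition anti :: "nat \<Rightarrow> 'n::finite \<Rightarrow> 'n" where
  "anti m i = (if idx i \<le> m then el (m - idx i) else i)"

lemma anti_permutes:
  assumes "m < CARD('n::finite)" shows "anti m permutes {i :: 'n. idx i \<le> m}"
proof -
  have idx_anti: "idx (anti m i :: 'n) = m - idx i" if "idx i \<le> m" for i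
    using assms that by (simp add: anti_def)
  have "anti m (anti m i :: 'n) = i" for i
  proof (cases "idx i \<le> m")
    case True
    then have "idx (anti m i) \<le> m" by (simp add: idx_anti)
    then have "idx (anti m (anti m i)) = idx i" using True by (simp add: idx_anti)
    then show ?thesis by simp
  qed (simp add: anti_def)
  then show ?thesis unfolding permutes_def by (metis anti_def mem_Collect_eq)
qed

definition pexp :: "'n::finite set \<Rightarrow> ('n \<Rightarrow> 'n) \<Rightarrow> 'n expo" where
  "pexp T \<pi> p = (if fst p \<in> T \<and> snd p = \<pi> (fst p) then 1 else 0)"

lemma sum_pexp: "(\<Sum>p\<in>UNIV. pexp T \<pi> p * f p) = (\<Sum>i\<in>T. f (i, \<pi> i))"
proof -
  have "(\<Sum>p\<in>UNIV. pexp T \<pi> p * f p) = (\<Sum>p\<in>(\<lambda>i. (i, \<pi> i)) ` T. f p)"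
    by (rule sum.mono_neutral_cong_right) (auto simp: pexp_def)
  also have "\<dots> = (\<Sum>i\<in>T. f (i, \<pi> i))" by (subst sum.reindex) (auto simp: inj_on_def)
  finally show ?thesis .
qed

lemma mfun_pexp: "mfun (pexp T \<pi>) X = (\<Prod>i\<in>T. X $ i $ \<pi> i)"
proof -
  have "mfun (pexp T \<pi>) X = (\<Prod>p\<in>(\<lambda>i. (i, \<pi> i)) ` T. X $ fst p $ snd p)"
    unfolding mfun_def by (rule prod.mono_neutral_cong_right) (auto simp: pexp_def)
  also have "\<dots> = (\<Prod>i\<in>T. X $ i $ \<pi> i)" by (subst prod.reindex) (auto simp: inj_on_def)
  finally show ?thesis .
qed

lemma mdeg_pexp: "mdeg (pexp T \<pi>) = card T"
  using sum_pexp[of T \<pi> "\<lambda>_. 1"] by (simp add: mdeg_def)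

lemma mwt_pexp: "mwt (pexp T \<pi>) = (\<Sum>i\<in>T. (idx i + idx (\<pi> i))\<^sup>2)"
  unfolding mwt_def by (subst sum_pexp) simp

lemma card_idx_le: "m < CARD('n) \<Longrightarrow> card {i :: 'n::finite. idx i \<le> m} = Suc m"
proof -
  assume "m < CARD('n)"
  then have "x \<in> idx ` {i :: 'n. idx i \<le> m}" if "x \<le> m" for x
    using that by (intro image_eqI[of _ _ "el x"]) auto
  then have "bij_betw idx {i :: 'n. idx i \<le> m} {..m}"
    unfolding bij_betw_def by (auto simp: inj_on_def)
  then show ?thesis by (metis bij_betw_same_card card_atMost)
qed

lemma pexp_anti: "pexp {i. idx i \<le> idx q} (anti (idx q)) = mu (q :: 'n::finite)"
proof
  fix p :: "'n \<times> 'n"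
  show "pexp {i. idx i \<le> idx q} (anti (idx q)) p = mu q p"
  proof (cases "idx (fst p) \<le> idx q")
    case True
    have l: "idx q - idx (fst p) < CARD('n)" using idx_less[of q] by linarith
    have "snd p = anti (idx q) (fst p) \<longleftrightarrow> idx (snd p) = idx (anti (idx q) (fst p))" by simp
    also have "\<dots> \<longleftrightarrow> idx (snd p) = idx q - idx (fst p)" using True l by (simp add: anti_def)
    also have "\<dots> \<longleftrightarrow> idx (fst p) + idx (snd p) = idx q" using True by auto
    finally show ?thesis using True by (simp add: pexp_def mu_def)
  qed (simp add: pexp_def mu_def)
qed

definition lsign :: "'n::finite \<Rightarrow> complex" where
  "lsign q = of_int (sign (anti (idx q) :: 'n \<Rightarrow> 'n))"

lemma lsign_nonzero: "lsign q \<noteq> 0"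
  by (simp add: lsign_def sign_def)

text \<open>A term of minimal weight has \<open>idx i + idx (\<pi> i) = m\<close> throughout T by
  \<open>weight_bound\<close>. Then T lies in the first m + 1 indices, equals that set by
  cardinality, and \<pi> is its reversal. So exactly one term is lightest, and its coefficient is a
  sign.\<close>

lemma leading_esym: "leading (esym (Suc (idx q))) (mu q) (lsign (q :: 'n::finite))"
proof -
  define m where "m = idx q"
  have m: "m < CARD('n)" by (simp add: m_def)
  define T0 :: "'n set" where "T0 = {i. idx i \<le> m}"
  define I where "I = (SIGMA T:{T :: 'n set. card T = Suc m}. {\<pi>. \<pi> permutes T})"
  define x0 where "x0 = (T0, anti m :: 'n \<Rightarrow> 'n)"
  have fI: "finite I" unfolding I_def by (intro finite_SigmaI finite_permutations) auto
  have x0: "x0 \<in> I" using card_idx_le[OF m] anti_permutes[OF m] by (simp add: x0_def I_def T0_def)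
  have mu: "pexp T0 (anti m) = mu q" unfolding T0_def m_def by (rule pexp_anti)
  have wt0: "mwt (mu q) = Suc m * m\<^sup>2"
  proof -
    have "mwt (mu q) = (\<Sum>i\<in>T0. (idx i + idx (anti m i))\<^sup>2)" by (simp add: mwt_pexp flip: mu)
    also have "\<dots> = (\<Sum>i\<in>T0. m\<^sup>2)" using m by (intro sum.cong) (auto simp: T0_def anti_def)
    finally show ?thesis using card_idx_le[OF m] by (simp add: T0_def)
  qed
  have dg0: "mdeg (mu q) = Suc m" using card_idx_le[OF m] by (simp add: mdeg_pexp T0_def flip: mu)
  let ?t = "\<lambda>x X. of_int (sign (snd x)) * mfun (pexp (fst x) (snd x)) X :: complex"
  have "esym (Suc m) X = (\<Sum>x\<in>I. ?t x X)" for X :: "complex^'n^'n"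
    unfolding esym_def I_def by (subst sum.Sigma) (auto simp: mfun_pexp finite_permutations split_def)
  then have eq: "esym (Suc m) X - lsign q * mfun (mu q) X = (\<Sum>x\<in>I - {x0}. ?t x X)" for X :: "complex^'n^'n"
    using sum.remove[OF fI x0, of "\<lambda>x. ?t x X"] by (simp add: x0_def mu lsign_def flip: m_def)
  have "(\<lambda>X. \<Sum>x\<in>I - {x0}. ?t x X) \<in> heavier (Suc m) (Suc m * m\<^sup>2)"
  proof -
    have "(\<Sum>x\<in>I - {x0}. ?t x) \<in> heavier (Suc m) (Suc m * m\<^sup>2)"
      unfolding heavier_def
    proof (intro fv.span_sum fv.span_scale fv.span_base imageI CollectI conjI)
      fix x assume x: "x \<in> I - {x0}"
      then have p: "snd x permutes fst x" "card (fst x) = Suc m" by (auto simp: I_def)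
      show "mdeg (pexp (fst x) (snd x)) = Suc m" using p by (simp add: mdeg_pexp)
      show "Suc m * m\<^sup>2 < mwt (pexp (fst x) (snd x))"
      proof (rule ccontr)
        assume "\<not> ?thesis"
        then have *: "idx i + idx (snd x i) = m" if "i \<in> fst x" for i
          using weight_bound(2)[OF p] that by (simp add: mwt_pexp)
        have "fst x \<subseteq> T0" unfolding T0_def using * by force
        then have T: "fst x = T0" using card_subset_eq[of T0 "fst x"] p card_idx_le[OF m] by (simp add: T0_def)
        have "snd x i = anti m i" for i
        proof (cases "i \<in> T0")
          case True
          then have "idx (snd x i) = m - idx i" using *[of i] T by simp
          also have "\<dots> = idx (anti m i)" using True m by (simp add: T0_def anti_def)
          finally show ?thesis by simp
        next
          case False
          then show ?thesis using p T by (simp add: permutes_not_in anti_def T0_def)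
        qed
        then have "x = x0" by (simp add: prod_eq_iff T x0_def fun_eq_iff)
        then show False using x by simp
      qed
    qed
    moreover have "(\<Sum>x\<in>J. ?t x) = (\<lambda>X. \<Sum>x\<in>J. ?t x X)" for J :: "('n set \<times> ('n \<Rightarrow> 'n)) set"
      by (induction J rule: infinite_finite_induct) (auto simp: fun_eq_iff)
    ultimately show ?thesis by (simp only:)
  qed
  then show ?thesis unfolding leading_def by (simp add: wt0 dg0 eq flip: m_def)
qed

section \<open>Freeness over the symmetric functions\<close>

definition cm :: "('n::finite \<Rightarrow> nat) \<Rightarrow> complex^'n^'n \<Rightarrow> complex" where
  "cm a X = (\<Prod>q\<in>UNIV. esym (Suc (idx q)) X ^ a q)"

text \<open>With a staircase exponent as second component, these functions form a basis of the
  polynomial functions; grouped by that component, they express freeness over the symmetric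
  ones.\<close>

definition bas :: "('n::finite \<Rightarrow> nat) \<times> 'n expo \<Rightarrow> complex^'n^'n \<Rightarrow> complex" where
  "bas s X = cm (fst s) X * mfun (snd s) X"

text \<open>The exponent of the leading monomial of \<open>bas s\<close>: leading exponents add
  under multiplication.\<close>

definition expo :: "('n::finite \<Rightarrow> nat) \<times> 'n expo \<Rightarrow> 'n expo" where
  "expo s p = (\<Sum>q\<in>UNIV. fst s q * mu q p) + snd s p"

text \<open>The exponents of monomials divisible by none of the antidiagonal ones.\<close>

definition staircase :: "'n::finite expo \<Rightarrow> bool" where
  "staircase \<beta> \<longleftrightarrow> (\<forall>q :: 'n. \<exists>p. idx (fst p) + idx (snd p) = idx q \<and> \<beta> p = 0)"

lemma leading_bas: "\<exists>z. z \<noteq> 0 \<and> leading (bas s) (expo s) z"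
proof -
  have "leading (\<lambda>X. cm (fst s) X * mfun (snd s) X) ((\<lambda>p. \<Sum>q\<in>UNIV. fst s q * mu q p) + snd s)
    ((\<Prod>q\<in>UNIV. lsign q ^ fst s q) * 1)"
    unfolding cm_def by (intro leading_mult leading_prod leading_power leading_esym leading_mfun finite)
  moreover have "(\<lambda>p. \<Sum>q\<in>UNIV. fst s q * mu q p) + snd s = expo s" by (simp add: expo_def fun_eq_iff)
  ultimately show ?thesis
    by (intro exI[of _ "(\<Prod>q\<in>UNIV. lsign q ^ fst s q) * 1"]) (simp add: bas_def[abs_def] lsign_nonzero)
qed

text \<open>The antidiagonals are disjoint, so at most one summand survives at each entry.\<close>

lemma expo_apply:
  "expo s p = (if idx (fst p) + idx (snd p) < CARD('n) then fst s (el (idx (fst p) + idx (snd p))) else 0) + snd s p"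
  for s :: "('n::finite \<Rightarrow> nat) \<times> 'n expo"
proof -
  let ?k = "idx (fst p) + idx (snd p)"
  have "(\<Sum>q\<in>UNIV. fst s q * mu q p) = (\<Sum>q\<in>UNIV. if q = el ?k then (if ?k < CARD('n) then fst s q else 0) else 0)"
  proof (rule sum.cong)
    fix q :: 'n
    have "?k = idx q \<longleftrightarrow> ?k < CARD('n) \<and> q = el ?k" by (metis el_idx idx_el idx_less)
    then show "fst s q * mu q p = (if q = el ?k then (if ?k < CARD('n) then fst s q else 0) else 0)"
      by (simp add: mu_def)
  qed simp
  then show ?thesis by (simp add: expo_def)
qed

lemma expo_class: "idx (fst p) + idx (snd p) = idx q \<Longrightarrow> expo s p = fst s q + snd s p"
  by (simp add: expo_apply)

text \<open>The staircase part attains 0 on every antidiagonal, so \<open>fst s q\<close> is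
  recovered as the minimum of \<open>expo s\<close> over antidiagonal \<open>q\<close>.\<close>

lemma expo_inject:
  assumes "staircase (snd s)" "staircase (snd t)" "expo s = expo t"
  shows "s = t"
proof -
  have le: "fst s q \<ge> fst t q" if "staircase (snd s)" "expo s = expo t" for s t :: "('a \<Rightarrow> nat) \<times> 'a expo" and q
  proof -
    obtain p where p: "idx (fst p) + idx (snd p) = idx q" "snd s p = 0"
      using \<open>staircase (snd s)\<close> unfolding staircase_def by blast
    then show ?thesis using expo_class[OF p(1), of s] expo_class[OF p(1), of t] that by simp
  qed
  have "fst s = fst t" using le[of s t] le[of t s] assms by (intro ext antisym) auto
  moreover have "snd s p = snd t p" for p
    using fun_cong[OF assms(3), of p] \<open>fst s = fst t\<close> by (simp add: expo_apply cong: if_cong)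
  ultimately show ?thesis by (simp add: prod_eq_iff fun_eq_iff)
qed

text \<open>The multiplicity of each antidiagonal monomial is the minimum of \<alpha> over that
  antidiagonal; subtracting it leaves a staircase exponent.\<close>

lemma expo_surj:
  fixes \<alpha> :: "'n::finite expo"
  obtains s where "staircase (snd s)" "expo s = \<alpha>"
proof -
  define C where "C q = {p :: 'n \<times> 'n. idx (fst p) + idx (snd p) = idx q}" for q :: 'n
  have C: "C q \<noteq> {}" for q
  proof -
    have "(q, el 0) \<in> C q" by (simp add: C_def)
    then show ?thesis by blast
  qed
  define a where "a q = Min (\<alpha> ` C q)" for q
  have a_le: "a q \<le> \<alpha> p" if "p \<in> C q" for p q using that by (simp add: a_def)
  define \<beta> where "\<beta> p = \<alpha> p - (if idx (fst p) + idx (snd p) < CARD('n) then a (el (idx (fst p) + idx (snd p))) else 0)" for p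
  have "staircase \<beta>" unfolding staircase_def
  proof
    fix q :: 'n
    have "a q \<in> \<alpha> ` C q" unfolding a_def by (rule Min_in) (use C in auto)
    then obtain p where p: "p \<in> C q" "a q = \<alpha> p" by auto
    then show "\<exists>p. idx (fst p) + idx (snd p) = idx q \<and> \<beta> p = 0"
      by (intro exI[of _ p]) (auto simp: C_def \<beta>_def)
  qed
  moreover have "expo (a, \<beta>) p = \<alpha> p" for p
  proof (cases "idx (fst p) + idx (snd p) < CARD('n)")
    case True
    then have "a (el (idx (fst p) + idx (snd p))) \<le> \<alpha> p" by (intro a_le) (simp add: C_def)
    then show ?thesis using True by (simp add: expo_apply \<beta>_def)
  qed (simp add: expo_apply \<beta>_def)
  ultimately show thesis using that[of "(a, \<beta>)"] by (simp add: fun_eq_iff)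
qed

lemma mwt_le: "mwt \<alpha> \<le> mdeg \<alpha> * (2 * CARD('n))\<^sup>2" for \<alpha> :: "'n::finite expo"
  unfolding mwt_def mdeg_def sum_distrib_right
proof (intro sum_mono mult_left_mono power_mono)
  fix p :: "'n \<times> 'n"
  show "idx (fst p) + idx (snd p) \<le> 2 * CARD('n)" using idx_less[of "fst p"] idx_less[of "snd p"] by linarith
qed auto

text \<open>Induction from heavy to light within one degree: the element of \<open>bas\<close> with
  leading exponent \<alpha> differs from a nonzero multiple of \<open>mfun \<alpha>\<close> only by
  heavier monomials. By \<open>mwt_le\<close> the distance to the weight bound decreases.\<close>

lemma mfun_in_span_bas: "mfun \<alpha> \<in> fv.span (bas ` {s. staircase (snd s)})" for \<alpha> :: "'n::finite expo"
proof (induction "mdeg \<alpha> * (2 * CARD('n))\<^sup>2 - mwt \<alpha>" arbitrary: \<alpha> rule: less_induct)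
  case less
  obtain s where s: "staircase (snd s)" "expo s = \<alpha>" by (rule expo_surj)
  obtain z where z: "z \<noteq> 0" "leading (bas s) \<alpha> z" using leading_bas[of s] s by blast
  let ?S = "fv.span (bas ` {s :: ('n \<Rightarrow> nat) \<times> 'n expo. staircase (snd s)})"
  have "heavier (mdeg \<alpha>) (mwt \<alpha>) \<subseteq> ?S"
    unfolding heavier_def
  proof (intro fv.span_minimal fv.subspace_span subsetI)
    fix f :: "complex^'n^'n \<Rightarrow> complex"
    assume "f \<in> mfun ` {\<gamma>. mdeg \<gamma> = mdeg \<alpha> \<and> mwt \<alpha> < mwt \<gamma>}"
    then obtain \<gamma> where g: "f = mfun \<gamma>" "mdeg \<gamma> = mdeg \<alpha>" "mwt \<alpha> < mwt \<gamma>" by auto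
    then show "f \<in> ?S" using less[of \<gamma>] mwt_le[of \<gamma>] by (simp add: diff_less_mono2)
  qed
  then have "(\<lambda>X. bas s X - z * mfun \<alpha> X) \<in> ?S" using z(2) unfolding leading_def by blast
  moreover have "bas s \<in> ?S" using s(1) by (intro fv.span_base) auto
  ultimately have "(\<lambda>X. (1 / z) * (bas s - (\<lambda>X. bas s X - z * mfun \<alpha> X)) X) \<in> ?S"
    by (intro fv.span_scale fv.span_diff)
  moreover have "(\<lambda>X. (1 / z) * (bas s - (\<lambda>X. bas s X - z * mfun \<alpha> X)) X) = mfun \<alpha>"
    using z(1) by (auto simp: fun_eq_iff)
  ultimately show ?case by simp
qed

text \<open>Among the terms with nonzero coefficient take one whose leading exponent is lightest.
  Leading exponents are distinct by \<open>expo_inject\<close>, so no other term contains this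
  monomial, and the relation would express it through different monomials.\<close>

lemma bas_independent:
  fixes S :: "(('n::finite \<Rightarrow> nat) \<times> 'n expo) set"
  assumes "finite S" "\<And>s. s \<in> S \<Longrightarrow> staircase (snd s)" "\<And>X. (\<Sum>s\<in>S. z s * bas s X) = 0" "s \<in> S"
  shows "z s = 0"
proof (rule ccontr)
  assume "z s \<noteq> 0"
  define S' where "S' = {s \<in> S. z s \<noteq> 0}"
  have "s \<in> S'" "finite S'" using assms(1,4) \<open>z s \<noteq> 0\<close> by (simp_all add: S'_def)
  then have S': "finite S'" "S' \<noteq> {}" by auto
  obtain s0 where s0: "s0 \<in> S'" "\<And>s. s \<in> S' \<Longrightarrow> mwt (expo s0) \<le> mwt (expo s)"
    using ex_min_if_finite[of "(mwt \<circ> expo) ` S'"] S' by (auto simp: not_less)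
  define V where "V = fv.span (range mfun - {mfun (expo s0)})"
  have mV: "mfun \<alpha> \<in> V" if "\<alpha> \<noteq> expo s0" for \<alpha>
    unfolding V_def using that inj_mfun by (intro fv.span_base) (auto simp: inj_def)
  obtain y where y: "\<And>s. y s \<noteq> 0" "\<And>s :: ('n \<Rightarrow> nat) \<times> 'n expo. leading (bas s) (expo s) (y s)"
    using leading_bas by metis
  have hV: "(\<lambda>X. bas s X - y s * mfun (expo s) X) \<in> V" if "s \<in> S'" for s
  proof -
    have "heavier (mdeg (expo s)) (mwt (expo s)) \<subseteq> V"
      unfolding heavier_def V_def
    proof (intro fv.span_mono subsetI)
      fix f :: "complex^'n^'n \<Rightarrow> complex"
      assume "f \<in> mfun ` {\<gamma>. mdeg \<gamma> = mdeg (expo s) \<and> mwt (expo s) < mwt \<gamma>}"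
      then obtain \<gamma> where g: "f = mfun \<gamma>" "mwt (expo s) < mwt \<gamma>" by auto
      then have "\<gamma> \<noteq> expo s0" using s0(2)[OF that] by auto
      then show "f \<in> range mfun - {mfun (expo s0)}" using g inj_mfun by (auto simp: inj_def)
    qed
    then show ?thesis using y(2)[of s] by (auto simp: leading_def)
  qed
  have bV: "bas s \<in> V" if "s \<in> S' - {s0}" for s
  proof -
    have "s \<in> S" "s0 \<in> S" "s \<noteq> s0" using that s0(1) by (simp_all add: S'_def)
    then have "expo s \<noteq> expo s0" using expo_inject[of s s0] assms(2) by blast
    then have "(\<lambda>X. bas s X - y s * mfun (expo s) X) + (\<lambda>X. y s * mfun (expo s) X) \<in> V"
      using hV[of s] mV[of "expo s"] that unfolding V_def by (intro fv.span_add fv.span_scale) auto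
    then show ?thesis by (simp add: plus_fun_def)
  qed
  have "(\<Sum>s\<in>S'. z s * bas s X) = 0" for X
    using assms(3)[of X] sum.mono_neutral_left[OF assms(1), of S' "\<lambda>s. z s * bas s X"] by (auto simp: S'_def)
  then have eq: "z s0 * bas s0 X = - (\<Sum>s\<in>S' - {s0}. z s * bas s X)" for X
    using sum.remove[OF S'(1) s0(1), of "\<lambda>s. z s * bas s X"] by (simp add: eq_neg_iff_add_eq_0)
  have "(\<Sum>s\<in>S' - {s0}. (\<lambda>X. z s * bas s X)) \<in> V"
    using bV unfolding V_def by (intro fv.span_sum fv.span_scale) auto
  moreover have "(\<Sum>s\<in>J. (\<lambda>X. z s * bas s X)) = (\<lambda>X. \<Sum>s\<in>J. z s * bas s X)" for J :: "(('n \<Rightarrow> nat) \<times> 'n expo) set"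
    by (induction J rule: infinite_finite_induct) (auto simp: fun_eq_iff)
  ultimately have sV: "(\<lambda>X. \<Sum>s\<in>S' - {s0}. z s * bas s X) \<in> V" by (simp only:)
  \<comment> \<open>The relation writes \<open>z s0 * bas s0\<close> as minus the rest; this is that
    equation solved for the leading monomial of \<open>bas s0\<close>.\<close>
  have "(\<lambda>X. (- 1 / (z s0 * y s0)) * ((\<lambda>X. \<Sum>s\<in>S' - {s0}. z s * bas s X) + (\<lambda>X. z s0 * (bas s0 X - y s0 * mfun (expo s0) X))) X) \<in> V"
    using sV hV[OF s0(1)] unfolding V_def by (intro fv.span_scale fv.span_add)
  moreover have "(- 1 / (z s0 * y s0)) * ((\<lambda>X. \<Sum>s\<in>S' - {s0}. z s * bas s X) + (\<lambda>X. z s0 * (bas s0 X - y s0 * mfun (expo s0) X))) X = mfun (expo s0) X" for X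
    using y(1)[of s0] s0(1) eq[of X] by (simp add: S'_def field_simps)
  ultimately have "mfun (expo s0) \<in> V" by (simp only:)
  then have "fv.dependent (range (mfun :: 'n expo \<Rightarrow> _))"
    unfolding fv.dependent_def V_def by blast
  then show False using independent_mfun by blast
qed

lemma symring_expansion:
  assumes "symring (f :: complex^'n^'n \<Rightarrow> complex)"
  shows "f \<in> fv.span (range cm)"
  using assms
proof (induction rule: symring.induct)
  case (const c)
  have "(\<lambda>X. c * cm (\<lambda>_. 0) X) \<in> fv.span (range (cm :: ('n \<Rightarrow> nat) \<Rightarrow> _))"
    by (intro fv.span_scale fv.span_base rangeI)
  moreover have "(\<lambda>X :: complex^'n^'n. c * cm (\<lambda>_. 0) X) = (\<lambda>_. c)" by (simp add: cm_def fun_eq_iff)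
  ultimately show ?case by (simp only:)
next
  case (esym k)
  consider "k = 0" | "k > CARD('n)" | q where "k = Suc (idx (q :: 'n))"
  proof (cases k)
    case (Suc l)
    then show thesis using that(2) that(3)[of "el l"] by (cases "l < CARD('n)") auto
  qed (use that in blast)
  then show ?case
  proof cases
    case 1
    have "cm (\<lambda>_. 0) \<in> fv.span (range (cm :: ('n \<Rightarrow> nat) \<Rightarrow> _))" by (intro fv.span_base rangeI)
    moreover have "cm (\<lambda>_. 0) = (esym k :: complex^'n^'n \<Rightarrow> _)" by (simp add: 1 cm_def fun_eq_iff)
    ultimately show ?thesis by (simp only:)
  next
    case 2
    then have "esym k = (0 :: complex^'n^'n \<Rightarrow> complex)" by (simp add: fun_eq_iff esym_gt)
    then show ?thesis by (metis fv.span_zero)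
  next
    case 3
    have "cm (\<lambda>r. if r = q then 1 else 0) X = (\<Prod>r\<in>UNIV. if r = q then esym k X else 1)" for X
      unfolding cm_def by (rule prod.cong) (auto simp: 3)
    then have "cm (\<lambda>r. if r = q then 1 else 0) = esym k" by (simp add: fun_eq_iff)
    then show ?thesis by (metis fv.span_base rangeI)
  qed
next
  case (add f g)
  then show ?case using fv.span_add[of f _ g] by (simp add: plus_fun_def)
next
  case (mult f g)
  show ?case
  proof (rule fv_span_mult[OF mult.IH])
    fix a b :: "complex^'n^'n \<Rightarrow> complex"
    assume "a \<in> range cm" "b \<in> range cm"
    then obtain \<alpha> \<beta> where "a = cm \<alpha>" "b = cm \<beta>" by auto
    then have "(\<lambda>X. a X * b X) = cm (\<lambda>q. \<alpha> q + \<beta> q)" by (simp add: cm_def fun_eq_iff power_add prod.distrib)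
    then show "(\<lambda>X. a X * b X) \<in> fv.span (range cm)" by (metis fv.span_base rangeI)
  qed
qed

text \<open>Coefficients are made to vanish outside \<open>A\<close> so that several expansions can
  be put over one common index set.\<close>

lemma span_cm_expansion:
  assumes "f \<in> fv.span (range cm)"
  shows "\<exists>A z. finite A \<and> (\<forall>a. a \<notin> A \<longrightarrow> z a = 0) \<and> (\<forall>X. f X = (\<Sum>a\<in>A. z a * cm a X))"
  using assms
proof (induction rule: fv.span_induct_alt)
  case base
  show ?case by (intro exI[of _ "{}"] exI[of _ "\<lambda>_. 0"]) simp
next
  case (step c x y)
  then obtain a A z where *: "x = cm a" "finite A" "\<forall>a. a \<notin> A \<longrightarrow> z a = 0" "\<And>X. y X = (\<Sum>a\<in>A. z a * cm a X)" by auto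
  have "y X = (\<Sum>b\<in>insert a A. z b * cm b X)" for X
    unfolding *(4) using *(2,3) by (intro sum.mono_neutral_left) auto
  moreover have "c * cm a X = (\<Sum>b\<in>insert a A. (if b = a then c else 0) * cm b X)" for X
    using *(2) by (simp add: if_distrib if_distribR sum.delta cong: if_cong)
  ultimately show ?case
    using * by (intro exI[of _ "insert a A"] exI[of _ "\<lambda>b. (if b = a then c else 0) + z b"])
      (auto simp: algebra_simps sum.distrib simp del: sum.insert)
qed

text \<open>Expanding each \<open>r \<beta>\<close> in products of the \<open>esym\<close> turns the
  relation into one between the functions \<open>bas (a, \<beta>)\<close>.\<close>

lemma symring_free:
  fixes F :: "'n::finite expo set"
  assumes "finite F" "\<And>\<beta>. \<beta> \<in> F \<Longrightarrow> staircase \<beta>" "\<And>\<beta>. \<beta> \<in> F \<Longrightarrow> symring (r \<beta>)"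
    and 0: "\<And>X. (\<Sum>\<beta>\<in>F. r \<beta> X * mfun \<beta> X) = 0" and "\<beta> \<in> F"
  shows "r \<beta> X = 0"
proof -
  have "\<forall>\<beta>\<in>F. \<exists>A z. finite A \<and> (\<forall>a. a \<notin> A \<longrightarrow> z a = 0) \<and> (\<forall>X. r \<beta> X = (\<Sum>a\<in>A. z a * cm a X))"
    using span_cm_expansion[OF symring_expansion[OF assms(3)]] by blast
  then obtain A z where A: "\<And>\<beta>. \<beta> \<in> F \<Longrightarrow> finite (A \<beta>)" "\<And>\<beta> a. \<beta> \<in> F \<Longrightarrow> a \<notin> A \<beta> \<Longrightarrow> z \<beta> a = 0"
    "\<And>\<beta> X. \<beta> \<in> F \<Longrightarrow> r \<beta> X = (\<Sum>a\<in>A \<beta>. z \<beta> a * cm a X)" by metis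
  define B where "B = (\<Union>\<beta>\<in>F. A \<beta>)"
  have B: "finite B" using A(1) assms(1) by (simp add: B_def)
  have rB: "r \<beta> X = (\<Sum>a\<in>B. z \<beta> a * cm a X)" if "\<beta> \<in> F" for \<beta> X
    unfolding A(3)[OF that] by (rule sum.mono_neutral_left) (use that A B in \<open>auto simp: B_def\<close>)
  have "(\<Sum>s\<in>B \<times> F. z (snd s) (fst s) * bas s X) = 0" for X
  proof -
    have "(\<Sum>s\<in>B \<times> F. z (snd s) (fst s) * bas s X) = (\<Sum>a\<in>B. \<Sum>\<beta>\<in>F. z \<beta> a * (cm a X * mfun \<beta> X))"
      by (simp add: sum.cartesian_product bas_def split_def)
    also have "\<dots> = (\<Sum>\<beta>\<in>F. \<Sum>a\<in>B. z \<beta> a * (cm a X * mfun \<beta> X))" by (rule sum.swap)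
    also have "\<dots> = (\<Sum>\<beta>\<in>F. r \<beta> X * mfun \<beta> X)"
      by (rule sum.cong) (auto simp: rB sum_distrib_right mult.assoc)
    finally show ?thesis using 0 by simp
  qed
  then have "z \<beta> a = 0" if "a \<in> B" for a
    using bas_independent[of "B \<times> F" "\<lambda>s. z (snd s) (fst s)" "(a, \<beta>)"] B assms that by auto
  then show ?thesis using rB[OF \<open>\<beta> \<in> F\<close>] by simp
qed

text \<open>The expansion in \<open>bas\<close> is regrouped by staircase exponents. As
  \<open>r\<close> vanishes outside \<open>F\<close>, the expansions of several functions can share
  one index set.\<close>

lemma symring_generates:
  fixes p :: "complex^'n^'n \<Rightarrow> complex"
  assumes "poly_fun p"
  shows "\<exists>F r. finite F \<and> (\<forall>\<beta>\<in>F. staircase \<beta>) \<and> (\<forall>\<beta>. symring (r \<beta>)) \<and> (\<forall>\<beta>. \<beta> \<notin> F \<longrightarrow> r \<beta> = (\<lambda>_. 0)) \<and>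
    (\<forall>X. p X = (\<Sum>\<beta>\<in>F. r \<beta> X * mfun \<beta> X))"
proof -
  have "range mfun \<subseteq> fv.span (bas ` {s :: ('n \<Rightarrow> nat) \<times> 'n expo. staircase (snd s)})"
    using mfun_in_span_bas by blast
  then have "p \<in> fv.span (bas ` {s. staircase (snd s)})"
    using poly_fun_span_mfun[OF assms] fv.span_minimal[OF _ fv.subspace_span] by blast
  then show ?thesis
  proof (induction rule: fv.span_induct_alt)
    case base
    show ?case by (intro exI[of _ "{}"] exI[of _ "\<lambda>_ _. 0"]) (auto intro: symring.const)
  next
    case (step c x y)
    then obtain s F r where *: "x = bas s" "staircase (snd s)" "finite F" "\<forall>\<beta>\<in>F. staircase \<beta>" "\<forall>\<beta>. symring (r \<beta>)"
      "\<forall>\<beta>. \<beta> \<notin> F \<longrightarrow> r \<beta> = (\<lambda>_. 0)" "\<And>X. y X = (\<Sum>\<beta>\<in>F. r \<beta> X * mfun \<beta> X)" by auto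
    let ?r = "\<lambda>\<beta> X. (if \<beta> = snd s then c else 0) * cm (fst s) X + r \<beta> X"
    have cm: "symring (cm (fst s))"
    proof -
      have pw: "symring (\<lambda>X. f X ^ k)" if "symring f" for f :: "complex^'n^'n \<Rightarrow> complex" and k
        by (induction k) (auto intro: symring.intros that)
      have "symring (\<lambda>X :: complex^'n^'n. \<Prod>q\<in>Q. esym (Suc (idx q)) X ^ fst s q)" for Q
        by (induction Q rule: infinite_finite_induct) (auto intro: symring.const symring.mult[OF pw[OF symring.esym]])
      then show ?thesis by (simp add: cm_def[abs_def])
    qed
    have "y X = (\<Sum>\<beta>\<in>insert (snd s) F. r \<beta> X * mfun \<beta> X)" for X
      unfolding *(7) using *(3,6) by (intro sum.mono_neutral_left) auto
    moreover have "c * bas s X = (\<Sum>\<beta>\<in>insert (snd s) F. (if \<beta> = snd s then c else 0) * cm (fst s) X * mfun \<beta> X)" for X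
      using *(3) by (simp add: bas_def if_distrib if_distribR sum.delta mult.assoc cong: if_cong)
    moreover have "symring (?r \<beta>)" for \<beta> by (intro symring.intros cm *(5)[rule_format])
    ultimately show ?case
      using * by (intro exI[of _ "insert (snd s) F"] exI[of _ ?r])
        (auto simp: algebra_simps sum.distrib simp del: sum.insert)
  qed
qed

section \<open>Relations restricted to lines through the origin\<close>

lemma poly_fun_on_ray:
  assumes "poly_fun f" obtains P where "\<And>t. f (map_matrix ((*) t) X) = poly P t"
proof -
  have "poly_family (\<lambda>s (X :: complex^'a^'a). f (map_matrix ((*) s) X))"
    by (rule poly_family_compose[OF assms])
       (auto intro!: poly_family_mult poly_family_var poly_family_fun)
  then show thesis using that unfolding poly_family_def by metis
qed

text \<open>Along a line through the origin, divide the relation by the highest power of the parameter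
  dividing all coefficients.\<close>

lemma symring_relation:
  fixes u H :: "'j \<Rightarrow> complex^'n^'n \<Rightarrow> complex"
  assumes J: "finite J" and u: "\<And>j. j \<in> J \<Longrightarrow> symring (u j)" and H: "\<And>j. j \<in> J \<Longrightarrow> poly_fun (H j)"
    and 0: "\<And>X. (\<Sum>j\<in>J. u j X * H j X) = 0" and j0: "j0 \<in> J" "u j0 X0 \<noteq> 0"
  obtains z F r where "\<exists>j\<in>J. z j \<noteq> 0" "finite F" "\<And>\<beta>. \<beta> \<in> F \<Longrightarrow> symring (r \<beta>)" "\<And>\<beta>. \<beta> \<in> F \<Longrightarrow> r \<beta> 0 = 0"
    "\<And>X. (\<Sum>j\<in>J. z j * H j X) = (\<Sum>\<beta>\<in>F. r \<beta> X * mfun \<beta> X)"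
proof -
  define Q where "Q j F r \<longleftrightarrow> finite F \<and> (\<forall>\<beta>\<in>F. staircase \<beta>) \<and> (\<forall>\<beta>. symring (r \<beta>)) \<and> (\<forall>\<beta>. \<beta> \<notin> F \<longrightarrow> r \<beta> = (\<lambda>_. 0)) \<and>
    (\<forall>X. H j X = (\<Sum>\<beta>\<in>F. r \<beta> X * mfun \<beta> X))" for j F r
  have "\<forall>j\<in>J. \<exists>F r. Q j F r"
    unfolding Q_def using symring_generates[OF H] by blast
  then obtain G s where "\<And>j. j \<in> J \<Longrightarrow> Q j (G j) (s j)" by metis
  then have G: "\<And>j. j \<in> J \<Longrightarrow> finite (G j)" "\<And>j \<beta>. j \<in> J \<Longrightarrow> \<beta> \<in> G j \<Longrightarrow> staircase \<beta>"
    "\<And>j \<beta>. j \<in> J \<Longrightarrow> symring (s j \<beta>)" "\<And>j \<beta>. j \<in> J \<Longrightarrow> \<beta> \<notin> G j \<Longrightarrow> s j \<beta> = (\<lambda>_. 0)"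
    "\<And>j X. j \<in> J \<Longrightarrow> H j X = (\<Sum>\<beta>\<in>G j. s j \<beta> X * mfun \<beta> X)" unfolding Q_def by blast+
  define F where "F = (\<Union>j\<in>J. G j)"
  have F: "finite F" "\<And>\<beta>. \<beta> \<in> F \<Longrightarrow> staircase \<beta>" using G(1,2) J by (auto simp: F_def)
  have HF: "H j X = (\<Sum>\<beta>\<in>F. s j \<beta> X * mfun \<beta> X)" if "j \<in> J" for j X
    unfolding G(5)[OF that] by (rule sum.mono_neutral_left) (use that G F in \<open>auto simp: F_def\<close>)
  \<comment> \<open>Freeness splits the relation into one scalar relation per staircase
    monomial.\<close>
  have rel: "(\<Sum>j\<in>J. u j X * s j \<beta> X) = 0" if "\<beta> \<in> F" for \<beta> X
  proof (rule symring_free[OF F, where r = "\<lambda>\<beta> X. \<Sum>j\<in>J. u j X * s j \<beta> X"])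
    fix X
    have "(\<Sum>\<beta>\<in>F. (\<Sum>j\<in>J. u j X * s j \<beta> X) * mfun \<beta> X) = (\<Sum>j\<in>J. \<Sum>\<beta>\<in>F. u j X * s j \<beta> X * mfun \<beta> X)"
      unfolding sum_distrib_right by (rule sum.swap)
    also have "\<dots> = (\<Sum>j\<in>J. u j X * H j X)"
      by (rule sum.cong) (auto simp: HF sum_distrib_left mult.assoc)
    finally show "(\<Sum>\<beta>\<in>F. (\<Sum>j\<in>J. u j X * s j \<beta> X) * mfun \<beta> X) = 0" using 0 by simp
  qed (use that in \<open>auto intro!: symring_sum symring.mult u G(3)\<close>)
  have "\<forall>j\<in>J. \<exists>P. \<forall>t. u j (map_matrix ((*) t) X0) = poly P t"
    using poly_fun_on_ray[OF symring_poly_fun[OF u]] by metis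
  then obtain P where P: "\<And>j t. j \<in> J \<Longrightarrow> u j (map_matrix ((*) t) X0) = poly (P j) t" by metis
  have "\<forall>j\<in>J. \<forall>\<beta>. \<exists>P. \<forall>t. s j \<beta> (map_matrix ((*) t) X0) = poly P t"
    using poly_fun_on_ray[OF symring_poly_fun[OF G(3)]] by metis
  then obtain Q where Q: "\<And>j \<beta> t. j \<in> J \<Longrightarrow> s j \<beta> (map_matrix ((*) t) X0) = poly (Q j \<beta>) t" by metis
  have PQ: "(\<Sum>j\<in>J. P j * Q j \<beta>) = 0" if "\<beta> \<in> F" for \<beta>
  proof -
    have "poly (\<Sum>j\<in>J. P j * Q j \<beta>) t = (\<Sum>j\<in>J. u j (map_matrix ((*) t) X0) * s j \<beta> (map_matrix ((*) t) X0))" for t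
      by (simp add: poly_sum P Q)
    then show ?thesis using rel[OF that] by (simp flip: poly_eq_poly_eq_iff add: fun_eq_iff)
  qed
  have scale1: "map_matrix ((*) 1) X0 = X0" and scale0: "map_matrix ((*) 0) X0 = 0" by (simp_all add: vec_eq_iff)
  have "poly (P j0) 1 \<noteq> 0" using j0 by (simp add: scale1 flip: P)
  then have "P j0 \<noteq> 0" by auto
  then have ex: "\<exists>k. \<exists>j\<in>J. coeff (P j) k \<noteq> 0" using j0(1) by (auto simp: poly_eq_iff)
  define e where "e = (LEAST k. \<exists>j\<in>J. coeff (P j) k \<noteq> 0)"
  define z where "z j = coeff (P j) e" for j
  have z: "\<exists>j\<in>J. z j \<noteq> 0" unfolding z_def e_def using LeastI_ex[OF ex] .
  have less: "coeff (P j) k = 0" if "k < e" "j \<in> J" for k j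
    using not_less_Least[of k] that unfolding e_def by blast
  show thesis
  proof (rule that[OF z F(1), of "\<lambda>\<beta> X. \<Sum>j\<in>J. z j * s j \<beta> X"])
    fix \<beta> assume \<beta>: "\<beta> \<in> F"
    show "symring (\<lambda>X. \<Sum>j\<in>J. z j * s j \<beta> X)" by (intro symring_sum symring.intros G(3))
    \<comment> \<open>Every \<open>P j\<close> vanishes below order \<open>e\<close>, so this
      coefficient only sees \<open>z j\<close> and the constant term of \<open>Q j \<beta>\<close>,
      which is the value of \<open>s j \<beta>\<close> at the origin.\<close>
    have "0 = coeff (\<Sum>j\<in>J. P j * Q j \<beta>) e" by (simp add: PQ[OF \<beta>])
    also have "\<dots> = (\<Sum>j\<in>J. \<Sum>i\<le>e. coeff (P j) i * coeff (Q j \<beta>) (e - i))"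
      by (simp add: coeff_sum coeff_mult)
    also have "\<dots> = (\<Sum>j\<in>J. z j * coeff (Q j \<beta>) 0)"
    proof (rule sum.cong)
      fix j assume "j \<in> J"
      have "(\<Sum>i\<le>e. coeff (P j) i * coeff (Q j \<beta>) (e - i)) = (\<Sum>i\<in>{e}. coeff (P j) i * coeff (Q j \<beta>) (e - i))"
        by (rule sum.mono_neutral_right) (use less \<open>j \<in> J\<close> in auto)
      then show "(\<Sum>i\<le>e. coeff (P j) i * coeff (Q j \<beta>) (e - i)) = z j * coeff (Q j \<beta>) 0" by (simp add: z_def)
    qed simp
    also have "\<dots> = (\<Sum>j\<in>J. z j * s j \<beta> 0)"
      using Q[of _ \<beta> 0] by (intro sum.cong) (auto simp: scale0 poly_0_coeff_0)
    finally show "(\<Sum>j\<in>J. z j * s j \<beta> 0) = 0" by simp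
  next
    fix X
    have "(\<Sum>j\<in>J. z j * H j X) = (\<Sum>j\<in>J. \<Sum>\<beta>\<in>F. z j * s j \<beta> X * mfun \<beta> X)"
      by (rule sum.cong) (auto simp: HF sum_distrib_left mult.assoc)
    also have "\<dots> = (\<Sum>\<beta>\<in>F. \<Sum>j\<in>J. z j * s j \<beta> X * mfun \<beta> X)" by (rule sum.swap)
    finally show "(\<Sum>j\<in>J. z j * H j X) = (\<Sum>\<beta>\<in>F. (\<Sum>j\<in>J. z j * s j \<beta> X) * mfun \<beta> X)"
      by (simp add: sum_distrib_right)
  qed
qed


section \<open>Differentials\<close>

text \<open>\<open>has_derivative\<close> refers to the real structure of the matrix space.
  Recording that the same map gives the derivatives along complex lines allows Frechet derivatives
  to be computed from polynomials in one complex variable.\<close>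

lemma poly_fun_has_derivative:
  fixes p :: "complex^'n^'n \<Rightarrow> complex"
  assumes "poly_fun p"
  shows "\<exists>D. (p has_derivative D) (at A) \<and> (\<forall>V. ((\<lambda>t. p (A + map_matrix ((*) t) V)) has_field_derivative D V) (at 0))"
  using assms
proof (induction rule: poly_fun_induct)
  case (const c)
  show ?case by (rule exI[of _ "\<lambda>_. 0"]) auto
next
  case (coord i j)
  have "bounded_linear (\<lambda>A :: complex^'n^'n. A $ i $ j)"
    using bounded_linear_compose[OF bounded_linear_vec_nth[of j] bounded_linear_vec_nth[of i]] by simp
  then have "((\<lambda>A :: complex^'n^'n. A $ i $ j) has_derivative (\<lambda>V. V $ i $ j)) (at A)"
    by (rule bounded_linear_imp_has_derivative)
  then show ?case by (intro exI[of _ "\<lambda>V. V $ i $ j"]) (auto intro!: derivative_eq_intros)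
next
  case (add f g)
  then obtain D E where "(f has_derivative D) (at A)" "(g has_derivative E) (at A)"
    "\<And>V. ((\<lambda>t. f (A + map_matrix ((*) t) V)) has_field_derivative D V) (at 0)"
    "\<And>V. ((\<lambda>t. g (A + map_matrix ((*) t) V)) has_field_derivative E V) (at 0)" by blast
  then show ?case
    by (intro exI[of _ "\<lambda>V. D V + E V"]) (auto intro!: has_derivative_add DERIV_add)
next
  case (mult f g)
  then obtain D E where *: "(f has_derivative D) (at A)" "(g has_derivative E) (at A)"
    "\<And>V. ((\<lambda>t. f (A + map_matrix ((*) t) V)) has_field_derivative D V) (at 0)"
    "\<And>V. ((\<lambda>t. g (A + map_matrix ((*) t) V)) has_field_derivative E V) (at 0)" by blast
  have z: "A + map_matrix ((*) 0) V = A" for V by (simp add: vec_eq_iff)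
  show ?case
  proof (intro exI[of _ "\<lambda>V. f A * E V + D V * g A"] conjI allI)
    show "((\<lambda>A. f A * g A) has_derivative (\<lambda>V. f A * E V + D V * g A)) (at A)"
      by (rule has_derivative_mult[OF *(1,2)])
    fix V
    show "((\<lambda>t. f (A + map_matrix ((*) t) V) * g (A + map_matrix ((*) t) V)) has_field_derivative f A * E V + D V * g A) (at 0)"
      using DERIV_mult[OF *(3,4), of V V] by (simp add: z algebra_simps)
  qed
qed

lemma frechet_poly_fun:
  fixes p :: "complex^'n^'n \<Rightarrow> complex"
  assumes "poly_fun p"
  shows "((\<lambda>t. p (A + map_matrix ((*) t) V)) has_field_derivative frechet_derivative p (at A) V) (at 0)"
proof -
  obtain D where D: "(p has_derivative D) (at A)"
    "((\<lambda>t. p (A + map_matrix ((*) t) V)) has_field_derivative D V) (at 0)"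
    using poly_fun_has_derivative[OF assms] by blast
  then show ?thesis using frechet_derivative_at[OF D(1)] by simp
qed

lemma frechet_eqI:
  assumes "poly_fun p" "((\<lambda>t. p (A + map_matrix ((*) t) V)) has_field_derivative c) (at 0)"
  shows "frechet_derivative p (at A) V = c"
  using DERIV_unique[OF frechet_poly_fun[OF assms(1)] assms(2)] .

text \<open>With V = A B one has A + t V = A (1 + t B), whose determinant is the polynomial in t
  with coefficients \<open>esym k B\<close>; the linear one is the trace.\<close>

lemma frechet_det:
  fixes A :: "complex^'n^'n"
  assumes "A \<in> SL"
  shows "frechet_derivative (\<lambda>A. det A - 1) (at A) V = trace (matrix_inv A ** V)"
proof (rule frechet_eqI)
  show "poly_fun (\<lambda>A :: complex^'n^'n. det A - 1)" by (intro poly_fun_diff poly_fun_det poly_fun_const)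
  define B where "B = matrix_inv A ** V"
  define q where "q = (\<Sum>k\<le>CARD('n). monom (esym k B) k) - 1"
  have "det (A + map_matrix ((*) t) V) - 1 = poly q t" for t
  proof -
    have "V = A ** B" using SL_inverse(1)[OF assms] by (simp add: B_def matrix_mul_assoc)
    then have "map_matrix ((*) t) V = A ** map_matrix ((*) t) B"
      by (simp add: vec_eq_iff matrix_matrix_mult_def sum_distrib_left mult_ac)
    then have "A + map_matrix ((*) t) V = A ** (map_matrix ((*) t) B + mat 1)"
      by (simp add: matrix_add_ldistrib)
    then have "det (A + map_matrix ((*) t) V) = det A * det (map_matrix ((*) t) B + mat 1)" by (simp add: det_mul)
    also have "\<dots> = (\<Sum>k\<le>CARD('n). esym k B * t ^ k)"
      using assms by (simp add: SL_def det_shift_eq esym_scale mult.commute)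
    finally show ?thesis by (simp add: q_def poly_sum poly_monom)
  qed
  moreover have "(poly q has_field_derivative trace B) (at 0)"
  proof -
    have "poly (pderiv q) 0 = coeff q 1" by (simp add: poly_0_coeff_0 coeff_pderiv)
    also have "\<dots> = esym 1 B"
      by (simp add: q_def coeff_sum Suc_le_eq)
    also have "\<dots> = trace B" by (rule esym_1)
    finally show ?thesis using poly_DERIV[of q 0] by simp
  qed
  ultimately show "((\<lambda>t. det (A + map_matrix ((*) t) V) - 1) has_field_derivative trace (matrix_inv A ** V)) (at 0)"
    by (simp add: B_def)
qed


section \<open>Division by \<open>det - 1\<close>\<close>

definition ntr :: "complex^'n^'n \<Rightarrow> complex" where
  "ntr X = 1 / of_nat CARD('n) * trace X"

lemma poly_fun_ntr: "poly_fun ntr"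
  unfolding ntr_def by (intro poly_fun_mult poly_fun_const poly_fun_trace)

lemma cayley_decomp: "cayley X + mat (ntr X) = X"
  by (simp add: cayley_eq ntr_def)

lemma cayley_shift: "Y \<in> sl \<Longrightarrow> cayley (Y + mat t) = Y" "Y \<in> sl \<Longrightarrow> ntr (Y + mat t) = t" for Y :: "complex^'n^'n"
  by (simp_all add: cayley_eq ntr_def trace_add trace_mat sl_def)

text \<open>Division with remainder by det - 1, regarded as a monic polynomial of degree n in
  \<open>ntr\<close> over the polynomial functions of the traceless part.\<close>

definition divrep :: "(complex^'n^'n \<Rightarrow> complex) \<Rightarrow> bool" where
  "divrep p \<longleftrightarrow> (\<exists>q r. poly_fun q \<and> (\<forall>i. poly_fun (r i)) \<and>
     (\<forall>X. p X = (det X - 1) * q X + (\<Sum>i<CARD('n). r i (cayley X) * ntr X ^ i)))"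

lemma divrepI:
  assumes "poly_fun q" "\<And>i. poly_fun (r i)"
    "\<And>X :: complex^'n^'n. p X = (det X - 1) * q X + (\<Sum>i<CARD('n). r i (cayley X) * ntr X ^ i)"
  shows "divrep p"
  using assms unfolding divrep_def by blast

lemma divrepE:
  assumes "divrep (p :: complex^'n^'n \<Rightarrow> complex)"
  obtains q r where "poly_fun q" "\<And>i. poly_fun (r i)"
    "\<And>X. p X = (det X - 1) * q X + (\<Sum>i<CARD('n). r i (cayley X) * ntr X ^ i)"
  using assms unfolding divrep_def by blast

lemma divrep_add:
  assumes "divrep f" "divrep g" shows "divrep (\<lambda>X. f X + g X)"
proof -
  obtain q r where *: "poly_fun q" "\<And>i. poly_fun (r i)"
    "\<And>X. f X = (det X - 1) * q X + (\<Sum>i<CARD('a). r i (cayley X) * ntr X ^ i)"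
    by (rule divrepE[OF assms(1)]) blast
  obtain q' r' where **: "poly_fun q'" "\<And>i. poly_fun (r' i)"
    "\<And>X. g X = (det X - 1) * q' X + (\<Sum>i<CARD('a). r' i (cayley X) * ntr X ^ i)"
    by (rule divrepE[OF assms(2)]) blast
  show ?thesis
    by (rule divrepI[of "\<lambda>X. q X + q' X" "\<lambda>i X. r i X + r' i X"])
       (use *(1,2) **(1,2) in \<open>auto simp: *(3) **(3) algebra_simps sum.distrib\<close>)
qed

lemma divrep_scale:
  assumes "divrep f" "poly_fun g" shows "divrep (\<lambda>X. g (cayley X) * f X)"
proof -
  obtain q r where *: "poly_fun q" "\<And>i. poly_fun (r i)"
    "\<And>X. f X = (det X - 1) * q X + (\<Sum>i<CARD('a). r i (cayley X) * ntr X ^ i)"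
    by (rule divrepE[OF assms(1)]) blast
  show ?thesis
    by (rule divrepI[of "\<lambda>X. g (cayley X) * q X" "\<lambda>i X. g X * r i X"])
       (use *(1,2) assms(2) in \<open>auto simp: *(3) algebra_simps sum_distrib_left intro: poly_fun_mult poly_fun_cayley\<close>)
qed

lemma divrep_sum:
  assumes "\<And>i. i \<in> I \<Longrightarrow> divrep (f i)" shows "divrep (\<lambda>X. \<Sum>i\<in>I. f i X)"
  using assms
proof (induction I rule: infinite_finite_induct)
  case (insert i I)
  then show ?case by (simp add: divrep_add)
qed (auto intro!: divrepI[of "\<lambda>_. 0" "\<lambda>_ _. 0"])

text \<open>Only the n-th power of \<open>ntr\<close> leaves the permitted range, and
  \<open>top\<close> rewrites it through det - 1 and lower powers.\<close>

lemma divrep_mult_ntr: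
  fixes f :: "complex^'n^'n \<Rightarrow> complex"
  assumes "divrep f" shows "divrep (\<lambda>X. ntr X * f X)"
proof -
  obtain q r where *: "poly_fun q" "\<And>i. poly_fun (r i)"
    "\<And>X. f X = (det X - 1) * q X + (\<Sum>i<CARD('n). r i (cayley X) * ntr X ^ i)"
    by (rule divrepE[OF assms]) blast
  obtain m where m: "CARD('n) = Suc m" using zero_less_CARD gr0_implies_Suc by blast
  let ?c = "\<lambda>k (X :: complex^'n^'n). coeff (charp X) k"
  have c: "poly_fun (?c k)" for k
    by (cases "k \<le> CARD('n)") (auto simp: coeff_charp[abs_def])
  \<comment> \<open>The characteristic polynomial of the traceless part is monic and takes the value
    det X at \<open>ntr X\<close>; writing det X as (det X - 1) + 1 exposes the divisor.\<close>
  have top: "ntr X ^ CARD('n) = (det X - 1) + 1 - (\<Sum>i<CARD('n). ?c i (cayley X) * ntr X ^ i)" for X :: "complex^'n^'n"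
  proof -
    have "det X = poly (charp (cayley X)) (ntr X)" by (simp add: poly_charp cayley_decomp)
    also have "\<dots> = (\<Sum>i\<le>CARD('n). ?c i (cayley X) * ntr X ^ i)"
      by (rule poly_degree_le_sum) (simp add: degree_charp)
    also have "\<dots> = (\<Sum>i<CARD('n). ?c i (cayley X) * ntr X ^ i) + ntr X ^ CARD('n)"
      by (simp add: lessThan_Suc_atMost[symmetric] coeff_charp)
    finally show ?thesis by simp
  qed
  show ?thesis
  proof (rule divrepI)
    show "poly_fun (\<lambda>X. ntr X * q X + r m (cayley X))"
      by (intro poly_fun_add poly_fun_mult poly_fun_ntr poly_fun_cayley[OF *(2)] *(1))
    show "poly_fun (\<lambda>X. (if i = 0 then 0 else r (i - 1) X) + r m X * ((if i = 0 then 1 else 0) - ?c i X))" for i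
      using * c by (auto intro!: poly_fun_add poly_fun_mult poly_fun_diff)
    fix X :: "complex^'n^'n"
    let ?s = "ntr X" and ?Y = "cayley X"
    let ?S = "\<Sum>i<CARD('n). (if i = 0 then 0 else r (i - 1) ?Y) * ?s ^ i"
    let ?C = "\<Sum>i<CARD('n). ?c i ?Y * ?s ^ i"
    have e1: "(\<Sum>i<CARD('n). r i ?Y * ?s ^ Suc i) = (\<Sum>i<m. r i ?Y * ?s ^ Suc i) + r m ?Y * ?s ^ CARD('n)"
      by (simp add: m)
    have e2: "(\<Sum>i<m. r i ?Y * ?s ^ Suc i) = ?S"
      unfolding m sum.lessThan_Suc_shift by simp
    have e3: "r m ?Y * ?s ^ CARD('n) = r m ?Y * (det X - 1) + r m ?Y - r m ?Y * ?C"
      unfolding top by (simp add: algebra_simps)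
    have e4: "r m ?Y = (\<Sum>i<CARD('n). r m ?Y * (if i = 0 then 1 else 0) * ?s ^ i)"
      unfolding m sum.lessThan_Suc_shift by simp
    have e5: "(\<Sum>i<CARD('n). ((if i = 0 then 0 else r (i - 1) ?Y) + r m ?Y * ((if i = 0 then 1 else 0) - ?c i ?Y)) * ?s ^ i) =
      ?S + (\<Sum>i<CARD('n). r m ?Y * (if i = 0 then 1 else 0) * ?s ^ i) - r m ?Y * ?C"
      by (simp only: sum_distrib_left sum.distrib[symmetric] sum_subtractf[symmetric]) (simp add: algebra_simps)
    have "(\<Sum>i<CARD('n). r i ?Y * ?s ^ Suc i) = (det X - 1) * r m ?Y +
      (\<Sum>i<CARD('n). ((if i = 0 then 0 else r (i - 1) ?Y) + r m ?Y * ((if i = 0 then 1 else 0) - ?c i ?Y)) * ?s ^ i)"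
      unfolding e5 e1 e2 e3 e4[symmetric] by (simp add: algebra_simps)
    moreover have "?s * f X = (det X - 1) * (?s * q X) + (\<Sum>i<CARD('n). r i ?Y * ?s ^ Suc i)"
      by (simp add: *(3) algebra_simps sum_distrib_left)
    ultimately show "?s * f X = (det X - 1) * (?s * q X + r m ?Y) +
      (\<Sum>i<CARD('n). ((if i = 0 then 0 else r (i - 1) ?Y) + r m ?Y * ((if i = 0 then 1 else 0) - ?c i ?Y)) * ?s ^ i)"
      by (simp add: algebra_simps)
  qed
qed

text \<open>Expand p (Y + s) in powers of s and put Y = \<open>cayley X\<close>, s =
  \<open>ntr X\<close>; it remains to divide the powers of \<open>ntr\<close>.\<close>

lemma divrep_poly_fun:
  fixes p :: "complex^'n^'n \<Rightarrow> complex"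
  assumes "poly_fun p" shows "divrep p"
proof -
  obtain m where m: "CARD('n) = Suc m" using zero_less_CARD gr0_implies_Suc by blast
  have one: "divrep (\<lambda>X :: complex^'n^'n. 1)"
  proof (rule divrepI[of "\<lambda>_. 0" "\<lambda>i _. if i = 0 then 1 else 0"])
    fix X :: "complex^'n^'n"
    show "1 = (det X - 1) * 0 + (\<Sum>i<CARD('n). (if i = 0 then 1 else 0) * ntr X ^ i)"
      unfolding m sum.lessThan_Suc_shift by simp
  qed auto
  have pw: "divrep (\<lambda>X :: complex^'n^'n. ntr X ^ k)" for k
    by (induction k) (auto intro: one divrep_mult_ntr)
  obtain P d where P: "\<And>k. poly_fun (\<lambda>X. coeff (P X) k)" "\<And>X. degree (P X) \<le> d" "\<And>s X. p (X + mat s) = poly (P X) s"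
    using poly_familyE[OF poly_family_shift[OF assms]] by metis
  have "divrep (\<lambda>X. \<Sum>k\<le>d. coeff (P (cayley X)) k * ntr X ^ k)"
    by (intro divrep_sum divrep_scale[OF pw P(1)])
  moreover have "p = (\<lambda>X. \<Sum>k\<le>d. coeff (P (cayley X)) k * ntr X ^ k)"
  proof
    show "p X = (\<Sum>k\<le>d. coeff (P (cayley X)) k * ntr X ^ k)" for X
      using P(3)[of "cayley X" "ntr X"] by (simp add: cayley_decomp poly_degree_le_sum[OF P(2)])
  qed
  ultimately show ?thesis by simp
qed


section \<open>Generic fibres\<close>

definition mpow :: "complex^'n^'n \<Rightarrow> nat \<Rightarrow> complex^'n^'n" where
  "mpow C k = ((\<lambda>M. C ** M) ^^ k) (mat 1)"

definition fibre_poly :: "complex^'n^'n \<Rightarrow> complex poly" where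
  "fibre_poly Y = charp Y - 1"

text \<open>With \<open>p = fibre_poly Y\<close> and \<open>C\<close> its companion matrix, \<open>dcomp Y\<close> is \<open>p'(C)\<close>, whose determinant is
  the discriminant of \<open>p\<close> up to sign: a root \<open>t\<close> of \<open>p\<close> gives the left eigenvector \<open>(1, t, t\<^sup>2, \<dots>)\<close> of
  \<open>C\<close>, and hence the eigenvalue \<open>p'(t)\<close> of \<open>p'(C)\<close>.\<close>

definition dcomp :: "complex^'n^'n \<Rightarrow> complex^'n^'n" where
  "dcomp Y = (\<Sum>k<CARD('n). mat (of_nat (Suc k) * coeff (fibre_poly Y) (Suc k)) ** mpow (compm (coeff (fibre_poly Y))) k)"

lemma coeff_fibre_poly:
  "coeff (fibre_poly Y) k = (if k \<le> CARD('n) then esym (CARD('n) - k) Y else 0) - (if k = 0 then 1 else 0)"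
  for Y :: "complex^'n^'n"
  by (simp add: fibre_poly_def coeff_charp)

lemma poly_fun_coeff_fibre_poly: "poly_fun (\<lambda>Y. coeff (fibre_poly Y) k)"
  unfolding coeff_fibre_poly by (intro poly_fun_diff poly_fun_const) (cases "k \<le> CARD('a)", auto)

lemma degree_fibre_poly: "degree (fibre_poly (Y :: complex^'n^'n)) = CARD('n)"
  by (rule antisym) (auto intro!: degree_le le_degree simp: coeff_fibre_poly)

lemma fibre_poly_nonzero: "fibre_poly (Y :: complex^'n^'n) \<noteq> 0"
  using degree_fibre_poly[of Y] zero_less_CARD by (metis degree_0 less_irrefl)

lemma poly_fibre_poly: "poly (fibre_poly Y) t = det (Y + mat t) - 1"
  by (simp add: fibre_poly_def poly_charp)

lemma poly_fun_dcomp: "poly_fun (\<lambda>Y. dcomp Y $ i $ j)"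
proof -
  have c: "poly_fun (\<lambda>Y :: complex^'a^'a. compm (coeff (fibre_poly Y)) $ i $ j :: complex)" for i j :: 'a
    using poly_fun_uminus[OF poly_fun_coeff_fibre_poly[of "idx i"]]
    by (cases "Suc (idx j) = CARD('a)"; cases "idx i = Suc (idx j)") (auto simp: compm_def)
  have m: "poly_fun (\<lambda>Y :: complex^'a^'a. (mpow (compm (coeff (fibre_poly Y))) k :: complex^'a^'a) $ i $ j)" for i j k
  proof (induction k arbitrary: i j)
    case (Suc k)
    then show ?case by (simp add: mpow_def) (intro poly_fun_matrix_mult c)
  qed (simp add: mpow_def)
  have "poly_fun (\<lambda>Y :: complex^'a^'a. \<Sum>k<CARD('a). of_nat (Suc k) * coeff (fibre_poly Y) (Suc k) *
    (mpow (compm (coeff (fibre_poly Y))) k :: complex^'a^'a) $ i $ j)"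
    by (intro poly_fun_sum poly_fun_mult m poly_fun_const poly_fun_coeff_fibre_poly)
  then show ?thesis by (simp add: dcomp_def mat_mult_left)
qed

lemma vector_matrix_sum: "v v* (\<Sum>k\<in>I. M k) = (\<Sum>k\<in>I. v v* M k)" for M :: "_ \<Rightarrow> complex^'n^'n"
  by (induction I rule: infinite_finite_induct) (simp_all add: vector_matrix_mult_add_rdistrib)

lemma det_dcomp_multiple_root:
  fixes Y :: "complex^'n^'n"
  assumes "poly (fibre_poly Y) t = 0" "poly (pderiv (fibre_poly Y)) t = 0"
  shows "det (dcomp Y) = 0"
proof (rule ccontr)
  assume "det (dcomp Y) \<noteq> 0"
  then obtain N where N: "dcomp Y ** N = mat 1"
    using invertible_det_nz[of "dcomp Y"] unfolding invertible_def by blast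
  define u :: "complex^'n" where "u = (\<chi> i. t ^ idx i)"
  define C :: "complex^'n^'n" where "C = compm (coeff (fibre_poly Y))"
  have C: "u v* C = t *s u"
  proof -
    have "(\<Sum>i\<in>UNIV. t ^ idx i * C $ i $ j) = t * t ^ idx j" for j
    proof (cases "Suc (idx j) = CARD('n)")
      case True
      have "(\<Sum>i\<in>UNIV. t ^ idx i * C $ i $ j) = (\<Sum>i\<in>(UNIV :: 'n set). - (coeff (fibre_poly Y) (idx i) * t ^ idx i))"
        using True by (simp add: C_def compm_def mult.commute)
      also have "\<dots> = (\<Sum>k<CARD('n). - (coeff (fibre_poly Y) k * t ^ k))" by (rule sum_idx)
      also have "\<dots> = t ^ CARD('n) - (\<Sum>k\<le>CARD('n). coeff (fibre_poly Y) k * t ^ k)"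
        by (simp add: lessThan_Suc_atMost[symmetric] coeff_fibre_poly sum_negf)
      also have "(\<Sum>k\<le>CARD('n). coeff (fibre_poly Y) k * t ^ k) = 0"
        using assms(1) poly_degree_le_sum[of "fibre_poly Y" "CARD('n)" t] by (simp add: degree_fibre_poly)
      finally show ?thesis by (simp add: True[symmetric])
    next
      case False
      then have s: "Suc (idx j) < CARD('n)" using idx_less[of j] by linarith
      then have "idx l = Suc (idx j) \<longleftrightarrow> l = el (Suc (idx j))" for l :: 'n by (metis el_idx idx_el)
      then have "(\<Sum>i\<in>UNIV. t ^ idx i * C $ i $ j) = (\<Sum>i\<in>(UNIV :: 'n set). if i = el (Suc (idx j)) then t ^ idx i else 0)"
        using False by (intro sum.cong) (auto simp: C_def compm_def)
      then show ?thesis using s by simp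
    qed
    then show ?thesis by (simp add: u_def vector_matrix_mult_def vec_eq_iff)
  qed
  have Ck: "u v* mpow C k = t ^ k *s u" for k
  proof (induction k)
    case 0
    then show ?case by (simp add: mpow_def)
  next
    case (Suc k)
    have "u v* mpow C (Suc k) = (u v* C) v* mpow C k" by (simp add: mpow_def vector_matrix_mul_assoc)
    also have "\<dots> = t *s (t ^ k *s u)" by (simp add: C scaleR_vector_matrix_assoc Suc scalar_vector_matrix_assoc)
    finally show ?case by (simp add: vector_smult_assoc)
  qed
  have mu: "u v* (mat c ** M) = c *s (u v* M)" for c and M :: "complex^'n^'n"
    by (simp add: mat_mult_left vec_eq_iff vector_matrix_mult_def sum_distrib_left mult_ac)
  have "u v* dcomp Y = (\<Sum>k<CARD('n). (of_nat (Suc k) * coeff (fibre_poly Y) (Suc k) * t ^ k) *s u)"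
    by (simp add: dcomp_def vector_matrix_sum mu Ck vector_smult_assoc flip: C_def del: of_nat_Suc)
  also have "\<dots> = (\<Sum>k<CARD('n). of_nat (Suc k) * coeff (fibre_poly Y) (Suc k) * t ^ k) *s u"
    by (simp add: vec_eq_iff sum_distrib_right)
  also have "(\<Sum>k<CARD('n). of_nat (Suc k) * coeff (fibre_poly Y) (Suc k) * t ^ k) = poly (pderiv (fibre_poly Y)) t"
  proof -
    have "poly (pderiv (fibre_poly Y)) t = (\<Sum>k\<le>CARD('n). coeff (pderiv (fibre_poly Y)) k * t ^ k)"
      by (rule poly_degree_le_sum) (simp add: degree_pderiv degree_fibre_poly)
    also have "\<dots> = (\<Sum>k<CARD('n). coeff (pderiv (fibre_poly Y)) k * t ^ k)"
      by (simp add: lessThan_Suc_atMost[symmetric] coeff_pderiv coeff_fibre_poly)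
    finally show ?thesis by (simp add: coeff_pderiv)
  qed
  finally have "u v* dcomp Y = 0" using assms(2) by simp
  then have "u v* (dcomp Y ** N) = 0" by (simp flip: vector_matrix_mul_assoc)
  then have "u = 0" by (simp add: N)
  \<comment> \<open>The entry of \<open>u\<close> at index 0 is \<open>t ^ 0 = 1\<close>, also for
    \<open>t = 0\<close>, so \<open>u\<close> cannot vanish.\<close>
  then have "u $ el 0 = 0" by simp
  then show False by (simp add: u_def)
qed

text \<open>For the polynomial t^n + \<open>a 0\<close> the companion matrix shifts the coordinates
  cyclically up to a nonzero factor, so its kernel is trivial.\<close>

lemma det_compm_cyclic:
  assumes "a 0 \<noteq> 0" "\<And>k. k > 0 \<Longrightarrow> k < CARD('n) \<Longrightarrow> a k = 0"
  shows "det (compm a :: complex^'n^'n) \<noteq> 0"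
proof -
  have "x = 0" if x: "(compm a :: complex^'n^'n) *v x = 0" for x
  proof -
    have "x $ j = 0" for j
    proof (cases "Suc (idx j) = CARD('n)")
      case True
      have "((compm a :: complex^'n^'n) *v x) $ el 0 = (\<Sum>l\<in>UNIV. if l = j then - a 0 * x $ l else 0)"
        unfolding matrix_vector_mult_def vec_lambda_beta
      proof (rule sum.cong)
        fix l :: 'n
        have "Suc (idx l) = CARD('n) \<longleftrightarrow> l = j" using True by (metis idx_inj nat.inject)
        then show "(compm a :: complex^'n^'n) $ el 0 $ l * x $ l = (if l = j then - a 0 * x $ l else 0)"
          by (simp add: compm_def)
      qed simp
      then show ?thesis using x assms(1) by simp
    next
      case False
      then have s: "Suc (idx j) < CARD('n)" using idx_less[of j] by linarith
      have "((compm a :: complex^'n^'n) *v x) $ el (Suc (idx j)) = (\<Sum>l\<in>UNIV. if l = j then x $ l else 0)"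
        unfolding matrix_vector_mult_def vec_lambda_beta
        by (rule sum.cong) (use s assms(2) in \<open>auto simp: compm_def\<close>)
      then show ?thesis using x by simp
    qed
    then show ?thesis by (simp add: vec_eq_iff)
  qed
  then obtain B where "B ** (compm a :: complex^'n^'n) = mat 1"
    using matrix_left_invertible_ker by blast
  then have "det B * det (compm a :: complex^'n^'n) = 1" by (metis det_mul det_I)
  then show ?thesis by auto
qed

lemma esym_zero: "k > 0 \<Longrightarrow> esym k (0 :: complex^'n^'n) = 0"
proof -
  assume "k > 0"
  have "map_matrix ((*) 0) 0 = (0 :: complex^'n^'n)" by (simp add: vec_eq_iff)
  then show ?thesis using esym_scale[of k 0 "0 :: complex^'n^'n"] \<open>k > 0\<close> by (simp add: power_0_left)
qed

text \<open>At Y = 0 the fibre polynomial is t^n - 1. Its derivative, evaluated at the companion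
  matrix C, is n times the power of C with exponent n - 1, which is invertible. This is the point
  where the discriminant is known not to vanish.\<close>

lemma det_dcomp_0: "det (dcomp (0 :: complex^'n^'n)) \<noteq> 0"
proof -
  obtain m where m: "CARD('n) = Suc m" using zero_less_CARD gr0_implies_Suc by blast
  have c: "coeff (fibre_poly (0 :: complex^'n^'n)) k = (if k = CARD('n) then 1 else if k = 0 then - 1 else 0)" for k
    by (auto simp: coeff_fibre_poly esym_zero)
  let ?C = "compm (coeff (fibre_poly (0 :: complex^'n^'n))) :: complex^'n^'n"
  have C: "det ?C \<noteq> 0" by (rule det_compm_cyclic) (auto simp: c)
  have "det (mpow ?C k) = det ?C ^ k" for k
    by (induction k) (simp_all add: mpow_def det_mul)
  moreover have "dcomp (0 :: complex^'n^'n) = mat (of_nat (Suc m)) ** mpow ?C m"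
  proof -
    have "dcomp (0 :: complex^'n^'n) = (\<Sum>k<CARD('n). if k = m then mat (of_nat (Suc k)) ** mpow ?C k else 0)"
      unfolding dcomp_def by (rule sum.cong) (auto simp: c m mat_mult_left vec_eq_iff)
    then show ?thesis by (simp add: m)
  qed
  ultimately show ?thesis using C by (simp add: det_mul det_mat del: of_nat_Suc)
qed

lemma card_fibre_roots:
  fixes Y :: "complex^'n^'n"
  assumes "det (dcomp Y) \<noteq> 0"
  shows "card {t. poly (fibre_poly Y) t = 0} = CARD('n)"
proof -
  have "rsquarefree (fibre_poly Y)"
    unfolding rsquarefree_roots using det_dcomp_multiple_root[of Y] assms by blast
  then have "smult (lead_coeff (fibre_poly Y)) (\<Prod>z | poly (fibre_poly Y) z = 0. [:- z, 1:]) = fibre_poly Y"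
    by (rule complex_poly_decompose_rsquarefree)
  then have "degree (fibre_poly Y) = degree (\<Prod>z | poly (fibre_poly Y) z = 0. [:- z, 1:])"
    by (metis degree_smult_eq smult_0_left fibre_poly_nonzero)
  also have "\<dots> = card {t. poly (fibre_poly Y) t = 0}"
    by (subst degree_prod_eq_sum_degree) auto
  finally show ?thesis by (simp add: degree_fibre_poly)
qed

lemma shift_in_SL: "poly (fibre_poly Y) t = 0 \<Longrightarrow> Y + mat t \<in> SL"
  by (simp add: SL_def poly_fibre_poly)

lemma cayley_surj:
  assumes "Y \<in> sl" obtains A where "A \<in> SL" "cayley A = (Y :: complex^'n^'n)"
proof -
  have "\<not> constant (poly (fibre_poly Y))"
    by (simp add: constant_degree degree_fibre_poly)
  then obtain t where "poly (fibre_poly Y) t = 0" using fundamental_theorem_of_algebra by blast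
  then show thesis using that shift_in_SL cayley_shift(1)[OF assms] by blast
qed

text \<open>Over a traceless Y with nonzero discriminant, the polynomial with coefficients
  \<open>r i Y\<close> has degree less than n but vanishes at the n distinct roots of the fibre
  polynomial. Hence its coefficients are zero for generic Y, and by density for all.\<close>

lemma ntr_powers_independent:
  fixes r :: "nat \<Rightarrow> complex^'n^'n \<Rightarrow> complex"
  assumes "\<And>i. poly_fun (r i)" "\<And>A. A \<in> SL \<Longrightarrow> (\<Sum>i<CARD('n). r i (cayley A) * ntr A ^ i) = 0"
    and "i < CARD('n)" "Y \<in> sl"
  shows "r i Y = 0"
proof (rule poly_fun_vanishing_dense_sl[where f = "r i" and g = "\<lambda>Y. det (dcomp Y)" and B = 0])
  show "poly_fun (\<lambda>Y :: complex^'n^'n. det (dcomp Y))" by (rule poly_fun_compose_det) (rule poly_fun_dcomp)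
  fix Y :: "complex^'n^'n" assume Y: "Y \<in> sl"
  show "r i Y * det (dcomp Y) = 0"
  proof (cases "det (dcomp Y) = 0")
    case False
    define q where "q = (\<Sum>i<CARD('n). monom (r i Y) i)"
    have "poly q t = 0" if "poly (fibre_poly Y) t = 0" for t
      using assms(2)[OF shift_in_SL[OF that]] by (simp add: cayley_shift[OF Y] q_def poly_sum poly_monom)
    then have "{t. poly (fibre_poly Y) t = 0} \<subseteq> {t. poly q t = 0}" by auto
    moreover have "q = 0"
    proof (rule ccontr)
      assume "q \<noteq> 0"
      then have "card {t. poly q t = 0} \<le> degree q" "finite {t. poly q t = 0}"
        using card_poly_roots_bound poly_roots_finite by auto
      then have "CARD('n) \<le> degree q"
        using card_fibre_roots[OF False] card_mono[OF _ calculation] by simp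
      moreover have "degree q < CARD('n)"
        unfolding q_def by (intro degree_sum_less) (auto intro: le_less_trans[OF degree_monom_le])
      ultimately show False by simp
    qed
    then have "coeff q i = 0" by simp
    then show ?thesis using assms(3) by (simp add: q_def coeff_sum)
  qed simp
qed (use assms det_dcomp_0 zero_in_sl in auto)

text \<open>The excluded closed set is the zero locus of the discriminant; elsewhere the fibre over
  Y consists of the matrices Y + t, with t running over the n distinct roots.\<close>

lemma cayley_mapping_degree: "has_mapping_degree cayley (SL :: (complex^'n^'n) set) sl CARD('n)"
  unfolding has_mapping_degree_def generically_on_def
proof (intro conjI exI ballI)
  show "cayley ` (SL :: (complex^'n^'n) set) \<subseteq> sl" using cayley_in_sl by auto
  let ?Z = "{Y :: complex^'n^'n. det (dcomp Y) = 0}"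
  show "zariski_closed ?Z" unfolding zariski_closed_def
    by (rule exI[of _ "{\<lambda>Y. det (dcomp Y)}"]) (auto intro!: poly_fun_compose_det poly_fun_dcomp)
  show "sl - ?Z \<noteq> {}" using det_dcomp_0 zero_in_sl by blast
  fix Y :: "complex^'n^'n" assume Y: "Y \<in> sl - ?Z"
  have eq: "{A \<in> SL. cayley A = Y} = (\<lambda>t. Y + mat t) ` {t. poly (fibre_poly Y) t = 0}"
  proof (intro equalityI subsetI)
    fix A assume A: "A \<in> {A \<in> SL. cayley A = Y}"
    then have eq: "Y + mat (ntr A) = A" using cayley_decomp[of A] by simp
    have "poly (fibre_poly Y) (ntr A) = 0" using A by (simp add: poly_fibre_poly SL_def eq)
    then show "A \<in> (\<lambda>t. Y + mat t) ` {t. poly (fibre_poly Y) t = 0}"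
      by (intro image_eqI[of _ _ "ntr A"]) (simp_all add: eq)
  qed (use Y shift_in_SL cayley_shift in auto)
  have "inj (\<lambda>t. Y + mat t :: complex^'n^'n)"
  proof (rule injI)
    fix s t assume "Y + mat s = Y + mat t"
    then have "ntr (Y + mat s) = ntr (Y + mat t)" by simp
    then show "s = t" using cayley_shift(2)[of Y] Y by simp
  qed
  moreover have "finite {t. poly (fibre_poly Y) t = 0}" by (rule poly_roots_finite[OF fibre_poly_nonzero])
  ultimately show "finite {A \<in> SL. cayley A = Y}" "card {A \<in> SL. cayley A = Y} = CARD('n)"
    unfolding eq using Y card_fibre_roots by (auto simp: card_image inj_on_subset)
qed


section \<open>The hypersurface and its tangent spaces\<close>

lemma poly_fun_det_minus_1: "poly_fun (\<lambda>A. det A - 1)"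
  by (intro poly_fun_diff poly_fun_det poly_fun_const)

text \<open>If p vanishes on \<open>SL\<close>, so does its remainder modulo det - 1, and
  independence of the powers of \<open>ntr\<close> makes every coefficient of the remainder zero.
  Thus det - 1 generates the full ideal.\<close>

lemma vanishing_ideal_SL: "vanishing_ideal (SL :: (complex^'n^'n) set) = {(\<lambda>A. (det A - 1) * q A) | q. poly_fun q}"
proof (intro equalityI subsetI)
  fix p :: "complex^'n^'n \<Rightarrow> complex" assume "p \<in> vanishing_ideal SL"
  then have p: "poly_fun p" "\<And>A. A \<in> SL \<Longrightarrow> p A = 0" by (auto simp: vanishing_ideal_def)
  obtain q r where *: "poly_fun q" "\<And>i. poly_fun (r i)"
    "\<And>X. p X = (det X - 1) * q X + (\<Sum>i<CARD('n). r i (cayley X) * ntr X ^ i)"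
    by (rule divrepE[OF divrep_poly_fun[OF p(1)]]) blast
  have "(\<Sum>i<CARD('n). r i (cayley A) * ntr A ^ i) = 0" if "A \<in> SL" for A
    using *(3)[of A] p(2)[OF that] that by (simp add: SL_def)
  then have "r i (cayley X) = 0" if "i < CARD('n)" for i X
    using ntr_powers_independent[of r, OF *(2)] that cayley_in_sl by blast
  then have "p = (\<lambda>A. (det A - 1) * q A)" using *(3) by auto
  then show "p \<in> {(\<lambda>A. (det A - 1) * q A) | q. poly_fun q}" using *(1) by blast
next
  fix p :: "complex^'n^'n \<Rightarrow> complex" assume "p \<in> {(\<lambda>A. (det A - 1) * q A) | q. poly_fun q}"
  then show "p \<in> vanishing_ideal SL"
    using poly_fun_det_minus_1 by (auto simp: vanishing_ideal_def SL_def)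
qed

text \<open>Restriction to scalar matrices gives lower bounds for the degree: det - 1 becomes t^n -
  1 there.\<close>

lemma poly_fun_le_scalar:
  "poly_fun_le d p \<Longrightarrow> \<exists>P. degree P \<le> d \<and> (\<forall>t. p (mat t) = poly P t)"
proof (induction rule: poly_fun_le.induct)
  case (const d c)
  show ?case by (rule exI[of _ "[:c:]"]) simp
next
  case (coord d i j)
  show ?case by (rule exI[of _ "if i = j then [:0, 1:] else 0"]) (simp add: mat_def)
next
  case (add d f g)
  then obtain P Q where "degree P \<le> d" "\<forall>t. f (mat t) = poly P t" "degree Q \<le> d" "\<forall>t. g (mat t) = poly Q t" by blast
  then show ?case by (intro exI[of _ "P + Q"]) (auto intro: degree_add_le)
next
  case (mult d f e g)
  then obtain P Q where *: "degree P \<le> d" "\<forall>t. f (mat t) = poly P t" "degree Q \<le> e" "\<forall>t. g (mat t) = poly Q t" by blast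
  then have "degree (P * Q) \<le> d + e" using degree_mult_le[of P Q] by linarith
  then show ?case using * by (intro exI[of _ "P * Q"]) auto
qed

lemma poly_fun_le_sum: "(\<And>i. i \<in> I \<Longrightarrow> poly_fun_le d (f i)) \<Longrightarrow> poly_fun_le d (\<lambda>A. \<Sum>i\<in>I. f i A)"
  by (induction I rule: infinite_finite_induct) (auto intro: poly_fun_le.const poly_fun_le.add)

lemma poly_fun_le_prod: "finite I \<Longrightarrow> (\<And>i. i \<in> I \<Longrightarrow> poly_fun_le 1 (f i)) \<Longrightarrow> poly_fun_le (card I) (\<lambda>A. \<Prod>i\<in>I. f i A)"
proof (induction I rule: finite_induct)
  case (insert i I)
  then show ?case using poly_fun_le.mult[of 1 "f i" "card I" "\<lambda>A. \<Prod>i\<in>I. f i A"] by simp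
qed (auto intro: poly_fun_le.const)

lemma poly_fun_degree_det: "poly_fun_degree (\<lambda>A :: complex^'n^'n. det A - 1) = CARD('n)"
  unfolding poly_fun_degree_def
proof (rule Least_equality)
  have c: "poly_fun_le 1 (\<lambda>A :: complex^'n^'n. A $ i $ j)" for i j using poly_fun_le.coord[of 0 i j] by simp
  have "poly_fun_le CARD('n) (\<lambda>A :: complex^'n^'n. det A)"
    unfolding det_def
  proof (rule poly_fun_le_sum)
    fix p :: "'n \<Rightarrow> 'n"
    have "poly_fun_le (0 + CARD('n)) (\<lambda>A :: complex^'n^'n. of_int (sign p) * (\<Prod>i\<in>UNIV. A $ i $ p i))"
      by (intro poly_fun_le.mult poly_fun_le.const poly_fun_le_prod c) simp
    then show "poly_fun_le CARD('n) (\<lambda>A :: complex^'n^'n. of_int (sign p) * (\<Prod>i\<in>UNIV. A $ i $ p i))" by simp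
  qed
  then have "poly_fun_le CARD('n) (\<lambda>A :: complex^'n^'n. det A + (- 1))" by (intro poly_fun_le.add poly_fun_le.const)
  then show "poly_fun_le CARD('n) (\<lambda>A :: complex^'n^'n. det A - 1)" by simp
  fix d assume "poly_fun_le d (\<lambda>A :: complex^'n^'n. det A - 1)"
  then obtain P :: "complex poly" where P: "degree P \<le> d" "\<And>t. t ^ CARD('n) - 1 = poly P t"
    using poly_fun_le_scalar[of d "\<lambda>A :: complex^'n^'n. det A - 1"] by (auto simp: det_mat)
  have "poly P t = poly (monom 1 CARD('n) - 1) t" for t by (simp add: poly_monom flip: P(2))
  then have "P = monom 1 CARD('n) - 1" by (simp flip: poly_eq_poly_eq_iff add: fun_eq_iff)
  then have "coeff P CARD('n) = 1" by simp
  then have "CARD('n) \<le> degree P" by (intro le_degree) simp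
  then show "CARD('n) \<le> d" using P(1) by simp
qed

lemma SL_smooth_hypersurface: "smooth_hypersurface_of_degree (SL :: (complex^'n^'n) set) CARD('n)"
  unfolding smooth_hypersurface_of_degree_def
proof (intro exI conjI ballI)
  let ?p = "\<lambda>A :: complex^'n^'n. det A - 1"
  have "?p (mat 0) \<noteq> 0" by (simp only: det_0) simp
  then have ne: "?p \<noteq> (\<lambda>_. 0)" by metis
  show "reduced_equation ?p SL"
    unfolding reduced_equation_def
  proof (intro conjI)
    show "(SL :: (complex^'n^'n) set) \<noteq> {}" using one_in_SL by blast
    show "SL = {A. ?p A = 0}" by (simp add: SL_def)
  qed (rule poly_fun_det_minus_1 ne vanishing_ideal_SL)+
  show "poly_fun_degree ?p = CARD('n)" by (rule poly_fun_degree_det)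
  fix A :: "complex^'n^'n" assume A: "A \<in> SL"
  \<comment> \<open>The derivative in the direction of A itself is the trace of the identity, which
    witnesses smoothness.\<close>
  have "frechet_derivative ?p (at A) A = of_nat CARD('n)"
    by (simp add: frechet_det[OF A] SL_inverse[OF A] trace_I)
  then show "frechet_derivative ?p (at A) \<noteq> (\<lambda>_. 0)"
    by (metis of_nat_eq_0_iff zero_less_CARD less_irrefl)
qed

section \<open>Tangent spaces and the differential of the Cayley mapping\<close>

lemma tangent_space_SL:
  assumes A: "A \<in> SL"
  shows "tangent_space SL A = {V. trace (matrix_inv A ** V) = 0}"
proof (intro equalityI subsetI)
  fix V assume "V \<in> tangent_space SL A"
  moreover have "(\<lambda>A :: complex^'a^'a. (det A - 1) * 1) \<in> vanishing_ideal SL"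
    unfolding vanishing_ideal_SL by (intro CollectI exI[of _ "\<lambda>_. 1"]) auto
  ultimately have "frechet_derivative (\<lambda>A :: complex^'a^'a. (det A - 1) * 1) (at A) V = 0" unfolding tangent_space_def by blast
  then show "V \<in> {V. trace (matrix_inv A ** V) = 0}" by (simp add: frechet_det[OF A])
next
  fix V assume V: "V \<in> {V. trace (matrix_inv A ** V) = 0}"
  show "V \<in> tangent_space SL A" unfolding tangent_space_def
  proof (intro CollectI ballI)
    fix p :: "complex^'a^'a \<Rightarrow> complex" assume "p \<in> vanishing_ideal SL"
    then obtain q where q: "poly_fun q" "p = (\<lambda>A. (det A - 1) * q A)" unfolding vanishing_ideal_SL by blast
    have z: "A + map_matrix ((*) 0) V = A" by (simp add: vec_eq_iff)
    show "frechet_derivative p (at A) V = 0"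
    proof (rule frechet_eqI)
      show "poly_fun p" unfolding q(2) by (intro poly_fun_mult poly_fun_det_minus_1 q(1))
      show "((\<lambda>t. p (A + map_matrix ((*) t) V)) has_field_derivative 0) (at 0)"
        unfolding q(2) using DERIV_mult[OF frechet_poly_fun[OF poly_fun_det_minus_1, of A V] frechet_poly_fun[OF q(1), of A V]] A V
        by (simp add: frechet_det[OF A] z SL_def)
    qed
  qed
qed

lemma tangent_space_sl:
  assumes X: "X \<in> sl"
  shows "tangent_space sl X = (sl :: (complex^'n^'n) set)"
proof (intro equalityI subsetI)
  fix V assume V: "V \<in> tangent_space sl X"
  have "frechet_derivative trace (at X) V = trace V"
  proof (rule frechet_eqI[OF poly_fun_trace])
    have "trace (X + map_matrix ((*) t) V) = trace X + t * trace V" for t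
      by (simp add: trace_def sum.distrib sum_distrib_left)
    then show "((\<lambda>t. trace (X + map_matrix ((*) t) V)) has_field_derivative trace V) (at 0)"
      by (auto intro!: derivative_eq_intros)
  qed
  moreover have "trace \<in> vanishing_ideal (sl :: (complex^'n^'n) set)"
    using poly_fun_trace by (simp add: vanishing_ideal_def sl_def)
  ultimately show "V \<in> sl" using V by (simp add: tangent_space_def sl_def)
next
  fix V :: "complex^'n^'n" assume V: "V \<in> sl"
  show "V \<in> tangent_space sl X" unfolding tangent_space_def
  proof (intro CollectI ballI)
    fix p :: "complex^'n^'n \<Rightarrow> complex" assume p: "p \<in> vanishing_ideal sl"
    have "X + map_matrix ((*) t) V \<in> sl" for t
      using X V by (simp add: sl_def trace_def sum.distrib flip: sum_distrib_left)
    then have "p (X + map_matrix ((*) t) V) = 0" for t using p by (simp add: vanishing_ideal_def)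
    then show "frechet_derivative p (at X) V = 0"
      using p by (intro frechet_eqI) (auto simp: vanishing_ideal_def)
  qed
qed

lemma frechet_cayley: "frechet_derivative cayley (at A) = cayley" for A :: "complex^'n^'n"
proof -
  have "linear (cayley :: complex^'n^'n \<Rightarrow> _)"
    by (rule linearI) (simp_all add: cayley_eq vec_eq_iff mat_def trace_def sum.distrib algebra_simps scaleR_sum_right[symmetric] flip: scaleR_sum_right)
  then have "bounded_linear (cayley :: complex^'n^'n \<Rightarrow> _)" by (simp add: linear_conv_bounded_linear)
  then have "(cayley has_derivative (cayley :: complex^'n^'n \<Rightarrow> _)) (at A)" by (rule bounded_linear_imp_has_derivative)
  then show ?thesis using frechet_derivative_at by metis
qed

lemma trace_mat_mult: "trace (M ** mat c) = c * trace M" for M :: "complex^'n^'n"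
  by (simp add: mat_mult_right trace_def sum_distrib_left)

text \<open>The kernel of \<open>cayley\<close> is the line of scalars, which lies in the tangent
  hyperplane trace (A^-1 V) = 0 exactly when the trace of A^-1 vanishes. Otherwise the inverse adds
  to W the unique scalar that moves it into the hyperplane.\<close>

lemma cayley_singular_iff:
  fixes A :: "complex^'n^'n"
  assumes A: "A \<in> SL"
  shows "singular_differential cayley SL sl A \<longleftrightarrow> trace (matrix_inv A) = 0"
proof -
  let ?T = "{V. trace (matrix_inv A ** V) = 0}" and ?c = "trace (matrix_inv A)"
  have c0: "cayley (mat c :: complex^'n^'n) = 0" for c
    using cayley_shift(1)[of 0 c] zero_in_sl by simp
  have "bij_betw cayley ?T sl \<longleftrightarrow> ?c \<noteq> 0"
  proof
    assume bij: "bij_betw cayley ?T sl"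
    show "?c \<noteq> 0"
    proof
      assume "?c = 0"
      then have "mat 1 \<in> ?T" "mat 0 \<in> ?T" by (simp_all only: mem_Collect_eq trace_mat_mult) simp_all
      moreover have "cayley (mat 1 :: complex^'n^'n) = cayley (mat 0)" by (simp only: c0)
      ultimately have "(mat 1 :: complex^'n^'n) = mat 0" using bij_betw_imp_inj_on[OF bij] by (rule_tac inj_onD)
      then show False by (metis trace_mat mult_cancel_left one_neq_zero of_nat_eq_0_iff zero_less_CARD less_irrefl)
    qed
  next
    assume c: "?c \<noteq> 0"
    show "bij_betw cayley ?T sl"
    proof (rule bij_betw_byWitness[where f' = "\<lambda>W. W + mat (- trace (matrix_inv A ** W) / ?c)"])
      show "\<forall>V\<in>?T. cayley V + mat (- trace (matrix_inv A ** cayley V) / ?c) = V"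
      proof
        fix V assume V: "V \<in> ?T"
        have "V = cayley V + mat (ntr V)" by (simp add: cayley_decomp)
        then have "trace (matrix_inv A ** V) = trace (matrix_inv A ** cayley V) + ntr V * ?c"
          by (metis matrix_add_ldistrib trace_add trace_mat_mult)
        then have "ntr V = - trace (matrix_inv A ** cayley V) / ?c" using V c by (simp add: field_simps eq_neg_iff_add_eq_0)
        then show "cayley V + mat (- trace (matrix_inv A ** cayley V) / ?c) = V" using cayley_decomp[of V] by simp
      qed
    qed (use c in \<open>auto simp: cayley_shift cayley_in_sl matrix_add_ldistrib trace_add trace_mat_mult\<close>)
  qed
  then show ?thesis
    by (simp add: singular_differential_def frechet_cayley tangent_space_SL[OF A] tangent_space_sl[OF cayley_in_sl])
qed

lemma matrix_inv_SL:
  assumes "A \<in> SL" shows "matrix_inv A \<in> SL" "matrix_inv (matrix_inv A) = A"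
proof -
  have "det A * det (matrix_inv A) = 1" using SL_inverse(1)[OF assms] by (metis det_I det_mul)
  then show "matrix_inv A \<in> SL" using assms by (simp add: SL_def)
  show "matrix_inv (matrix_inv A) = A" by (rule matrix_inv_eqI) (use SL_inverse[OF assms] in auto)
qed

lemma matrix_inv_SL_sl: "matrix_inv ` (SL \<inter> sl) = {A \<in> SL. trace (matrix_inv A) = 0}"
proof (intro equalityI subsetI)
  fix A :: "complex^'a^'a" assume "A \<in> {A \<in> SL. trace (matrix_inv A) = 0}"
  then have "A = matrix_inv (matrix_inv A)" "matrix_inv A \<in> SL \<inter> sl" by (auto simp: matrix_inv_SL sl_def)
  then show "A \<in> matrix_inv ` (SL \<inter> sl)" by blast
qed (auto simp: matrix_inv_SL sl_def)


section \<open>Regular orbits\<close>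

lemma cayley_conj:
  fixes g :: "complex^'n^'n"
  assumes "g \<in> SL" shows "cayley (g ** A ** matrix_inv g) = g ** cayley A ** matrix_inv g"
    "cayley (matrix_inv g ** A ** g) = matrix_inv g ** cayley A ** g"
proof -
  have t: "trace (P ** A ** Q) = trace A" if "Q ** P = mat 1" for P Q :: "complex^'n^'n"
    by (metis that trace_mul_sym matrix_mul_assoc matrix_mul_rid)
  have c: "cayley (P ** A ** Q) = P ** cayley A ** Q" if "Q ** P = mat 1" "P ** Q = mat 1" for P Q :: "complex^'n^'n"
  proof -
    have "P ** A ** Q = P ** (cayley A + mat (ntr A)) ** Q" by (simp add: cayley_decomp)
    also have "\<dots> = P ** cayley A ** Q + mat (ntr A)" by (rule conj_shift[OF that(2)])
    also have "ntr A = ntr (P ** A ** Q)" by (simp add: ntr_def t[OF that(1)])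
    finally show ?thesis using cayley_decomp[of "P ** A ** Q"] by (metis add_right_cancel)
  qed
  show "cayley (g ** A ** matrix_inv g) = g ** cayley A ** matrix_inv g"
    "cayley (matrix_inv g ** A ** g) = matrix_inv g ** cayley A ** g"
    using c SL_inverse[OF assms] by auto
qed

lemma cayley_commute_iff: "g ** cayley A = cayley A ** g \<longleftrightarrow> g ** A = A ** g" for A g :: "complex^'n^'n"
proof -
  have "g ** A = g ** cayley A + map_matrix ((*) (ntr A)) g" "A ** g = cayley A ** g + map_matrix ((*) (ntr A)) g"
    using cayley_decomp[of A] by (metis matrix_add_ldistrib mat_mult_right, metis matrix_add_rdistrib' mat_mult_left)
  then show ?thesis by simp
qed

text \<open>A and its image have literally the same centralizer, so regularity transfers without
  computing a dimension; orbits map onto orbits because \<open>cayley\<close> commutes with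
  conjugation.\<close>

lemma cayley_regular_orbits:
  assumes "Orb \<in> regular_orbits (SL :: (complex^'n^'n) set)"
  shows "cayley ` Orb \<in> regular_orbits sl"
proof -
  obtain A where A: "Orb = conj_orbit A" "A \<in> SL" "regular_element A"
    using assms by (auto simp: regular_orbits_def)
  have "cayley ` Orb = conj_orbit (cayley A)"
    unfolding A(1) conj_orbit_def by (force simp: cayley_conj)
  moreover have "regular_element (cayley A)"
    using A(3) by (simp add: regular_element_def cayley_commute_iff)
  ultimately show ?thesis unfolding regular_orbits_def using cayley_in_sl by blast
qed


section \<open>The ring of functions on the Lie algebra\<close>

definition sres :: "(complex^'n^'n \<Rightarrow> complex) \<Rightarrow> ('n::finite) sl_fun" where
  "sres p = Abs_sl_fun (restrict p sl)"

lemma sl_eval_sres: "poly_fun p \<Longrightarrow> sl_eval (sres p) = restrict p sl"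
  unfolding sres_def by (rule Abs_sl_fun_inverse) (rule restrict_regular)

lemma sl_eval_sres' [simp]: "poly_fun p \<Longrightarrow> X \<in> sl \<Longrightarrow> sl_eval (sres p) X = p X"
  by (simp add: sl_eval_sres)

lemma sl_fun_eqI:
  assumes "\<And>X. X \<in> sl \<Longrightarrow> sl_eval f X = sl_eval g X" shows "f = g"
proof -
  have "sl_eval f = restrict (sl_eval f) sl" "sl_eval g = restrict (sl_eval g) sl"
    using regular_functions_restrict[OF sl_eval] by metis+
  then have "sl_eval f = sl_eval g" using assms by (metis restrict_ext)
  then show ?thesis by (simp add: sl_eval_inject)
qed

lemma sl_fun_cases:
  obtains p where "poly_fun p" "f = sres p"
proof -
  obtain p where "poly_fun p" "sl_eval f = restrict p sl" using sl_eval[of f] by (metis regular_functionsE)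
  then show thesis using that by (metis sl_eval_sres sl_eval_inject)
qed

lemma sl_eval_simps [simp]:
  assumes "X \<in> sl"
  shows "sl_eval (f + g) X = sl_eval f X + sl_eval g X" "sl_eval (f * g) X = sl_eval f X * sl_eval g X"
    "sl_eval (f - g) X = sl_eval f X - sl_eval g X" "sl_eval (- f) X = - sl_eval f X"
    "sl_eval 0 X = 0" "sl_eval 1 X = 1" "sl_eval (sl_const c) X = c"
  using assms by (simp_all add: plus_sl_fun.rep_eq times_sl_fun.rep_eq minus_sl_fun.rep_eq uminus_sl_fun.rep_eq
      zero_sl_fun.rep_eq one_sl_fun.rep_eq sl_const.rep_eq)

lemma sl_eval_sum: "X \<in> sl \<Longrightarrow> sl_eval (\<Sum>i\<in>I. f i) X = (\<Sum>i\<in>I. sl_eval (f i) X)"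
  by (induction I rule: infinite_finite_induct) simp_all

lemma sl_const_simps [simp]: "sl_const 0 = 0" "sl_const 1 = 1" "sl_const (a + b) = sl_const a + sl_const b"
    "sl_const (a * b) = sl_const a * sl_const b" "sl_const (- a) = - sl_const a"
  by (auto intro: sl_fun_eqI)

lemma sres_simps:
  assumes "poly_fun p" "poly_fun q"
  shows "sres (\<lambda>X. p X + q X) = sres p + sres q" "sres (\<lambda>X. p X * q X) = sres p * sres q"
  using assms by (auto intro!: sl_fun_eqI simp: poly_fun_add poly_fun_mult)

lemma sres_const: "sres (\<lambda>_. c) = sl_const c"
  by (auto intro!: sl_fun_eqI)

text \<open>Reduces identities between derivations and algebra automorphisms to the coordinate
  functions.\<close>

lemma sl_fun_induct [case_names const coord add mult]:
  assumes "\<And>c. P (sl_const c)" "\<And>i j. P (sres (\<lambda>X. X $ i $ j))" "\<And>f g. P f \<Longrightarrow> P g \<Longrightarrow> P (f + g)"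
    "\<And>f g. P f \<Longrightarrow> P g \<Longrightarrow> P (f * g)"
  shows "P f"
proof -
  obtain p where p: "poly_fun p" "f = sres p" by (rule sl_fun_cases)
  from p(1) have "P (sres p)"
    by (induction rule: poly_fun_induct) (simp_all add: assms sres_const sres_simps)
  then show ?thesis by (simp add: p)
qed

lemma cayley_sl: "X \<in> sl \<Longrightarrow> cayley X = X" for X :: "complex^'n^'n"
  by (simp add: cayley_eq sl_def)

lemma sl_scale: "X \<in> sl \<Longrightarrow> map_matrix ((*) t) X \<in> sl"
  by (simp add: sl_def trace_def flip: sum_distrib_left)

lemma sl_add: "X \<in> sl \<Longrightarrow> Y \<in> sl \<Longrightarrow> X + Y \<in> sl"
  by (simp add: sl_def trace_add)

lemma sl_fun_on_ray:
  assumes "X \<in> sl" obtains P where "\<And>t. sl_eval f (map_matrix ((*) t) X) = poly P t"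
proof -
  obtain p where p: "poly_fun p" "f = sres p" by (rule sl_fun_cases)
  obtain P where P: "\<And>t. p (map_matrix ((*) t) X) = poly P t" by (rule poly_fun_on_ray[OF p(1), of X]) blast
  show thesis by (rule that[of P]) (simp add: p sl_scale assms flip: P)
qed


section \<open>Directional derivatives\<close>

lemma dir_deriv_has_derivative:
  assumes "V \<in> sl" "X \<in> sl"
  shows "((\<lambda>t. sl_eval f (X + map_matrix ((*) t) V)) has_field_derivative sl_eval (dir_deriv V f) X) (at 0)"
proof -
  obtain p where p: "poly_fun p" "f = sres p" by (rule sl_fun_cases)
  obtain q where q: "((\<lambda>t. p (X + map_matrix ((*) t) V)) has_field_derivative q X) (at 0)"
    using poly_fun_dir_deriv[OF p(1)] by blast
  have "(\<lambda>t. sl_eval f (X + map_matrix ((*) t) V)) = (\<lambda>t. p (X + map_matrix ((*) t) V))"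
    using assms by (simp add: p sl_add sl_scale)
  then show ?thesis using q DERIV_imp_deriv[OF q] assms by (simp add: sl_eval_dir_deriv)
qed

lemma dir_deriv_eqI:
  assumes "V \<in> sl" "\<And>X. X \<in> sl \<Longrightarrow>
    ((\<lambda>t. sl_eval f (X + map_matrix ((*) t) V)) has_field_derivative sl_eval g X) (at 0)"
  shows "dir_deriv V f = g"
  by (rule sl_fun_eqI) (rule DERIV_unique[OF dir_deriv_has_derivative[OF assms(1)] assms(2)])

lemma dir_deriv_add: "V \<in> sl \<Longrightarrow> dir_deriv V (f + g) = dir_deriv V f + dir_deriv V g"
proof (rule dir_deriv_eqI)
  fix X :: "complex^'a^'a" assume "V \<in> sl" "X \<in> sl"
  then show "((\<lambda>t. sl_eval (f + g) (X + map_matrix ((*) t) V)) has_field_derivative sl_eval (dir_deriv V f + dir_deriv V g) X) (at 0)"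
    using DERIV_add[OF dir_deriv_has_derivative dir_deriv_has_derivative, of V X V X f g]
    by (simp add: sl_add sl_scale)
qed

lemma dir_deriv_mult: "V \<in> sl \<Longrightarrow> dir_deriv V (f * g) = dir_deriv V f * g + f * dir_deriv V g"
proof (rule dir_deriv_eqI)
  fix X :: "complex^'a^'a" assume "V \<in> sl" "X \<in> sl"
  moreover have "X + map_matrix ((*) 0) V = X" by (simp add: vec_eq_iff)
  ultimately show "((\<lambda>t. sl_eval (f * g) (X + map_matrix ((*) t) V)) has_field_derivative sl_eval (dir_deriv V f * g + f * dir_deriv V g) X) (at 0)"
    using DERIV_mult[OF dir_deriv_has_derivative dir_deriv_has_derivative, of V X V X f g]
    by (simp add: sl_add sl_scale algebra_simps)
qed

lemma dir_deriv_const [simp]: "V \<in> sl \<Longrightarrow> dir_deriv V (sl_const c) = 0"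
  by (rule dir_deriv_eqI) (simp_all add: sl_add sl_scale)

lemma dir_deriv_scale: "V \<in> sl \<Longrightarrow> dir_deriv V (sl_const c * f) = sl_const c * dir_deriv V f"
  by (simp add: dir_deriv_mult)

lemma dir_deriv_0 [simp]: "V \<in> sl \<Longrightarrow> dir_deriv V 0 = 0"
  using dir_deriv_const[of V 0] by simp

lemma dir_deriv_sum: "V \<in> sl \<Longrightarrow> dir_deriv V (\<Sum>i\<in>I. f i) = (\<Sum>i\<in>I. dir_deriv V (f i))"
  by (induction I rule: infinite_finite_induct) (simp_all add: dir_deriv_add)

lemma dir_deriv_linear:
  assumes "V \<in> sl" "poly_fun l" "\<And>X t. l (X + map_matrix ((*) t) V) = l X + t * c"
  shows "dir_deriv V (sres l) = sl_const c"
proof (rule dir_deriv_eqI[OF assms(1)])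
  fix X :: "complex^'a^'a" assume "X \<in> sl"
  moreover have "((\<lambda>t. l X + t * c) has_field_derivative c) (at 0)" by (auto intro!: derivative_eq_intros)
  ultimately show "((\<lambda>t. sl_eval (sres l) (X + map_matrix ((*) t) V)) has_field_derivative sl_eval (sl_const c) X) (at 0)"
    using assms by (simp add: sl_add sl_scale)
qed

lemma dir_deriv_coord: "V \<in> sl \<Longrightarrow> dir_deriv V (sres (\<lambda>X. X $ i $ j)) = sl_const (V $ i $ j)"
  by (rule dir_deriv_linear) auto

lemma dir_deriv_direction_add:
  assumes "V \<in> sl" "W \<in> sl" shows "dir_deriv (V + W) f = dir_deriv V f + dir_deriv W f"
  by (induction f rule: sl_fun_induct)
    (simp_all add: assms sl_add dir_deriv_coord dir_deriv_add dir_deriv_mult algebra_simps)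

lemma dir_deriv_direction_scale:
  assumes "V \<in> sl" shows "dir_deriv (map_matrix ((*) c) V) f = sl_const c * dir_deriv V f"
proof -
  define W where "W = map_matrix ((*) c) V"
  have W: "W \<in> sl" "\<And>i j. W $ i $ j = c * V $ i $ j" using assms by (simp_all add: W_def sl_scale)
  have "dir_deriv W f = sl_const c * dir_deriv V f"
    by (induction f rule: sl_fun_induct)
      (simp_all add: assms W dir_deriv_coord dir_deriv_add dir_deriv_mult algebra_simps)
  then show ?thesis by (simp add: W_def)
qed

lemma zero_scale: "map_matrix ((*) 0) V = (0 :: complex^'n^'n)"
  by (simp add: vec_eq_iff)

lemma dir_deriv_direction_0: "dir_deriv 0 f = 0"
  using dir_deriv_direction_scale[OF zero_in_sl, of 0 f] by (simp add: zero_scale)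

lemma sl_sum: "(\<And>i. i \<in> I \<Longrightarrow> V i \<in> sl) \<Longrightarrow> (\<Sum>i\<in>I. V i) \<in> sl"
  by (induction I rule: infinite_finite_induct) (auto simp: zero_in_sl sl_add)

lemma dir_deriv_direction_sum:
  "(\<And>i. i \<in> I \<Longrightarrow> V i \<in> sl) \<Longrightarrow> dir_deriv (\<Sum>i\<in>I. V i) f = (\<Sum>i\<in>I. dir_deriv (V i) f)"
  by (induction I rule: infinite_finite_induct) (simp_all add: dir_deriv_direction_0 dir_deriv_direction_add sl_sum)

lemma dir_deriv_commute:
  assumes "V \<in> sl" "W \<in> sl" shows "dir_deriv V (dir_deriv W f) = dir_deriv W (dir_deriv V f)"
  by (induction f rule: sl_fun_induct)
    (simp_all add: assms dir_deriv_coord dir_deriv_add dir_deriv_mult algebra_simps)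


section \<open>Conjugation\<close>

lemma sl_eval_act: "g \<in> SL \<Longrightarrow> X \<in> sl \<Longrightarrow> sl_eval (sl_act g f) X = sl_eval f (matrix_inv g ** X ** g)"
  by (simp add: sl_eval_sl_act)

lemma sl_act_simps:
  assumes "g \<in> SL"
  shows "sl_act g (f + h) = sl_act g f + sl_act g h" "sl_act g (f * h) = sl_act g f * sl_act g h"
    "sl_act g (f - h) = sl_act g f - sl_act g h" "sl_act g (sl_const c) = sl_const c"
    "sl_act g 0 = 0" "sl_act g 1 = 1"
  using assms by (auto intro!: sl_fun_eqI simp: sl_eval_act sl_conj)

lemma sl_act_sum: "g \<in> SL \<Longrightarrow> sl_act g (\<Sum>i\<in>I. f i) = (\<Sum>i\<in>I. sl_act g (f i))"
  by (induction I rule: infinite_finite_induct) (simp_all add: sl_act_simps)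

lemma conj_cancel:
  assumes "g \<in> SL"
  shows "g ** (matrix_inv g ** X ** g) ** matrix_inv g = X" "matrix_inv g ** (g ** X ** matrix_inv g) ** g = X"
proof -
  have "g ** (matrix_inv g ** X ** g) ** matrix_inv g = (g ** matrix_inv g) ** X ** (g ** matrix_inv g)"
    by (simp add: matrix_mul_assoc)
  then show "g ** (matrix_inv g ** X ** g) ** matrix_inv g = X" by (simp add: SL_inverse[OF assms])
  have "matrix_inv g ** (g ** X ** matrix_inv g) ** g = (matrix_inv g ** g) ** X ** (matrix_inv g ** g)"
    by (simp add: matrix_mul_assoc)
  then show "matrix_inv g ** (g ** X ** matrix_inv g) ** g = X" by (simp add: SL_inverse[OF assms])
qed

lemma sl_conj': "g \<in> SL \<Longrightarrow> X \<in> sl \<Longrightarrow> g ** X ** matrix_inv g \<in> sl"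
  using sl_conj[of "matrix_inv g" X] by (simp add: matrix_inv_SL)

lemma sl_act_inverse:
  assumes "g \<in> SL" shows "sl_act g (sl_act (matrix_inv g) f) = f" "sl_act (matrix_inv g) (sl_act g f) = f"
  using assms by (auto intro!: sl_fun_eqI simp: sl_eval_act sl_conj sl_conj' matrix_inv_SL conj_cancel)

lemma conj_scale: "P ** map_matrix ((*) t) X ** Q = map_matrix ((*) t) (P ** X ** Q)" for P Q X :: "complex^'n^'n"
  by (simp add: vec_eq_iff matrix_matrix_mult_def sum_distrib_left sum_distrib_right mult_ac)

lemma conj_add: "P ** (X + Y) ** Q = P ** X ** Q + P ** Y ** Q" for P Q X Y :: "complex^'n^'n"
  by (simp add: matrix_add_ldistrib matrix_add_rdistrib')

lemma sl_act_dir_deriv: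
  fixes g :: "complex^'n^'n"
  assumes g: "g \<in> SL" and V: "V \<in> sl"
  shows "sl_act g (dir_deriv V f) = dir_deriv (g ** V ** matrix_inv g) (sl_act g f)"
proof (induction f rule: sl_fun_induct)
  case (const c)
  show ?case using assms by (simp add: sl_act_simps sl_conj')
next
  case (coord i j)
  let ?l = "\<lambda>X :: complex^'n^'n. (matrix_inv g ** X ** g) $ i $ j"
  have l: "poly_fun ?l" by (rule poly_fun_conj) auto
  have "sl_act g (sres (\<lambda>X. X $ i $ j)) = sres ?l"
    using g l by (auto intro!: sl_fun_eqI simp: sl_eval_act sl_conj)
  moreover have "dir_deriv (g ** V ** matrix_inv g) (sres ?l) = sl_const (V $ i $ j)"
    by (rule dir_deriv_linear[OF sl_conj'[OF g V] l]) (simp add: conj_add conj_scale conj_cancel[OF g])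
  ultimately show ?case using assms by (simp add: dir_deriv_coord sl_act_simps)
qed (use assms in \<open>simp_all add: sl_act_simps dir_deriv_add dir_deriv_mult sl_conj'\<close>)


section \<open>Homogeneous components\<close>

text \<open>Homogeneity is expressed by values, so sums, products and conjugates inherit it at once;
  \<open>hom_in_span\<close> leads back to monomials. The zero function is homogeneous of every
  degree.\<close>

definition hom :: "nat \<Rightarrow> ('n::finite) sl_fun \<Rightarrow> bool" where
  "hom k f \<longleftrightarrow> (\<forall>t. \<forall>X\<in>sl. sl_eval f (map_matrix ((*) t) X) = t ^ k * sl_eval f X)"

lemma hom_0 [simp]: "hom k 0"
  by (simp add: hom_def sl_scale)

lemma hom_add: "hom k f \<Longrightarrow> hom k g \<Longrightarrow> hom k (f + g)"
  by (simp add: hom_def sl_scale algebra_simps)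

lemma hom_diff: "hom k f \<Longrightarrow> hom k g \<Longrightarrow> hom k (f - g)"
  by (simp add: hom_def sl_scale algebra_simps)

lemma hom_scale: "hom k f \<Longrightarrow> hom k (sl_const c * f)"
  by (simp add: hom_def sl_scale algebra_simps)

lemma hom_mult: "hom k f \<Longrightarrow> hom l g \<Longrightarrow> hom (k + l) (f * g)"
  by (simp add: hom_def sl_scale algebra_simps power_add)

lemma hom_act: "g \<in> SL \<Longrightarrow> hom k f \<Longrightarrow> hom k (sl_act g f)"
  by (simp add: hom_def sl_eval_act sl_scale conj_scale sl_conj)

lemma hom_mfun: "hom (mdeg \<alpha>) (sres (mfun \<alpha>))"
  by (simp add: hom_def sl_scale mfun_scale poly_fun_mfun)

lemma hom_eval_0:
  assumes "hom k f" "k \<noteq> 0" shows "sl_eval f 0 = 0"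
  using assms(1)[unfolded hom_def, THEN spec[of _ 0], THEN bspec, OF zero_in_sl] assms(2)
  by (simp add: zero_scale power_0_left)

lemma hom_0_eval:
  assumes "hom 0 f" "X \<in> sl" shows "sl_eval f X = sl_eval f 0"
  using assms(1)[unfolded hom_def, THEN spec[of _ 0], THEN bspec, OF assms(2)] by (simp add: zero_scale)

text \<open>Differentiate f (t X + s t V) = t^k f (X + s V) with respect to s at 0. As
  \<open>k - 1\<close> is truncated, degree 0 gets a statement of its own.\<close>

lemma dir_deriv_hom:
  assumes "V \<in> sl" "hom k f"
  shows "hom (k - 1) (dir_deriv V f)" "k = 0 \<Longrightarrow> dir_deriv V f = 0"
proof -
  have e: "t * sl_eval (dir_deriv V f) (map_matrix ((*) t) X) = t ^ k * sl_eval (dir_deriv V f) X" if X: "X \<in> sl" for t X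
  proof -
    have "((\<lambda>s. sl_eval f (map_matrix ((*) t) X + map_matrix ((*) s) (map_matrix ((*) t) V))) has_field_derivative
      t * sl_eval (dir_deriv V f) (map_matrix ((*) t) X)) (at 0)"
      using dir_deriv_has_derivative[of "map_matrix ((*) t) V" "map_matrix ((*) t) X" f] assms X
      by (simp add: sl_scale dir_deriv_direction_scale)
    moreover have "map_matrix ((*) t) X + map_matrix ((*) s) (map_matrix ((*) t) V) = map_matrix ((*) t) (X + map_matrix ((*) s) V)" for s
      by (simp add: vec_eq_iff algebra_simps)
    then have "sl_eval f (map_matrix ((*) t) X + map_matrix ((*) s) (map_matrix ((*) t) V)) = t ^ k * sl_eval f (X + map_matrix ((*) s) V)" for s
      using assms X by (simp add: hom_def sl_add sl_scale)
    moreover have "((\<lambda>s. t ^ k * sl_eval f (X + map_matrix ((*) s) V)) has_field_derivative t ^ k * sl_eval (dir_deriv V f) X) (at 0)"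
      by (rule DERIV_cmult) (rule dir_deriv_has_derivative[OF assms(1) X])
    ultimately show ?thesis by (simp add: DERIV_unique)
  qed
  show "dir_deriv V f = 0" if "k = 0"
    by (rule sl_fun_eqI) (use e[of _ 0] that in simp)
  show "hom (k - 1) (dir_deriv V f)"
  proof (cases k)
    case 0
    have "dir_deriv V f = 0" by (rule sl_fun_eqI) (use e[of _ 0] 0 in simp)
    then show ?thesis by simp
  next
    case (Suc m)
    show ?thesis unfolding hom_def
    proof (intro allI ballI)
      fix t and X :: "complex^'a^'a" assume X: "X \<in> sl"
      obtain P where P: "\<And>t. sl_eval (dir_deriv V f) (map_matrix ((*) t) X) = poly P t"
        by (rule sl_fun_on_ray[OF X]) blast
      \<comment> \<open>\<open>e\<close> gives homogeneity only after multiplication by t;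
        cancelling the factor between polynomials also covers t = 0.\<close>
      have "poly ([:0, 1:] * (P - monom (sl_eval (dir_deriv V f) X) m)) t = 0" for t
        using e[OF X, of t] by (simp add: P Suc poly_monom algebra_simps)
      then have "[:0, 1:] * (P - monom (sl_eval (dir_deriv V f) X) m) = 0"
        using poly_all_0_iff_0 by blast
      then have "P = monom (sl_eval (dir_deriv V f) X) m" by simp
      then show "sl_eval (dir_deriv V f) (map_matrix ((*) t) X) = t ^ (k - 1) * sl_eval (dir_deriv V f) X"
        by (simp add: P Suc poly_monom)
    qed
  qed
qed

interpretation sv: vector_space "\<lambda>(c::complex) (f :: ('n::finite) sl_fun). sl_const c * f"
  by unfold_locales (simp_all add: algebra_simps)

definition hmons :: "nat \<Rightarrow> ('n::finite) sl_fun set" where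
  "hmons k = (\<lambda>\<alpha>. sres (mfun \<alpha>)) ` {\<alpha>. mdeg \<alpha> = k}"

lemma finite_hmons: "finite (hmons k :: ('n::finite) sl_fun set)"
proof -
  have "{\<alpha> :: 'n expo. mdeg \<alpha> = k} \<subseteq> PiE UNIV (\<lambda>_. {..k})"
    unfolding mdeg_def by (auto intro!: member_le_sum)
  then have "finite {\<alpha> :: 'n expo. mdeg \<alpha> = k}" by (rule finite_subset) (intro finite_PiE, auto)
  then show ?thesis by (simp add: hmons_def)
qed

lemma span_hmons_hom: "f \<in> sv.span (hmons k) \<Longrightarrow> hom k f"
  by (induction rule: sv.span_induct_alt) (auto simp: hmons_def intro: hom_add hom_scale hom_mfun)

lemma homogeneous_decomposition:
  fixes f :: "('n::finite) sl_fun"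
  obtains d F where "\<And>k. F k \<in> sv.span (hmons k)" "f = (\<Sum>k\<le>d. F k)"
proof -
  obtain p where p: "poly_fun p" "f = sres p" by (rule sl_fun_cases)
  have "p \<in> fv.span (range mfun)" using p(1) by (rule poly_fun_span_mfun)
  then have "poly_fun p \<and> (\<exists>d F. (\<forall>k. F k \<in> sv.span (hmons k)) \<and> (\<forall>k>d. F k = 0) \<and> sres p = (\<Sum>k\<le>d. F k))"
  proof (induction rule: fv.span_induct_alt)
    case base
    have "sres (0 :: complex^'n^'n \<Rightarrow> complex) = 0"
      using sres_const[of 0] by (simp add: zero_fun_def)
    then show ?case by (auto simp: zero_fun_def intro!: exI[of _ 0] exI[of _ "\<lambda>_. 0"] sv.span_zero)
  next
    case (step c x y)
    then obtain \<alpha> d F where *: "x = mfun \<alpha>" "poly_fun y" "\<And>k. F k \<in> sv.span (hmons k)" "\<And>k. k > d \<Longrightarrow> F k = 0" "sres y = (\<Sum>k\<le>d. F k)"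
      by blast
    let ?G = "\<lambda>k. (if k = mdeg \<alpha> then sl_const c * sres (mfun \<alpha>) else 0) + F k"
    have cx: "poly_fun (\<lambda>X. c * x X)" using * by auto
    then have "sres ((\<lambda>X. c * x X) + y) = sres (\<lambda>X. c * x X) + sres y"
      using sres_simps(1)[of "\<lambda>X. c * x X" y] * by (simp add: plus_fun_def)
    also have "sres (\<lambda>X. c * x X) = sl_const c * sres (mfun \<alpha>)"
      using sres_simps(2)[of "\<lambda>_. c" x] * by (simp add: sres_const poly_fun_mfun)
    also have "\<dots> = (\<Sum>k\<le>max d (mdeg \<alpha>). if k = mdeg \<alpha> then sl_const c * sres (mfun \<alpha>) else 0)" by simp
    also have "sres y = (\<Sum>k\<le>max d (mdeg \<alpha>). F k)"
      unfolding *(5) by (rule sum.mono_neutral_left) (auto simp: *(4))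
    finally have "sres ((\<lambda>X. c * x X) + y) = (\<Sum>k\<le>max d (mdeg \<alpha>). ?G k)" by (simp only: sum.distrib)
    moreover have "?G k \<in> sv.span (hmons k)" for k
      by (intro sv.span_add *(3)) (auto simp: hmons_def sv.span_zero intro!: sv.span_scale[OF sv.span_base])
    moreover have "\<forall>k>max d (mdeg \<alpha>). ?G k = 0" using *(4) by auto
    moreover have "poly_fun ((\<lambda>X. c * x X) + y)" using cx *(2) by (auto simp: plus_fun_def)
    ultimately show ?case by (intro conjI exI[of _ "max d (mdeg \<alpha>)"] exI[of _ ?G]) blast+
  qed
  then show thesis using that p(2) by blast
qed

lemma hom_components_unique:
  assumes "\<And>k. hom k (F k)" "(\<Sum>k\<le>d. F k) = 0" "k \<le> d"
  shows "F k = 0"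
proof (rule sl_fun_eqI)
  fix X :: "complex^'a^'a" assume X: "X \<in> sl"
  define P where "P = (\<Sum>k\<le>d. monom (sl_eval (F k) X) k)"
  have "poly P t = sl_eval (\<Sum>k\<le>d. F k) (map_matrix ((*) t) X)" for t
    using assms(1) X by (simp add: P_def poly_sum poly_monom sl_eval_sum sl_scale hom_def mult.commute)
  then have "poly P t = 0" for t using assms(2) X by (simp add: sl_scale)
  then have "P = 0" using poly_all_0_iff_0 by blast
  then have "coeff P k = 0" by simp
  then show "sl_eval (F k) X = sl_eval 0 X" using assms(3) X by (simp add: P_def coeff_sum)
qed

lemma hom_in_span:
  assumes "hom k f" shows "f \<in> sv.span (hmons k)"
proof -
  obtain d F where F: "\<And>k. F k \<in> sv.span (hmons k)" "f = (\<Sum>k\<le>d. F k)"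
    by (rule homogeneous_decomposition[of f]) blast
  let ?F = "\<lambda>j. if j \<le> d then F j else 0"
  let ?G = "\<lambda>j. ?F j - (if j = k then f else 0)"
  have "f = (\<Sum>j\<le>max d k. ?F j)" unfolding F(2) by (rule sum.mono_neutral_cong_left) auto
  then have "(\<Sum>j\<le>max d k. ?G j) = 0" by (simp add: sum_subtractf)
  moreover have "hom j (?G j)" for j
  proof (rule hom_diff)
    show "hom j (?F j)" using span_hmons_hom[OF F(1)] by simp
    show "hom j (if j = k then f else 0)" using assms by simp
  qed
  ultimately have "?G k = 0" by (intro hom_components_unique[of ?G "max d k"]) auto
  then show ?thesis using F(1)[of k] sv.span_zero by (auto split: if_splits)
qed


section \<open>The Fischer form\<close>

definition emat :: "'n \<times> 'n \<Rightarrow> complex^'n^'n" where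
  "emat e = (\<chi> i j. if (i, j) = e then 1 else 0)"

definition Dc :: "'n \<times> 'n \<Rightarrow> ('n::finite) sl_fun \<Rightarrow> 'n sl_fun" where
  "Dc e = dir_deriv (cayley (emat e))"

text \<open>The sum of \<open>cnj (D p) * D q\<close> at the origin, over all words \<open>D\<close> of length \<open>k\<close> in the derivatives along the
  projected matrix units; these form a tight frame of \<open>sl\<close>, which replaces an orthonormal basis.\<close>

primrec fisch :: "nat \<Rightarrow> ('n::finite) sl_fun \<Rightarrow> 'n sl_fun \<Rightarrow> complex" where
  "fisch 0 p q = cnj (sl_eval p 0) * sl_eval q 0"
| "fisch (Suc k) p q = (\<Sum>e\<in>UNIV. fisch k (Dc e p) (Dc e q))"

lemma Dc_add: "Dc e (f + g) = Dc e f + Dc e g" and Dc_scale: "Dc e (sl_const c * f) = sl_const c * Dc e f"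
  and Dc_0 [simp]: "Dc e 0 = 0"
  unfolding Dc_def by (simp_all add: dir_deriv_add dir_deriv_scale cayley_in_sl)

lemma fisch_add: "fisch k (p + p') q = fisch k p q + fisch k p' q" "fisch k p (q + q') = fisch k p q + fisch k p q'"
  by (induction k arbitrary: p p' q q') (simp_all add: zero_in_sl algebra_simps Dc_add sum.distrib)

lemma fisch_scale: "fisch k (sl_const c * p) q = cnj c * fisch k p q" "fisch k p (sl_const c * q) = c * fisch k p q"
  by (induction k arbitrary: p q) (simp_all add: zero_in_sl Dc_scale sum_distrib_left)

lemma fisch_0 [simp]: "fisch k 0 q = 0" "fisch k p 0 = 0"
  using fisch_scale(1)[of k 0 0 q] fisch_scale(2)[of k p 0 0] by simp_all

lemma fisch_sum: "fisch k p (\<Sum>i\<in>I. q i) = (\<Sum>i\<in>I. fisch k p (q i))"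
  by (induction I rule: infinite_finite_induct) (simp_all add: fisch_add)

lemma fisch_hom:
  "hom m q \<Longrightarrow> k \<noteq> m \<Longrightarrow> fisch k p q = 0" "hom m p \<Longrightarrow> k \<noteq> m \<Longrightarrow> fisch k p q = 0"
proof (induction k arbitrary: p q m)
  case 0
  { case 1 then show ?case by (simp add: hom_eval_0) }
  { case 2 then show ?case by (simp add: hom_eval_0) }
next
  case (Suc k)
  { case 1
    show ?case
    proof (cases "m = 0")
      case True
      then show ?thesis using dir_deriv_hom(2)[OF cayley_in_sl 1(1)] by (simp add: Dc_def)
    next
      case False
      then show ?thesis using Suc.IH(1)[of "m - 1"] dir_deriv_hom(1)[OF cayley_in_sl 1(1)] 1(2) by (simp add: Dc_def)
    qed }
  { case 2
    show ?case
    proof (cases "m = 0")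
      case True
      then show ?thesis using dir_deriv_hom(2)[OF cayley_in_sl 2(1)] by (simp add: Dc_def)
    next
      case False
      then show ?thesis using Suc.IH(2)[of "m - 1"] dir_deriv_hom(1)[OF cayley_in_sl 2(1)] 2(2) by (simp add: Dc_def)
    qed }
qed

lemma fisch_bounded:
  fixes q :: "('n::finite) sl_fun"
  obtains d where "\<And>k p. k > d \<Longrightarrow> fisch k p q = 0"
proof -
  obtain d F where F: "\<And>k. F k \<in> sv.span (hmons k)" "q = (\<Sum>k\<le>d. F k)"
    by (rule homogeneous_decomposition[of q]) blast
  have "fisch k p q = 0" if "k > d" for k p
    unfolding F(2) fisch_sum
    by (rule sum.neutral) (use fisch_hom(1)[OF span_hmons_hom[OF F(1)]] that in auto)
  then show thesis using that by blast
qed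

text \<open>Only finitely many terms are nonzero, by \<open>fisch_bounded\<close>. The weight 1 / k!
  absorbs the factor k in \<open>fisch_lin\<close> and makes multiplication and differentiation
  exactly adjoint.\<close>

definition ip :: "('n::finite) sl_fun \<Rightarrow> 'n sl_fun \<Rightarrow> complex" where
  "ip p q = suminf (\<lambda>k. fisch k p q / fact k)"

lemma ip_finite:
  assumes "\<And>k. k > d \<Longrightarrow> fisch k p q = 0" shows "ip p q = (\<Sum>k\<le>d. fisch k p q / fact k)"
  unfolding ip_def by (rule suminf_finite) (use assms in auto)

lemma ip_summable: "summable (\<lambda>k. fisch k p q / fact k)"
proof -
  obtain d where "\<And>k p. k > d \<Longrightarrow> fisch k p q = 0" using fisch_bounded[of q] by blast
  then show ?thesis by (intro summable_finite[of "{..d}"]) (auto simp: not_le)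
qed

lemma ip_add: "ip (p + p') q = ip p q + ip p' q" "ip p (q + q') = ip p q + ip p q'"
  by (simp_all add: ip_def fisch_add add_divide_distrib suminf_add ip_summable)

lemma ip_scale: "ip (sl_const c * p) q = cnj c * ip p q" "ip p (sl_const c * q) = c * ip p q"
  using suminf_mult[OF ip_summable, of "cnj c" p q] suminf_mult[OF ip_summable, of c p q]
  by (simp_all add: ip_def fisch_scale)

lemma ip_0 [simp]: "ip 0 q = 0" "ip p 0 = 0"
  by (simp_all add: ip_def)

lemma ip_diff: "ip (p - p') q = ip p q - ip p' q" "ip p (q - q') = ip p q - ip p q'"
proof -
  show "ip (p - p') q = ip p q - ip p' q" using ip_add(1)[of "p - p'" p' q] by simp
  show "ip p (q - q') = ip p q - ip p q'" using ip_add(2)[of p "q - q'" q'] by simp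
qed

lemma ip_sum: "ip (\<Sum>i\<in>I. p i) q = (\<Sum>i\<in>I. ip (p i) q)"
  by (induction I rule: infinite_finite_induct) (simp_all add: ip_add)

lemma ip_hom: "hom k p \<Longrightarrow> hom m q \<Longrightarrow> k \<noteq> m \<Longrightarrow> ip p q = 0"
proof -
  assume *: "hom k p" "hom m q" "k \<noteq> m"
  have "fisch l p q = 0" for l using fisch_hom(1)[OF *(2), of l p] fisch_hom(2)[OF *(1), of l q] *(3) by (cases "l = m") auto
  then show ?thesis by (simp add: ip_def)
qed

lemma fisch_nonneg: "Im (fisch k p p) = 0 \<and> 0 \<le> Re (fisch k p p)"
  by (induction k arbitrary: p) (auto intro!: sum_nonneg)

lemma fisch_self_zero:
  assumes "fisch (Suc k) p p = 0" shows "fisch k (Dc e p) (Dc e p) = 0"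
proof -
  have "(\<Sum>e\<in>UNIV. Re (fisch k (Dc e p) (Dc e p))) = 0" using arg_cong[OF assms, of Re] by simp
  then have "\<forall>e\<in>UNIV. Re (fisch k (Dc e p) (Dc e p)) = 0"
    by (subst (asm) sum_nonneg_eq_0_iff) (simp_all add: fisch_nonneg)
  then have "Re (fisch k (Dc e p) (Dc e p)) = 0" by blast
  then show ?thesis using fisch_nonneg[of k "Dc e p"] by (simp add: complex_eq_iff)
qed

lemma sum_emat: "V = (\<Sum>e\<in>UNIV. map_matrix ((*) (V $ fst e $ snd e)) (emat e))"
proof -
  have "(\<Sum>e\<in>UNIV. V $ fst e $ snd e * emat e $ i $ j) = (\<Sum>e\<in>UNIV. if e = (i, j) then V $ fst e $ snd e else 0)" for i j
    by (rule sum.cong) (auto simp: emat_def)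
  then show ?thesis by (simp add: vec_eq_iff)
qed

lemma cayley_add: "cayley (A + B) = cayley A + cayley B"
  and cayley_scale: "cayley (map_matrix ((*) c) A) = map_matrix ((*) c) (cayley A)"
  by (simp_all add: cayley_eq vec_eq_iff mat_def trace_def sum.distrib algebra_simps flip: sum_distrib_left)

lemma cayley_sum: "cayley (\<Sum>i\<in>I. A i) = (\<Sum>i\<in>I. cayley (A i))" for A :: "'i \<Rightarrow> complex^'n^'n"
  by (induction I rule: infinite_finite_induct) (simp_all add: cayley_add cayley_sl zero_in_sl)

text \<open>The projected matrix units are linearly dependent, since the diagonal ones sum to 0. The
  entries of V still serve as coefficients, because \<open>cayley\<close> is linear and fixes
  V.\<close>

lemma dir_deriv_basis:
  assumes "V \<in> sl" shows "dir_deriv V f = (\<Sum>e\<in>UNIV. sl_const (V $ fst e $ snd e) * Dc e f)"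
proof -
  have "V = cayley (\<Sum>e\<in>UNIV. map_matrix ((*) (V $ fst e $ snd e)) (emat e))"
    using cayley_sl[OF assms] sum_emat[of V] by simp
  then have "V = (\<Sum>e\<in>UNIV. map_matrix ((*) (V $ fst e $ snd e)) (cayley (emat e)))"
    by (simp add: cayley_sum cayley_scale)
  then have "dir_deriv V f = dir_deriv (\<Sum>e\<in>UNIV. map_matrix ((*) (V $ fst e $ snd e)) (cayley (emat e))) f"
    by simp
  also have "\<dots> = (\<Sum>e\<in>UNIV. sl_const (V $ fst e $ snd e) * Dc e f)"
    by (subst dir_deriv_direction_sum) (simp_all add: sl_scale cayley_in_sl dir_deriv_direction_scale Dc_def)
  finally show ?thesis .
qed

lemma all_derivs_zero_const:
  assumes "\<And>e. Dc e p = 0" "X \<in> sl" shows "sl_eval p X = sl_eval p 0"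
proof -
  obtain P where P: "\<And>t. sl_eval p (map_matrix ((*) t) X) = poly P t" by (rule sl_fun_on_ray[OF assms(2)]) blast
  have "poly (pderiv P) t = 0" for t
  proof -
    have "dir_deriv X p = 0" using assms by (simp add: dir_deriv_basis)
    then have "((\<lambda>s. sl_eval p (map_matrix ((*) t) X + map_matrix ((*) s) X)) has_field_derivative 0) (at 0)"
      using dir_deriv_has_derivative[OF assms(2) sl_scale[OF assms(2), of t], of p] assms(2) by (simp add: sl_scale)
    moreover have "map_matrix ((*) t) X + map_matrix ((*) s) X = map_matrix ((*) (t + s)) X" for s
      by (simp add: vec_eq_iff algebra_simps)
    ultimately have "((\<lambda>s. poly P (t + s)) has_field_derivative 0) (at 0)" by (simp add: P)
    then have "(poly P has_field_derivative 0) (at t)" 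
      using DERIV_shift[where f = "poly P" and x = 0 and z = t] by (simp add: add.commute)
    then show ?thesis using DERIV_unique poly_DERIV by blast
  qed
  then have "pderiv P = 0" using poly_all_0_iff_0 by blast
  then have "degree P = 0" by (simp add: pderiv_eq_0_iff)
  then have "poly P 1 = poly P 0" by (metis degree_0_id poly_pCons poly_0 mult_zero_right)
  moreover have "map_matrix ((*) 1) X = X" by (simp add: vec_eq_iff)
  ultimately show ?thesis using P[of 1] P[of 0] by (simp add: zero_scale)
qed

text \<open>Induction on the degree: all first derivatives have lower degree and inherit the
  hypothesis by positivity, so they vanish. Then p is constant, and its value at 0 is zero.\<close>

lemma fisch_definite:
  assumes "\<And>k. hom k (F k)" "p = (\<Sum>k\<le>d. F k)" "\<And>k. fisch k p p = 0"
  shows "p = 0"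
  using assms
proof (induction d arbitrary: p F)
  case 0
  have "sl_eval p 0 = 0" using 0(3)[of 0] by simp
  moreover have "hom 0 p" using 0(1)[of 0] 0(2) by simp
  ultimately show ?case by (intro sl_fun_eqI) (use hom_0_eval[of p] in simp)
next
  case (Suc d)
  have "Dc e p = 0" for e
  proof (rule Suc.IH)
    show "hom k (Dc e (F (Suc k)))" for k
      using dir_deriv_hom(1)[OF cayley_in_sl Suc.prems(1)[of "Suc k"]] by (simp add: Dc_def)
    have "Dc e (F 0) = 0" unfolding Dc_def by (rule dir_deriv_hom(2)[OF cayley_in_sl Suc.prems(1)[of 0]]) simp
    moreover have "Dc e p = (\<Sum>k\<le>Suc d. Dc e (F k))"
      unfolding Suc.prems(2) Dc_def by (rule dir_deriv_sum[OF cayley_in_sl])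
    ultimately show "Dc e p = (\<Sum>k\<le>d. Dc e (F (Suc k)))" by (simp add: sum.atMost_Suc_shift del: sum.atMost_Suc)
    show "fisch k (Dc e p) (Dc e p) = 0" for k by (rule fisch_self_zero) (rule Suc.prems(3))
  qed
  moreover have "sl_eval p 0 = 0" using Suc.prems(3)[of 0] by simp
  ultimately show ?case by (intro sl_fun_eqI) (use all_derivs_zero_const in fastforce)
qed

lemma ip_definite:
  assumes "ip p p = 0" shows "p = 0"
proof -
  obtain d where d: "\<And>k q. k > d \<Longrightarrow> fisch k q p = 0" using fisch_bounded[of p] by blast
  have "(\<Sum>k\<le>d. Re (fisch k p p) / fact k) = Re (ip p p)" 
  proof -
    have "Re (z / fact k) = Re z / fact k" for z k by (metis Re_divide_of_real of_real_fact)
    then show ?thesis by (simp add: ip_finite[OF d])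
  qed
  then have "(\<Sum>k\<le>d. Re (fisch k p p) / fact k) = 0" using assms by simp
  then have "\<forall>k\<in>{..d}. Re (fisch k p p) / fact k = 0"
    by (subst (asm) sum_nonneg_eq_0_iff) (simp_all add: fisch_nonneg)
  then have z: "Re (fisch k p p) = 0" if "k \<le> d" for k using that by simp
  have "fisch k p p = 0" for k
  proof (cases "k \<le> d")
    case True
    then show ?thesis using z[OF True] fisch_nonneg[of k p] by (simp add: complex_eq_iff)
  qed (simp add: d)
  moreover obtain d F where F: "\<And>k. F k \<in> sv.span (hmons k)" "p = (\<Sum>k\<le>d. F k)"
    by (rule homogeneous_decomposition[of p]) blast
  ultimately show ?thesis using fisch_definite[OF span_hmons_hom[OF F(1)] F(2)] by blast
qed


section \<open>Multiplication and differentiation are adjoint\<close>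

text \<open>The Hermitian pairing with V, antilinear in V; multiplication by it will be adjoint to
  the derivative along V.\<close>

definition lin :: "complex^'n^'n \<Rightarrow> ('n::finite) sl_fun" where
  "lin V = sres (\<lambda>X. \<Sum>e\<in>UNIV. cnj (V $ fst e $ snd e) * X $ fst e $ snd e)"

lemma poly_fun_lin: "poly_fun (\<lambda>X :: complex^'n^'n. \<Sum>e\<in>UNIV. cnj (V $ fst e $ snd e) * X $ fst e $ snd e)"
  by (intro poly_fun_sum poly_fun_mult poly_fun_const poly_fun_coord)

lemma lin_eval: "X \<in> sl \<Longrightarrow> sl_eval (lin V) X = (\<Sum>e\<in>UNIV. cnj (V $ fst e $ snd e) * X $ fst e $ snd e)"
  by (simp add: lin_def poly_fun_lin)

lemma dir_deriv_lin:
  "W \<in> sl \<Longrightarrow> dir_deriv W (lin V) = sl_const (\<Sum>e\<in>UNIV. cnj (V $ fst e $ snd e) * W $ fst e $ snd e)"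
  unfolding lin_def
  by (rule dir_deriv_linear[OF _ poly_fun_lin]) (simp_all add: algebra_simps sum.distrib sum_distrib_left)

text \<open>The frame property: pairing V with a projected matrix unit gives just an entry of V,
  because the scalar correction is multiplied by the trace of V.\<close>

lemma Dc_lin:
  assumes "V \<in> sl" shows "Dc e (lin V) = sl_const (cnj (V $ fst e $ snd e))"
proof -
  have p: "(\<Sum>e'\<in>UNIV. cnj (V $ fst e' $ snd e') * A $ fst e' $ snd e') = (\<Sum>i\<in>UNIV. \<Sum>j\<in>UNIV. cnj (V $ i $ j) * A $ i $ j)" for A
    by (simp add: sum.cartesian_product split_def)
  have "(\<Sum>e'\<in>UNIV. cnj (V $ fst e' $ snd e') * cayley (emat e) $ fst e' $ snd e') =
    (\<Sum>e'\<in>UNIV. cnj (V $ fst e' $ snd e') * emat e $ fst e' $ snd e') -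
    (\<Sum>e'\<in>UNIV. cnj (V $ fst e' $ snd e') * mat (ntr (emat e)) $ fst e' $ snd e')"
    by (simp add: cayley_eq ntr_def algebra_simps sum_subtractf)
  also have "(\<Sum>e'\<in>UNIV. cnj (V $ fst e' $ snd e') * emat e $ fst e' $ snd e') =
    (\<Sum>e'\<in>UNIV. if e' = e then cnj (V $ fst e $ snd e) else 0)"
    by (rule sum.cong) (auto simp: emat_def)
  also have "(\<Sum>e'\<in>UNIV. cnj (V $ fst e' $ snd e') * mat (ntr (emat e)) $ fst e' $ snd e') = cnj (trace V) * ntr (emat e)"
    unfolding p by (simp add: mat_def trace_def sum_distrib_right if_distrib sum.delta cong: if_cong)
  finally show ?thesis using assms by (simp add: Dc_def dir_deriv_lin[OF cayley_in_sl] sl_def)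
qed

text \<open>The Leibniz rule splits each derivative of \<open>lin V * p\<close>. The derivatives of
  \<open>lin V\<close> reassemble the derivative of \<open>q\<close> along V, and the other summands
  contribute k further copies by induction. For \<open>k = 0\<close> the factor 0 hides the
  truncated \<open>k - 1\<close>.\<close>

lemma fisch_lin:
  assumes V: "V \<in> sl"
  shows "fisch k (lin V * p) q = of_nat k * fisch (k - 1) p (dir_deriv V q)"
proof (induction k arbitrary: p q)
  case 0
  show ?case by (simp add: zero_in_sl lin_eval)
next
  case (Suc k)
  have "fisch (Suc k) (lin V * p) q = (\<Sum>e\<in>UNIV. fisch k (sl_const (cnj (V $ fst e $ snd e)) * p + lin V * Dc e p) (Dc e q))"
    by (simp add: Dc_lin[OF V, unfolded Dc_def] Dc_def dir_deriv_mult cayley_in_sl)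
  also have "\<dots> = (\<Sum>e\<in>UNIV. V $ fst e $ snd e * fisch k p (Dc e q)) + of_nat k * (\<Sum>e\<in>UNIV. fisch (k - 1) (Dc e p) (dir_deriv V (Dc e q)))"
    by (simp add: fisch_add fisch_scale Suc.IH sum.distrib sum_distrib_left)
  also have "(\<Sum>e\<in>UNIV. V $ fst e $ snd e * fisch k p (Dc e q)) = fisch k p (dir_deriv V q)"
    by (simp add: dir_deriv_basis[OF V] fisch_sum fisch_scale)
  also have "of_nat k * (\<Sum>e\<in>UNIV. fisch (k - 1) (Dc e p) (dir_deriv V (Dc e q))) = of_nat k * fisch k p (dir_deriv V q)"
  proof (cases k)
    case (Suc m)
    have "dir_deriv V (Dc e q) = Dc e (dir_deriv V q)" for e
      unfolding Dc_def by (rule dir_deriv_commute[OF V cayley_in_sl])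
    then show ?thesis by (simp add: Suc)
  qed simp
  finally show ?case by (simp add: algebra_simps)
qed

lemma ip_lin:
  assumes "V \<in> sl" shows "ip (lin V * p) q = ip p (dir_deriv V q)"
proof -
  have "ip p (dir_deriv V q) = suminf (\<lambda>k. fisch (Suc k) (lin V * p) q / fact (Suc k))"
    unfolding ip_def by (rule suminf_cong) (simp add: fisch_lin[OF assms] del: of_nat_Suc fisch.simps)
  also have "\<dots> = ip (lin V * p) q - fisch 0 (lin V * p) q / fact 0"
    unfolding ip_def by (rule suminf_split_head[OF ip_summable])
  finally show ?thesis by (simp add: zero_in_sl lin_eval)
qed

text \<open>Pairs an operator with its symbol, multiplication by which is the adjoint. Scalars are
  conjugated because the form is antilinear on the left. As a relation it is built along with the
  operator; that each side determines the other is proved from definiteness.\<close>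

inductive adj_rel :: "('n::finite) sl_fun \<Rightarrow> ('n sl_fun \<Rightarrow> 'n sl_fun) \<Rightarrow> bool" where
  lin: "V \<in> sl \<Longrightarrow> adj_rel (lin V) (dir_deriv V)"
| add: "adj_rel a D \<Longrightarrow> adj_rel b E \<Longrightarrow> adj_rel (a + b) (\<lambda>f. D f + E f)"
| scale: "adj_rel a D \<Longrightarrow> adj_rel (sl_const (cnj c) * a) (\<lambda>f. sl_const c * D f)"
| comp: "adj_rel a D \<Longrightarrow> adj_rel b E \<Longrightarrow> adj_rel (a * b) (D \<circ> E)"

lemma adj_rel_op: "adj_rel a D \<Longrightarrow> D \<in> const_coeff_ops"
  by (induction rule: adj_rel.induct) (blast intro: const_coeff_ops.intros)+

lemma adj_rel_eval: "adj_rel a D \<Longrightarrow> sl_eval a 0 = 0"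
  by (induction rule: adj_rel.induct) (simp_all add: zero_in_sl lin_eval)

lemma adj_rel_ip: "adj_rel a D \<Longrightarrow> ip (a * p) q = ip p (D q)"
proof (induction arbitrary: p q rule: adj_rel.induct)
  case (lin V)
  then show ?case by (rule ip_lin)
next
  case (add a D b E)
  then show ?case by (simp add: distrib_right ip_add)
next
  case (scale a D c)
  then show ?case by (simp add: mult.assoc ip_scale)
next
  case (comp a D b E)
  have "ip (a * b * p) q = ip (b * (a * p)) q" by (simp add: algebra_simps)
  then show ?case by (simp add: comp.IH)
qed

lemma ops_adj_rel: "D \<in> const_coeff_ops \<Longrightarrow> \<exists>a. adj_rel a D"
proof (induction rule: const_coeff_ops.induct)
  case (scale D c)
  then show ?case using adj_rel.scale[of _ D c] by blast
qed (blast intro: adj_rel.intros)+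

lemma lin_cayley_emat: "lin (cayley (emat (i, j))) = sres (\<lambda>X. X $ i $ j)"
proof (rule sl_fun_eqI)
  fix X :: "complex^'a^'a" assume X: "X \<in> sl"
  have "sl_eval (Dc (i, j) (lin X)) 0 = cnj (X $ i $ j)" by (simp add: Dc_lin[OF X] zero_in_sl)
  moreover have "sl_eval (Dc (i, j) (lin X)) 0 = (\<Sum>e\<in>UNIV. cnj (X $ fst e $ snd e) * cayley (emat (i, j)) $ fst e $ snd e)"
    by (simp add: Dc_def dir_deriv_lin[OF cayley_in_sl] zero_in_sl)
  ultimately have "cnj (\<Sum>e\<in>UNIV. cnj (X $ fst e $ snd e) * cayley (emat (i, j)) $ fst e $ snd e) = X $ i $ j" by simp
  then show "sl_eval (lin (cayley (emat (i, j)))) X = sl_eval (sres (\<lambda>X. X $ i $ j)) X"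
    using X by (simp add: lin_eval mult.commute)
qed

lemma adj_rel_zero: "\<exists>D. adj_rel 0 D"
  using adj_rel.scale[OF adj_rel.lin[OF zero_in_sl], of 0] by auto

text \<open>Operators without constant term have symbols vanishing at 0, so the value at 0 is
  subtracted in order to allow induction over all functions.\<close>

lemma adj_rel_exists_shift: "\<exists>D. adj_rel (a - sl_const (sl_eval a 0)) D"
proof (induction a rule: sl_fun_induct)
  case (const c)
  then show ?case using adj_rel_zero by (simp add: zero_in_sl)
next
  case (coord i j)
  then show ?case using adj_rel.lin[OF cayley_in_sl[of "emat (i, j)"]]
    by (auto simp: zero_in_sl lin_cayley_emat)
next
  case (add f g)
  then obtain D E where "adj_rel (f - sl_const (sl_eval f 0)) D" "adj_rel (g - sl_const (sl_eval g 0)) E" by blast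
  from adj_rel.add[OF this] show ?case by (auto simp: zero_in_sl algebra_simps)
next
  case (mult f g)
  let ?f = "f - sl_const (sl_eval f 0)" and ?g = "g - sl_const (sl_eval g 0)"
  obtain D E where *: "adj_rel ?f D" "adj_rel ?g E" using mult by blast
  \<comment> \<open>Expand f = f' + f(0) and g = g' + g(0). The double conjugates bring the scalars
    into the form required by the scaling rule of \<open>adj_rel\<close>.\<close>
  have eq: "f * g - sl_const (sl_eval (f * g) 0) = (?f * ?g + sl_const (cnj (cnj (sl_eval f 0))) * ?g) + sl_const (cnj (cnj (sl_eval g 0))) * ?f"
    by (simp add: zero_in_sl algebra_simps)
  show ?case unfolding eq
    by (rule exI, rule adj_rel.add[OF adj_rel.add[OF adj_rel.comp[OF *] adj_rel.scale[OF *(2)]] adj_rel.scale[OF *(1)]])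
qed

lemma adj_rel_exists: "sl_eval a 0 = 0 \<Longrightarrow> \<exists>D. adj_rel a D"
  using adj_rel_exists_shift[of a] by simp

lemma adj_rel_unique:
  assumes "adj_rel a D" shows "adj_rel a E \<Longrightarrow> D = E" "adj_rel b D \<Longrightarrow> a = b"
proof -
  assume E: "adj_rel a E"
  have "ip p (D q - E q) = 0" for p q
    by (simp add: ip_diff flip: adj_rel_ip[OF assms] adj_rel_ip[OF E])
  then have "D q - E q = 0" for q by (rule ip_definite)
  then show "D = E" by (simp add: fun_eq_iff)
next
  assume b: "adj_rel b D"
  have "ip (a - b) q = 0" for q
    using adj_rel_ip[OF assms, of 1 q] adj_rel_ip[OF b, of 1 q] by (simp add: ip_diff)
  then have "a - b = 0" by (intro ip_definite)
  then show "a = b" by simp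
qed


section \<open>Invariant operators correspond to invariant functions\<close>

definition adjoint :: "complex^'n^'n \<Rightarrow> complex^'n^'n" where
  "adjoint A = (\<chi> i j. cnj (A $ j $ i))"

lemma adjoint_adjoint [simp]: "adjoint (adjoint A) = A"
  by (simp add: adjoint_def vec_eq_iff)

lemma adjoint_mult: "adjoint (A ** B) = adjoint B ** adjoint A"
  by (simp add: adjoint_def vec_eq_iff matrix_matrix_mult_def mult.commute)

lemma adjoint_mat_1 [simp]: "adjoint (mat 1) = mat 1"
  by (simp add: adjoint_def vec_eq_iff mat_def)

lemma det_adjoint: "det (adjoint A) = cnj (det A)" for A :: "complex^'n^'n"
proof -
  have "det (adjoint A) = det (transpose (adjoint A))" by simp
  also have "\<dots> = cnj (det A)"
    by (simp add: det_def adjoint_def transpose_def)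
  finally show ?thesis .
qed

lemma adjoint_SL: "g \<in> SL \<Longrightarrow> adjoint g \<in> SL"
  by (simp add: SL_def det_adjoint)

lemma matrix_inv_adjoint: "g \<in> SL \<Longrightarrow> matrix_inv (adjoint g) = adjoint (matrix_inv g)"
  by (rule matrix_inv_eqI) (simp_all add: SL_inverse flip: adjoint_mult)

lemma lin_trace: "(\<Sum>e\<in>UNIV. cnj (V $ fst e $ snd e) * X $ fst e $ snd e) = trace (adjoint V ** X)" for V X :: "complex^'n^'n"
proof -
  have "(\<Sum>e\<in>UNIV. cnj (V $ fst e $ snd e) * X $ fst e $ snd e) = (\<Sum>i\<in>UNIV. \<Sum>j\<in>UNIV. cnj (V $ i $ j) * X $ i $ j)"
    by (simp add: sum.cartesian_product split_def)
  also have "\<dots> = (\<Sum>j\<in>UNIV. \<Sum>i\<in>UNIV. cnj (V $ i $ j) * X $ i $ j)" by (rule sum.swap)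
  finally show ?thesis by (simp add: trace_def matrix_matrix_mult_def adjoint_def)
qed

lemma sl_act_lin:
  fixes g :: "complex^'n^'n"
  assumes g: "g \<in> SL"
  shows "sl_act g (lin V) = lin (adjoint (matrix_inv g) ** V ** adjoint g)"
proof (rule sl_fun_eqI)
  fix X :: "complex^'n^'n" assume X: "X \<in> sl"
  have "trace (adjoint V ** (matrix_inv g ** X ** g)) = trace (g ** (adjoint V ** matrix_inv g ** X))"
    by (subst trace_mul_sym) (simp add: matrix_mul_assoc)
  then show "sl_eval (sl_act g (lin V)) X = sl_eval (lin (adjoint (matrix_inv g) ** V ** adjoint g)) X"
    using X g by (simp add: sl_eval_act lin_eval sl_conj lin_trace adjoint_mult matrix_mul_assoc)
qed

text \<open>Acting with \<open>g\<close> on functions is adjoint to acting with the conjugate transpose.\<close>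

lemma adj_rel_act:
  fixes g :: "complex^'n^'n"
  assumes "adj_rel a D" and g: "g \<in> SL"
  shows "adj_rel (sl_act g a) (\<lambda>f. sl_act (matrix_inv (adjoint g)) (D (sl_act (adjoint g) f)))"
  using assms(1)
proof (induction rule: adj_rel.induct)
  case (lin V)
  let ?h = "matrix_inv (adjoint g)"
  have h: "?h \<in> SL" by (rule matrix_inv_SL(1)[OF adjoint_SL[OF g]])
  have "(\<lambda>f. sl_act ?h (dir_deriv V (sl_act (adjoint g) f))) = dir_deriv (?h ** V ** matrix_inv ?h)"
    using sl_act_inverse(2)[OF adjoint_SL[OF g]] by (simp add: sl_act_dir_deriv[OF h lin] fun_eq_iff)
  also have "?h ** V ** matrix_inv ?h = adjoint (matrix_inv g) ** V ** adjoint g"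
    using matrix_inv_SL(2)[OF adjoint_SL[OF g]] by (simp add: matrix_inv_adjoint[OF g])
  finally show ?case
    using adj_rel.lin[OF sl_conj'[OF h lin]] matrix_inv_SL(2)[OF adjoint_SL[OF g]]
    by (simp add: sl_act_lin[OF g] matrix_inv_adjoint[OF g])
next
  case (add a D b E)
  from adj_rel.add[OF add.IH] show ?case
    by (simp add: sl_act_simps g matrix_inv_SL adjoint_SL)
next
  case (scale a D c)
  from adj_rel.scale[OF scale.IH, of c] show ?case
    by (simp add: sl_act_simps g matrix_inv_SL adjoint_SL)
next
  case (comp a D b E)
  from adj_rel.comp[OF comp.IH] show ?case
    by (simp add: sl_act_simps g matrix_inv_SL adjoint_SL sl_act_inverse o_def)
qed

text \<open>By \<open>adj_rel_act\<close> the action on symbols corresponds to conjugating operators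
  with the conjugate transpose, which permutes \<open>SL\<close>; operator and symbol determine each
  other.\<close>

lemma adj_rel_invariant:
  assumes "adj_rel a D" shows "invariant_op D \<longleftrightarrow> a \<in> sl_invariants"
proof
  assume D: "invariant_op D"
  show "a \<in> sl_invariants" unfolding sl_invariants_def
  proof (intro CollectI ballI)
    fix g :: "complex^'a^'a" assume g: "g \<in> SL"
    have "(\<lambda>f. sl_act (matrix_inv (adjoint g)) (D (sl_act (adjoint g) f))) = D"
      using D adjoint_SL[OF g] by (simp add: invariant_op_def sl_act_inverse)
    then show "sl_act g a = a"
      using adj_rel_act[OF assms g] adj_rel_unique(2)[OF assms] by metis
  qed
next
  assume a: "a \<in> sl_invariants"
  show "invariant_op D" unfolding invariant_op_def
  proof (intro ballI allI)
    fix h :: "complex^'a^'a" and f assume h: "h \<in> SL"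
    have "sl_act (adjoint h) a = a" using a adjoint_SL[OF h] by (simp add: sl_invariants_def)
    then have "adj_rel a (\<lambda>f. sl_act (matrix_inv h) (D (sl_act h f)))"
      using adj_rel_act[OF assms adjoint_SL[OF h]] by simp
    then have "D = (\<lambda>f. sl_act (matrix_inv h) (D (sl_act h f)))" by (rule adj_rel_unique(1)[OF assms])
    then have "sl_act h (D f) = sl_act h (sl_act (matrix_inv h) (D (sl_act h f)))" by metis
    then show "D (sl_act h f) = sl_act h (D f)" by (simp add: sl_act_inverse h)
  qed
qed

lemma sl_harmonic_iff:
  fixes h :: "('n::finite) sl_fun"
  shows "h \<in> sl_harmonic \<longleftrightarrow> (\<forall>a\<in>sl_invariants. sl_eval a 0 = 0 \<longrightarrow> (\<forall>p. ip (a * p) h = 0))"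
proof
  assume h: "h \<in> sl_harmonic"
  show "\<forall>a\<in>sl_invariants. sl_eval a 0 = 0 \<longrightarrow> (\<forall>p. ip (a * p) h = 0)"
  proof (intro ballI impI allI)
    fix a p :: "'n sl_fun" assume a: "a \<in> sl_invariants" "sl_eval a 0 = 0"
    obtain D where D: "adj_rel a D" using adj_rel_exists[OF a(2)] by blast
    then have "D h = 0"
      using h a(1) adj_rel_op[OF D] adj_rel_invariant[OF D] by (simp add: sl_harmonic_def)
    then show "ip (a * p) h = 0" by (simp add: adj_rel_ip[OF D])
  qed
next
  assume h: "\<forall>a\<in>sl_invariants. sl_eval a 0 = 0 \<longrightarrow> (\<forall>p. ip (a * p) h = 0)"
  show "h \<in> sl_harmonic" unfolding sl_harmonic_def
  proof (intro CollectI ballI impI)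
    fix D :: "'n sl_fun \<Rightarrow> 'n sl_fun" assume D: "D \<in> const_coeff_ops" "invariant_op D"
    obtain a where a: "adj_rel a D" using ops_adj_rel[OF D(1)] by blast
    \<comment> \<open>Orthogonality to the ideal is tested with the cofactor \<open>D h\<close>
      itself, so definiteness applies.\<close>
    have "ip (D h) (D h) = ip (a * D h) h" by (simp add: adj_rel_ip[OF a])
    also have "\<dots> = 0" using h a D(2) adj_rel_invariant[OF a] adj_rel_eval[OF a] by blast
    finally show "D h = 0" by (rule ip_definite)
  qed
qed

lemma sl_harmonic_closed:
  "0 \<in> sl_harmonic" "h \<in> sl_harmonic \<Longrightarrow> h' \<in> sl_harmonic \<Longrightarrow> h + h' \<in> sl_harmonic"
  "h \<in> sl_harmonic \<Longrightarrow> sl_const c * h \<in> sl_harmonic"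
  by (simp_all add: sl_harmonic_iff ip_add ip_scale)

lemma sl_harmonic_sum: "(\<And>i. i \<in> I \<Longrightarrow> h i \<in> sl_harmonic) \<Longrightarrow> (\<Sum>i\<in>I. h i) \<in> sl_harmonic"
  by (induction I rule: infinite_finite_induct) (auto simp: sl_harmonic_closed)

lemma sl_invariants_closed:
  "sl_const c \<in> sl_invariants" "0 \<in> sl_invariants" "1 \<in> sl_invariants"
  "a \<in> sl_invariants \<Longrightarrow> b \<in> sl_invariants \<Longrightarrow> a + b \<in> sl_invariants"
  "a \<in> sl_invariants \<Longrightarrow> b \<in> sl_invariants \<Longrightarrow> a * b \<in> sl_invariants"
  by (simp_all add: sl_invariants_def sl_act_simps)

lemma hom_components_invariant:
  assumes "\<And>k. hom k (F k)" "(\<Sum>k\<le>d. F k) \<in> sl_invariants" "k \<le> d"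
  shows "F k \<in> sl_invariants"
  unfolding sl_invariants_def
proof (intro CollectI ballI)
  fix g :: "complex^'a^'a" assume g: "g \<in> SL"
  have "(\<Sum>k\<le>d. sl_act g (F k) - F k) = 0"
    using assms(2) g by (simp add: sum_subtractf sl_invariants_def flip: sl_act_sum)
  then have "sl_act g (F k) - F k = 0"
    by (intro hom_components_unique[of "\<lambda>k. sl_act g (F k) - F k" d] hom_diff hom_act g assms)
  then show "sl_act g (F k) = F k" by simp
qed


section \<open>Separation of variables\<close>

text \<open>Gram-Schmidt, one vector at a time; a vector depending on the previous ones gives
  \<open>b' = 0\<close> and leaves the span unchanged.\<close>

lemma orthogonal_projection:
  assumes "finite B" shows "\<exists>j\<in>sv.span B. \<forall>b\<in>B. ip b (f - j) = 0"
  using assms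
proof (induction B arbitrary: f rule: finite_induct)
  case empty
  show ?case by (intro bexI[of _ 0] sv.span_zero) simp
next
  case (insert b B)
  have ortho_span: "ip c x = 0" if "\<forall>b\<in>B. ip b x = 0" "c \<in> sv.span B" for c x
    using that(2) by (induction rule: sv.span_induct_alt) (use that(1) in \<open>auto simp: ip_add ip_scale\<close>)
  obtain jb where jb: "jb \<in> sv.span B" "\<forall>c\<in>B. ip c (b - jb) = 0" using insert.IH by blast
  obtain jf where jf: "jf \<in> sv.span B" "\<forall>c\<in>B. ip c (f - jf) = 0" using insert.IH by blast
  define b' where "b' = b - jb"
  have sub: "sv.span B \<subseteq> sv.span (insert b B)" by (rule sv.span_mono) auto
  show ?case
  proof (cases "b' = 0")
    case True
    then have "b \<in> sv.span B" using jb(1) by (simp add: b'_def)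
    then show ?thesis using jf sub ortho_span[OF jf(2)] by blast
  next
    case False
    define z where "z = ip b' (f - jf) / ip b' b'"
    have z: "ip b' (f - jf - sl_const z * b') = 0"
      using ip_definite[of b'] False by (auto simp: ip_diff ip_scale z_def)
    have B: "\<forall>c\<in>B. ip c (f - jf - sl_const z * b') = 0"
      using jf(2) jb(2) by (simp add: ip_diff(2)[of _ "f - jf"] ip_scale flip: b'_def)
    have "ip b (f - jf - sl_const z * b') = ip b' (f - jf - sl_const z * b') + ip jb (f - jf - sl_const z * b')"
      by (simp add: b'_def flip: ip_add)
    also have "\<dots> = 0" using z ortho_span[OF B jb(1)] by simp
    finally have "ip b (f - jf - sl_const z * b') = 0" .
    moreover have "jf + sl_const z * b' \<in> sv.span (insert b B)"
      unfolding b'_def using subsetD[OF sub jf(1)] subsetD[OF sub jb(1)] sv.span_base[of b "insert b B"]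
      by (intro sv.span_add sv.span_scale sv.span_diff) auto
    ultimately show ?thesis using B
      by (intro bexI[of _ "jf + sl_const z * b'"]) (auto simp flip: diff_diff_eq)
  qed
qed

inductive_set inv_harm :: "('n::finite) sl_fun set" where
  zero: "0 \<in> inv_harm"
| add: "a \<in> sl_invariants \<Longrightarrow> h \<in> sl_harmonic \<Longrightarrow> f \<in> inv_harm \<Longrightarrow> a * h + f \<in> inv_harm"

lemma inv_harm_add: "f \<in> inv_harm \<Longrightarrow> g \<in> inv_harm \<Longrightarrow> f + g \<in> inv_harm"
  by (induction rule: inv_harm.induct) (auto simp: add.assoc intro: inv_harm.add)

lemma inv_harm_mult: "f \<in> inv_harm \<Longrightarrow> a \<in> sl_invariants \<Longrightarrow> a * f \<in> inv_harm"
proof (induction rule: inv_harm.induct)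
  case (add b h f)
  then have "(a * b) * h + a * f \<in> inv_harm" by (intro inv_harm.add sl_invariants_closed)
  then show ?case by (simp add: algebra_simps)
qed (simp add: inv_harm.zero)

text \<open>Project f orthogonally onto the degree d part of the ideal J. The projection has
  cofactors of lower degree, covered by induction, and the difference is orthogonal to the whole
  ideal, hence harmonic.\<close>

lemma inv_harm_hom: "hom d f \<Longrightarrow> f \<in> inv_harm"
proof (induction d arbitrary: f rule: less_induct)
  case (less d)
  \<comment> \<open>Generators of the degree d part of the ideal; \<open>1 \<le> k\<close> forces
    the cofactor \<open>p\<close> to have degree less than d.\<close>
  define J :: "'a sl_fun set" where "J = {a * p | a p k. 1 \<le> k \<and> k \<le> d \<and> a \<in> sl_invariants \<and> hom k a \<and> hom (d - k) p}"
  have Jd: "hom d x" if "x \<in> J" for x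
  proof -
    obtain a p k where *: "x = a * p" "k \<le> d" "hom k a" "hom (d - k) p" using \<open>x \<in> J\<close> by (auto simp: J_def)
    then show ?thesis using hom_mult[OF *(3,4)] by simp
  qed
  then have "J \<subseteq> sv.span (hmons d)" using hom_in_span by blast
  obtain B where B: "B \<subseteq> J" "sv.independent B" "J \<subseteq> sv.span B"
    using sv.maximal_independent_subset[of J] by blast
  have fB: "finite B"
    using sv.independent_span_bound[OF finite_hmons B(2)] B(1) \<open>J \<subseteq> sv.span (hmons d)\<close> by blast
  obtain j where j: "j \<in> sv.span B" "\<forall>b\<in>B. ip b (f - j) = 0" using orthogonal_projection[OF fB] by blast
  define h where "h = f - j"
  have hJ: "ip x h = 0" if "x \<in> J" for x
  proof -
    have "x \<in> sv.span B" using B(3) that by blast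
    then show ?thesis
      by (induction rule: sv.span_induct_alt) (use j(2) in \<open>auto simp: ip_add ip_scale h_def\<close>)
  qed
  have "j \<in> sv.span (hmons d)"
    using j(1) sv.span_mono[of B "sv.span (hmons d)"] B(1) \<open>J \<subseteq> sv.span (hmons d)\<close> by (auto simp: sv.span_span)
  then have hh: "hom d h" unfolding h_def using less.prems span_hmons_hom by (intro hom_diff)
  have "h \<in> sl_harmonic" unfolding sl_harmonic_iff
  proof (intro ballI impI allI)
    fix a p :: "'a sl_fun" assume a: "a \<in> sl_invariants" "sl_eval a 0 = 0"
    obtain m F where F: "\<And>k. F k \<in> sv.span (hmons k)" "a = (\<Sum>k\<le>m. F k)"
      by (rule homogeneous_decomposition[of a]) blast
    obtain l G where G: "\<And>k. G k \<in> sv.span (hmons k)" "p = (\<Sum>k\<le>l. G k)"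
      by (rule homogeneous_decomposition[of p]) blast
    have Fh: "hom k (F k)" and Gh: "hom k (G k)" for k using span_hmons_hom F(1) G(1) by blast+
    have "sl_eval a 0 = (\<Sum>k\<le>m. if k = 0 then sl_eval (F 0) 0 else 0)"
      unfolding F(2) sl_eval_sum[OF zero_in_sl] by (rule sum.cong) (auto simp: hom_eval_0[OF Fh])
    then have "sl_eval (F 0) 0 = 0" using a(2) by simp
    then have F0: "F 0 = 0" by (intro sl_fun_eqI) (use hom_0_eval[OF Fh[of 0]] in simp)
    have Finv: "F k \<in> sl_invariants" if "k \<le> m" for k
      by (rule hom_components_invariant[of F m, OF Fh _ that]) (use a(1) F(2) in simp)
    have "ip (F k * G i) h = 0" if "k \<le> m" for k i
    \<comment> \<open>Either the invariant factor is the vanishing constant component, or the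
      degrees differ and the form is zero; the remaining products lie in \<open>J\<close>.\<close>
    proof (cases "k = 0 \<or> k + i \<noteq> d")
      case True
      then show ?thesis using F0 ip_hom[OF hom_mult[OF Fh[of k] Gh[of i]] hh] by auto
    next
      case False
      then have "F k * G i \<in> J" unfolding J_def using Finv[OF that] Fh[of k] Gh[of i]
        by (intro CollectI exI[of _ "F k"] exI[of _ "G i"] exI[of _ k]) auto
      then show ?thesis by (rule hJ)
    qed
    then show "ip (a * p) h = 0"
      unfolding F(2) G(2) sum_distrib_left sum_distrib_right ip_sum by (intro sum.neutral ballI) auto
  qed
  then have "1 * h + 0 \<in> inv_harm" by (intro inv_harm.intros sl_invariants_closed)
  then have "h \<in> inv_harm" by simp
  moreover have "j \<in> inv_harm" using j(1)
  proof (induction rule: sv.span_induct_alt)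
    case (step c x y)
    then obtain a p k where *: "x = a * p" "1 \<le> k" "k \<le> d" "a \<in> sl_invariants" "hom (d - k) p"
      using B(1) by (auto simp: J_def)
    then have "p \<in> inv_harm" using less.IH[of "d - k" p] by simp
    then have "sl_const c * (a * p) \<in> inv_harm"
      using *(4) by (intro inv_harm_mult sl_invariants_closed)
    then show ?case using step by (simp add: *(1) inv_harm_add)
  qed (rule inv_harm.zero)
  ultimately have "j + h \<in> inv_harm" by (intro inv_harm_add)
  then show ?case by (simp add: h_def)
qed

lemma inv_harm_UNIV: "f \<in> inv_harm"
proof -
  obtain d F where F: "\<And>k. F k \<in> sv.span (hmons k)" "f = (\<Sum>k\<le>d. F k)"
    by (rule homogeneous_decomposition[of f]) blast
  have "(\<Sum>k\<in>I. F k) \<in> inv_harm" for I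
    by (induction I rule: infinite_finite_induct)
      (auto intro: inv_harm.zero inv_harm_add inv_harm_hom[OF span_hmons_hom[OF F(1)]])
  then show ?thesis by (simp add: F(2))
qed

lemma poly_fun_sl_eval_cayley: "poly_fun (\<lambda>X. sl_eval f (cayley X))"
proof -
  obtain p where p: "poly_fun p" "f = sres p" by (rule sl_fun_cases)
  have "(\<lambda>X. sl_eval f (cayley X)) = (\<lambda>X. p (cayley X))" by (simp add: p cayley_in_sl)
  then show ?thesis using poly_fun_cayley[OF p(1)] by simp
qed

text \<open>Composition with \<open>cayley\<close> extends the invariant to all matrices, where it
  is still invariant because \<open>cayley\<close> commutes with conjugation.\<close>

lemma symring_sl_invariant:
  assumes "a \<in> sl_invariants" shows "symring (\<lambda>X. sl_eval a (cayley X))"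
proof (rule invariant_symring[OF poly_fun_sl_eval_cayley])
  fix g X :: "complex^'a^'a" assume g: "g \<in> SL"
  have "sl_eval a (cayley (matrix_inv g ** X ** g)) = sl_eval (sl_act g a) (cayley X)"
    by (simp add: cayley_conj[OF g] sl_eval_act[OF g cayley_in_sl])
  then show "sl_eval a (cayley (matrix_inv g ** X ** g)) = sl_eval a (cayley X)"
    using assms g by (simp add: sl_invariants_def)
qed

lemma sres_symring_invariant:
  assumes "symring r" shows "sres r \<in> sl_invariants"
  unfolding sl_invariants_def
proof (intro CollectI ballI sl_fun_eqI)
  fix g X :: "complex^'a^'a" assume "g \<in> SL" "X \<in> sl"
  then show "sl_eval (sl_act g (sres r)) X = sl_eval (sres r) X"
    by (simp add: sl_eval_act sl_conj symring_poly_fun[OF assms] symring_conj[OF assms] SL_inverse)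
qed

section \<open>Independence of harmonic functions over the invariants\<close>

lemma harmonic_independent:
  fixes v h :: "'j \<Rightarrow> ('n::finite) sl_fun"
  assumes J: "finite J" and v: "\<And>j. j \<in> J \<Longrightarrow> v j \<in> sl_invariants" and h: "\<And>j. j \<in> J \<Longrightarrow> h j \<in> sl_harmonic"
    and rel: "(\<Sum>j\<in>J. v j * h j) = 0"
    and ind: "\<And>z. (\<Sum>j\<in>J. sl_const (z j) * h j) = 0 \<Longrightarrow> \<forall>j\<in>J. z j = 0"
    and "j \<in> J"
  shows "v j = 0"
proof (rule ccontr)
  assume "v j \<noteq> 0"
  then obtain X0 where X0: "X0 \<in> sl" "sl_eval (v j) X0 \<noteq> 0"
    using sl_fun_eqI[of "v j" 0] by auto
  have 0: "(\<Sum>j\<in>J. sl_eval (v j) (cayley X) * sl_eval (h j) (cayley X)) = 0" for X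
    using arg_cong[OF rel, of "\<lambda>f. sl_eval f (cayley X)"] by (simp add: sl_eval_sum cayley_in_sl)
  have "sl_eval (v j) (cayley X0) \<noteq> 0" using X0 by (simp add: cayley_sl)
  from symring_relation[OF J symring_sl_invariant[OF v] poly_fun_sl_eval_cayley 0 \<open>j \<in> J\<close> this]
  obtain z F r where z: "\<exists>j\<in>J. z j \<noteq> 0" and F: "finite F" and r: "\<And>\<beta>. \<beta> \<in> F \<Longrightarrow> symring (r \<beta>)" "\<And>\<beta>. \<beta> \<in> F \<Longrightarrow> r \<beta> 0 = 0"
    "\<And>X. (\<Sum>j\<in>J. z j * sl_eval (h j) (cayley X)) = (\<Sum>\<beta>\<in>F. r \<beta> X * mfun \<beta> X)" by blast
  define w where "w = (\<Sum>j\<in>J. sl_const (z j) * h j)"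
  have w: "w \<in> sl_harmonic" unfolding w_def by (intro sl_harmonic_sum sl_harmonic_closed h)
  have weq: "w = (\<Sum>\<beta>\<in>F. sres (r \<beta>) * sres (mfun \<beta>))"
  proof (rule sl_fun_eqI)
    fix X :: "complex^'n^'n" assume X: "X \<in> sl"
    have "sl_eval w X = (\<Sum>j\<in>J. z j * sl_eval (h j) (cayley X))" using X by (simp add: w_def sl_eval_sum cayley_sl)
    also have "\<dots> = sl_eval (\<Sum>\<beta>\<in>F. sres (r \<beta>) * sres (mfun \<beta>)) X"
      unfolding r(3) using X by (simp add: sl_eval_sum symring_poly_fun r(1) poly_fun_mfun)
    finally show "sl_eval w X = sl_eval (\<Sum>\<beta>\<in>F. sres (r \<beta>) * sres (mfun \<beta>)) X" .
  qed
  \<comment> \<open>Each \<open>sres (r \<beta>)\<close> is an invariant without constant term. So w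
    lies in the ideal and is harmonic as well, which makes it orthogonal to itself.\<close>
  have "ip (sres (r \<beta>) * sres (mfun \<beta>)) w = 0" if "\<beta> \<in> F" for \<beta>
    using w sres_symring_invariant[OF r(1)[OF that]] r(2)[OF that] symring_poly_fun[OF r(1)[OF that]]
    by (simp add: sl_harmonic_iff zero_in_sl)
  then have "ip (\<Sum>\<beta>\<in>F. sres (r \<beta>) * sres (mfun \<beta>)) w = 0" by (simp add: ip_sum)
  then have "ip w w = 0" by (simp flip: weq)
  then have "w = 0" by (rule ip_definite)
  then show False using ind z unfolding w_def by blast
qed


section \<open>The ring of functions on the group\<close>

definition Sres :: "(complex^'n^'n \<Rightarrow> complex) \<Rightarrow> ('n::finite) SL_fun" where
  "Sres p = Abs_SL_fun (restrict p SL)"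

lemma SL_eval_Sres: "poly_fun p \<Longrightarrow> SL_eval (Sres p) = restrict p SL"
  unfolding Sres_def by (rule Abs_SL_fun_inverse) (rule restrict_regular)

lemma SL_fun_eqI:
  assumes "\<And>X. X \<in> SL \<Longrightarrow> SL_eval f X = SL_eval g X" shows "f = g"
proof -
  have "SL_eval f = restrict (SL_eval f) SL" "SL_eval g = restrict (SL_eval g) SL"
    using regular_functions_restrict[OF SL_eval] by metis+
  then have "SL_eval f = SL_eval g" using assms by (metis restrict_ext)
  then show ?thesis by (simp add: SL_eval_inject)
qed

lemma SL_fun_cases:
  obtains p where "poly_fun p" "f = Sres p"
proof -
  obtain p where "poly_fun p" "SL_eval f = restrict p SL" using SL_eval[of f] by (metis regular_functionsE)
  then show thesis using that by (metis SL_eval_Sres SL_eval_inject)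
qed

lemma SL_eval_simps [simp]:
  assumes "X \<in> SL"
  shows "SL_eval (f + g) X = SL_eval f X + SL_eval g X" "SL_eval (f * g) X = SL_eval f X * SL_eval g X"
    "SL_eval (f - g) X = SL_eval f X - SL_eval g X"
    "SL_eval 0 X = 0" "SL_eval 1 X = 1" "SL_eval (SL_const c) X = c"
    "SL_eval (pullback p) X = sl_eval p (cayley X)" "SL_eval chi X = ntr X"
  using assms by (simp_all add: plus_SL_fun.rep_eq times_SL_fun.rep_eq minus_SL_fun.rep_eq
      zero_SL_fun.rep_eq one_SL_fun.rep_eq SL_const.rep_eq chi.rep_eq SL_eval_pullback ntr_def)

lemma SL_eval_power: "X \<in> SL \<Longrightarrow> SL_eval (f ^ k) X = SL_eval f X ^ k"
  by (induction k) simp_all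

lemma SL_eval_sum: "X \<in> SL \<Longrightarrow> SL_eval (\<Sum>i\<in>I. f i) X = (\<Sum>i\<in>I. SL_eval (f i) X)"
  by (induction I rule: infinite_finite_induct) simp_all

lemma SL_const_simps: "SL_const 0 = 0" "SL_const 1 = 1" "SL_const (a + b) = SL_const a + SL_const b"
    "SL_const (a * b) = SL_const a * SL_const b"
  by (auto intro: SL_fun_eqI)

lemma pullback_simps:
  "pullback (f + g) = pullback f + pullback g" "pullback (f * g) = pullback f * pullback g"
  "pullback (f - g) = pullback f - pullback g" "pullback 0 = 0" "pullback 1 = 1" "pullback (sl_const c) = SL_const c"
  by (auto intro!: SL_fun_eqI simp: cayley_in_sl)

lemma pullback_sum: "pullback (\<Sum>i\<in>I. f i) = (\<Sum>i\<in>I. pullback (f i))"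
  by (induction I rule: infinite_finite_induct) (simp_all add: pullback_simps)

lemma inj_pullback: "inj pullback"
proof (rule injI, rule sl_fun_eqI)
  fix f g :: "'a sl_fun" and Y :: "complex^'a^'a" assume *: "pullback f = pullback g" "Y \<in> sl"
  obtain A where A: "A \<in> SL" "cayley A = Y" by (rule cayley_surj[OF *(2)])
  have "SL_eval (pullback f) A = SL_eval (pullback g) A" using *(1) by simp
  then show "sl_eval f Y = sl_eval g Y" using A by simp
qed

lemma SL_eval_act: "g \<in> SL \<Longrightarrow> X \<in> SL \<Longrightarrow> SL_eval (SL_act g f) X = SL_eval f (matrix_inv g ** X ** g)"
  by (simp add: SL_eval_SL_act)

lemma ntr_conj:
  assumes "g \<in> SL" shows "ntr (matrix_inv g ** X ** g) = ntr (X :: complex^'n^'n)"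
proof -
  have "trace (matrix_inv g ** X ** g) = trace X"
    by (metis trace_mul_sym matrix_mul_assoc SL_inverse(1)[OF assms] matrix_mul_lid)
  then show ?thesis by (simp add: ntr_def)
qed

lemma SL_act_simps:
  assumes "g \<in> SL"
  shows "SL_act g (f + h) = SL_act g f + SL_act g h" "SL_act g (f * h) = SL_act g f * SL_act g h"
    "SL_act g 0 = 0" "SL_act g 1 = 1" "SL_act g (SL_const c) = SL_const c"
    "SL_act g chi = chi" "SL_act g (pullback p) = pullback (sl_act g p)"
  using assms by (auto intro!: SL_fun_eqI simp: SL_eval_act SL_conj ntr_conj cayley_conj sl_eval_act cayley_in_sl)

lemma SL_act_power: "g \<in> SL \<Longrightarrow> SL_act g (f ^ k) = SL_act g f ^ k"
  by (induction k) (simp_all add: SL_act_simps)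

lemma SL_act_sum: "g \<in> SL \<Longrightarrow> SL_act g (\<Sum>i\<in>I. f i) = (\<Sum>i\<in>I. SL_act g (f i))"
  by (induction I rule: infinite_finite_induct) (simp_all add: SL_act_simps)

lemma inj_SL_act: "g \<in> SL \<Longrightarrow> inj (SL_act g)"
proof (rule inj_on_inverseI)
  fix f :: "'a SL_fun" and g :: "complex^'a^'a" assume g: "g \<in> SL"
  have c: "g ** X ** matrix_inv g \<in> SL" if "X \<in> SL" for X
    using SL_conj[OF matrix_inv_SL(1)[OF g] that] by (simp add: matrix_inv_SL(2)[OF g])
  show "SL_act (matrix_inv g) (SL_act g f) = f"
    by (rule SL_fun_eqI) (simp add: SL_eval_act g matrix_inv_SL c conj_cancel)
qed

lemma inj_sl_act: "g \<in> SL \<Longrightarrow> inj (sl_act g)"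
  by (rule inj_on_inverseI) (rule sl_act_inverse(2))

lemma SL_fun_expansion:
  fixes F :: "('n::finite) SL_fun"
  obtains f where "F = (\<Sum>i<CARD('n). pullback (f i) * chi ^ i)"
proof -
  obtain p where p: "poly_fun p" "F = Sres p" by (rule SL_fun_cases)
  obtain q r where *: "poly_fun q" "\<And>i. poly_fun (r i)"
    "\<And>X. p X = (det X - 1) * q X + (\<Sum>i<CARD('n). r i (cayley X) * ntr X ^ i)"
    by (rule divrepE[OF divrep_poly_fun[OF p(1)]]) blast
  have "F = (\<Sum>i<CARD('n). pullback (sres (r i)) * chi ^ i)"
  proof (rule SL_fun_eqI)
    fix X :: "complex^'n^'n" assume X: "X \<in> SL"
    then have "p X = (\<Sum>i<CARD('n). r i (cayley X) * ntr X ^ i)" by (simp add: *(3) SL_def)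
    then show "SL_eval F X = SL_eval (\<Sum>i<CARD('n). pullback (sres (r i)) * chi ^ i) X"
      using X by (simp add: SL_eval_sum SL_eval_power *(2) cayley_in_sl p SL_eval_Sres)
  qed
  then show thesis by (rule that)
qed

lemma SL_fun_independent:
  fixes f :: "nat \<Rightarrow> ('n::finite) sl_fun"
  assumes "(\<Sum>i<CARD('n). pullback (f i) * chi ^ i) = 0" "i < CARD('n)"
  shows "f i = 0"
proof -
  have "\<exists>p. poly_fun p \<and> f i = sres p" for i by (rule sl_fun_cases[of "f i"]) blast
  then obtain r where r: "\<And>i. poly_fun (r i)" "\<And>i. f i = sres (r i)" by metis
  have "(\<Sum>i<CARD('n). r i (cayley A) * ntr A ^ i) = 0" if "A \<in> SL" for A
    using arg_cong[OF assms(1), of "\<lambda>F. SL_eval F A"] that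
    by (simp add: SL_eval_sum SL_eval_power r cayley_in_sl)
  from ntr_powers_independent[of r, OF r(1) this assms(2)]
  show ?thesis by (intro sl_fun_eqI) (simp add: r)
qed

lemma SL_invariants_expansion:
  fixes F :: "('n::finite) SL_fun"
  assumes "F \<in> SL_invariants"
  obtains f where "\<And>i. f i \<in> sl_invariants" "F = (\<Sum>i<CARD('n). pullback (f i) * chi ^ i)"
proof -
  obtain f where f: "F = (\<Sum>i<CARD('n). pullback (f i) * chi ^ i)" by (rule SL_fun_expansion)
  have inv: "f i \<in> sl_invariants" if i: "i < CARD('n)" for i
    unfolding sl_invariants_def
  proof (intro CollectI ballI)
    fix g :: "complex^'n^'n" assume g: "g \<in> SL"
    have "(\<Sum>i<CARD('n). pullback (sl_act g (f i)) * chi ^ i) = SL_act g F"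
      by (simp add: f SL_act_sum[OF g] SL_act_simps[OF g] SL_act_power[OF g])
    also have "\<dots> = F" using assms g by (simp add: SL_invariants_def)
    finally have "(\<Sum>i<CARD('n). pullback (sl_act g (f i) - f i) * chi ^ i) = 0"
      by (simp add: f pullback_simps algebra_simps sum_subtractf)
    from SL_fun_independent[OF this i] show "sl_act g (f i) = f i" by simp
  qed
  show thesis
  \<comment> \<open>Coefficients beyond n - 1 are unconstrained by uniqueness, so they are replaced
    by 0 to make all of them invariant.\<close>
  proof (rule that[of "\<lambda>i. if i < CARD('n) then f i else 0"])
    show "(if i < CARD('n) then f i else 0) \<in> sl_invariants" for i by (simp add: inv sl_invariants_closed(2))
    show "F = (\<Sum>i<CARD('n). pullback (if i < CARD('n) then f i else 0) * chi ^ i)" unfolding f by simp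
  qed
qed

lemma SL_invariants_closed:
  "0 \<in> SL_invariants" "SL_const c \<in> SL_invariants" "chi \<in> SL_invariants"
  "a \<in> SL_invariants \<Longrightarrow> b \<in> SL_invariants \<Longrightarrow> a + b \<in> SL_invariants"
  "a \<in> SL_invariants \<Longrightarrow> b \<in> SL_invariants \<Longrightarrow> a * b \<in> SL_invariants"
  "p \<in> sl_invariants \<Longrightarrow> pullback p \<in> SL_invariants"
  by (simp_all add: SL_invariants_def SL_act_simps sl_invariants_def)

lemma SL_invariants_power: "a \<in> SL_invariants \<Longrightarrow> a ^ k \<in> SL_invariants"
  by (induction k) (simp_all add: SL_invariants_closed SL_invariants_closed(2)[of 1, unfolded SL_const_simps])

lemma SL_invariants_eq: "(SL_invariants :: ('n::finite) SL_fun set) = adjoin (pullback ` sl_invariants) chi"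
proof (intro equalityI subsetI)
  fix F :: "'n SL_fun" assume "F \<in> SL_invariants"
  then obtain f where f: "\<And>i. f i \<in> sl_invariants" "F = (\<Sum>i<CARD('n). pullback (f i) * chi ^ i)"
    by (rule SL_invariants_expansion) blast
  define p where "p = (\<Sum>i<CARD('n). monom (pullback (f i)) i)"
  have "F = poly p chi" by (simp add: f(2) p_def poly_sum poly_monom)
  moreover have "coeff p i \<in> pullback ` sl_invariants" for i
  proof (cases "i < CARD('n)")
    case True
    then show ?thesis using f(1) by (simp add: p_def coeff_sum)
  next
    case False
    then have "coeff p i = pullback 0" by (simp add: p_def coeff_sum pullback_simps)
    then show ?thesis using sl_invariants_closed(2) by blast
  qed
  ultimately show "F \<in> adjoin (pullback ` sl_invariants) chi" unfolding adjoin_def by blast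
next
  fix F :: "'n SL_fun" assume "F \<in> adjoin (pullback ` sl_invariants) chi"
  then obtain p where p: "F = poly p chi" "\<And>i. coeff p i \<in> pullback ` sl_invariants" unfolding adjoin_def by blast
  have "(\<Sum>i\<in>I. coeff p i * chi ^ i) \<in> SL_invariants" for I
  proof (induction I rule: infinite_finite_induct)
    case (insert i I)
    have "coeff p i \<in> SL_invariants" using p(2)[of i] SL_invariants_closed(6) by auto
    then show ?case using insert by (simp add: SL_invariants_closed SL_invariants_power)
  qed (simp_all add: SL_invariants_closed)
  then show "F \<in> SL_invariants" by (simp add: p(1) poly_altdef)
qed

text \<open>The \<open>w j\<close> are pullbacks, so expanding the invariants \<open>u j\<close> in
  powers of \<open>chi\<close> and comparing coefficients splits the relation into n relations on
  \<open>sl\<close> with the same harmonic functions.\<close>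

lemma SL_harmonic_independent:
  fixes u w :: "'j \<Rightarrow> ('n::finite) SL_fun"
  assumes J: "finite J" and u: "\<And>j. j \<in> J \<Longrightarrow> u j \<in> SL_invariants" and w: "\<And>j. j \<in> J \<Longrightarrow> w j \<in> SL_harmonic"
    and rel: "(\<Sum>j\<in>J. u j * w j) = 0"
    and ind: "\<And>z. (\<Sum>j\<in>J. SL_const (z j) * w j) = 0 \<Longrightarrow> \<forall>j\<in>J. z j = 0"
    and j: "j \<in> J"
  shows "u j = 0"
proof -
  have "\<forall>j\<in>J. \<exists>h. h \<in> sl_harmonic \<and> w j = pullback h" using w unfolding SL_harmonic_def by blast
  then obtain h where h: "\<And>j. j \<in> J \<Longrightarrow> h j \<in> sl_harmonic" "\<And>j. j \<in> J \<Longrightarrow> w j = pullback (h j)" by metis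
  have "\<forall>j\<in>J. \<exists>f. (\<forall>i. f i \<in> sl_invariants) \<and> u j = (\<Sum>i<CARD('n). pullback (f i) * chi ^ i)"
    using SL_invariants_expansion[OF u] by metis
  then obtain v where v: "\<And>j i. j \<in> J \<Longrightarrow> v j i \<in> sl_invariants"
    "\<And>j. j \<in> J \<Longrightarrow> u j = (\<Sum>i<CARD('n). pullback (v j i) * chi ^ i)" by metis
  have "(\<Sum>i<CARD('n). pullback (\<Sum>j\<in>J. v j i * h j) * chi ^ i) = (\<Sum>i<CARD('n). \<Sum>j\<in>J. pullback (v j i) * chi ^ i * w j)"
    unfolding pullback_sum sum_distrib_right
    by (intro sum.cong refl) (simp add: pullback_simps h(2) mult_ac)
  also have "\<dots> = (\<Sum>j\<in>J. \<Sum>i<CARD('n). pullback (v j i) * chi ^ i * w j)" by (rule sum.swap)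
  also have "\<dots> = (\<Sum>j\<in>J. u j * w j)" by (rule sum.cong) (simp_all add: v(2) sum_distrib_right)
  finally have s: "(\<Sum>i<CARD('n). pullback (\<Sum>j\<in>J. v j i * h j) * chi ^ i) = 0" using rel by simp
  have "v j i = 0" if "i < CARD('n)" for i
  proof (rule harmonic_independent[of J "\<lambda>j. v j i" h, OF J v(1) h(1) SL_fun_independent[OF s that] _ j])
    fix z assume "(\<Sum>j\<in>J. sl_const (z j) * h j) = 0"
    then have "pullback (\<Sum>j\<in>J. sl_const (z j) * h j) = 0" by (simp add: pullback_simps)
    then have "(\<Sum>j\<in>J. SL_const (z j) * w j) = 0" by (simp add: pullback_sum pullback_simps h(2))
    then show "\<forall>j\<in>J. z j = 0" by (rule ind)
  qed
  then show ?thesis by (simp add: v(2)[OF j] pullback_simps)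
qed


section \<open>Tensor products\<close>

locale tensor =
  fixes k :: "complex \<Rightarrow> 'a::comm_ring_1" and U W :: "'a set"
  assumes k_add: "k (a + b) = k a + k b" and k_mult: "k (a * b) = k a * k b" and k_1: "k 1 = 1"
    and U: "subspace_over k U" and W: "subspace_over k W"
begin

lemma k_0: "k 0 = 0"
  using k_add[of 0 0] by simp

lemma k_minus: "k (- a) = - k a"
  using k_add[of "- a" a] by (simp add: k_0 eq_neg_iff_add_eq_0)

abbreviation T :: "('a \<times> 'a \<Rightarrow>\<^sub>0 complex) set" where
  "T \<equiv> tensor_relations k U W"

lemma mult_map_superset:
  assumes "finite S" "Poly_Mapping.keys x \<subseteq> S"
  shows "mult_map k x = (\<Sum>p\<in>S. k (Poly_Mapping.lookup x p) * (fst p * snd p))"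
  unfolding mult_map_def split_def prod.collapse
  by (rule sum.mono_neutral_left) (use assms in \<open>auto simp: k_0 in_keys_iff\<close>)

lemma mult_map_add: "mult_map k (x + y) = mult_map k x + mult_map k y"
proof -
  let ?S = "Poly_Mapping.keys x \<union> Poly_Mapping.keys y"
  show ?thesis
    using mult_map_superset[of ?S x] mult_map_superset[of ?S y] mult_map_superset[of ?S "x + y"] keys_add[of x y]
    by (simp add: lookup_add k_add distrib_right sum.distrib)
qed

lemma lookup_scale: "Poly_Mapping.lookup (Poly_Mapping.map ((*) c) x) p = c * Poly_Mapping.lookup x p"
  for c :: complex
  by (simp add: Poly_Mapping.map.rep_eq when_def)

lemma mult_map_scale: "mult_map k (Poly_Mapping.map ((*) c) x) = k c * mult_map k x"
proof -
  have "Poly_Mapping.keys (Poly_Mapping.map ((*) c) x) \<subseteq> Poly_Mapping.keys x"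
    by (auto simp: in_keys_iff lookup_scale)
  then show ?thesis
    using mult_map_superset[of "Poly_Mapping.keys x" x] mult_map_superset[of "Poly_Mapping.keys x" "Poly_Mapping.map ((*) c) x"]
    by (simp add: lookup_scale k_mult sum_distrib_left mult.assoc)
qed

lemma mult_map_single: "mult_map k (Poly_Mapping.single (u, w) c) = k c * (u * w)"
  using mult_map_superset[of "{(u, w)}" "Poly_Mapping.single (u, w) c"] by simp

lemma uminus_eq_scale: "- x = Poly_Mapping.map ((*) (- 1)) x" for x :: "'a \<times> 'a \<Rightarrow>\<^sub>0 complex"
  by (rule poly_mapping_eqI) (simp add: lookup_scale)

lemma mult_map_diff: "mult_map k (x - y) = mult_map k x - mult_map k y"
  using mult_map_add[of "x - y" y] by (simp add: algebra_simps)

lemma mult_map_0: "mult_map k 0 = 0"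
  using mult_map_add[of 0 0] by simp

lemma keys_scale: "Poly_Mapping.keys (Poly_Mapping.map ((*) c) x) \<subseteq> Poly_Mapping.keys x" for c :: complex
  by (auto simp: in_keys_iff lookup_scale)

lemma keys_diff': "Poly_Mapping.keys (x - y) \<subseteq> Poly_Mapping.keys x \<union> Poly_Mapping.keys y"
  for x y :: "'a \<times> 'a \<Rightarrow>\<^sub>0 complex"
  by (auto simp: in_keys_iff lookup_minus)

lemma relations_in_kernel:
  assumes "x \<in> T" shows "Poly_Mapping.keys x \<subseteq> U \<times> W \<and> mult_map k x = 0"
  using assms
proof (induction rule: tensor_relations.induct)
  case (add_left u u' w)
  have "u + u' \<in> U" using U add_left by (simp add: subspace_over_def)
  then have "Poly_Mapping.keys (Poly_Mapping.single (u + u', w) 1 - Poly_Mapping.single (u, w) 1 - Poly_Mapping.single (u', w) (1 :: complex)) \<subseteq> U \<times> W"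
    using add_left by (intro order_trans[OF keys_diff'] Un_least) auto
  then show ?case by (simp only: mult_map_diff mult_map_single k_1) (simp add: algebra_simps)
next
  case (add_right u w w')
  have "w + w' \<in> W" using W add_right by (simp add: subspace_over_def)
  then have "Poly_Mapping.keys (Poly_Mapping.single (u, w + w') 1 - Poly_Mapping.single (u, w) 1 - Poly_Mapping.single (u, w') (1 :: complex)) \<subseteq> U \<times> W"
    using add_right by (intro order_trans[OF keys_diff'] Un_least) auto
  then show ?case by (simp only: mult_map_diff mult_map_single k_1) (simp add: algebra_simps)
next
  case (scale_left u w c)
  have "k c * u \<in> U" using U scale_left by (simp add: subspace_over_def)
  then have "Poly_Mapping.keys (Poly_Mapping.single (k c * u, w) 1 - Poly_Mapping.single (u, w) c) \<subseteq> U \<times> W"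
    using scale_left by (intro order_trans[OF keys_diff'] Un_least) auto
  then show ?case by (simp only: mult_map_diff mult_map_single k_1) (simp add: algebra_simps)
next
  case (scale_right u w c)
  have "k c * w \<in> W" using W scale_right by (simp add: subspace_over_def)
  then have "Poly_Mapping.keys (Poly_Mapping.single (u, k c * w) 1 - Poly_Mapping.single (u, w) c) \<subseteq> U \<times> W"
    using scale_right by (intro order_trans[OF keys_diff'] Un_least) auto
  then show ?case by (simp only: mult_map_diff mult_map_single k_1) (simp add: algebra_simps)
next
  case (add x y)
  then show ?case using keys_add[of x y] by (auto simp: mult_map_add)
next
  case (scale x c)
  then show ?case using keys_scale[of c x] by (auto simp: mult_map_scale)
qed (simp add: mult_map_0)

lemma T_uminus: "x \<in> T \<Longrightarrow> - x \<in> T"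
  unfolding uminus_eq_scale by (rule tensor_relations.scale)

definition eqv :: "('a \<times> 'a \<Rightarrow>\<^sub>0 complex) \<Rightarrow> ('a \<times> 'a \<Rightarrow>\<^sub>0 complex) \<Rightarrow> bool" where
  "eqv x y \<longleftrightarrow> x - y \<in> T"

lemma eqv_refl [simp]: "eqv x x"
  by (simp add: eqv_def tensor_relations.zero)

lemma eqv_sym: "eqv x y \<Longrightarrow> eqv y x"
  unfolding eqv_def using T_uminus[of "x - y"] by simp

lemma eqv_trans [trans]: "eqv x y \<Longrightarrow> eqv y z \<Longrightarrow> eqv x z"
  unfolding eqv_def using tensor_relations.add[of "x - y" k U W "y - z"] by simp

lemma eqv_add: "eqv x y \<Longrightarrow> eqv x' y' \<Longrightarrow> eqv (x + x') (y + y')"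
  unfolding eqv_def using tensor_relations.add[of "x - y" k U W "x' - y'"] by (simp add: algebra_simps)

lemma eqv_sum: "(\<And>i. i \<in> I \<Longrightarrow> eqv (x i) (y i)) \<Longrightarrow> eqv (\<Sum>i\<in>I. x i) (\<Sum>i\<in>I. y i)"
  by (induction I rule: infinite_finite_induct) (simp_all add: eqv_add)

lemma U_closed: "0 \<in> U" "u \<in> U \<Longrightarrow> u' \<in> U \<Longrightarrow> u + u' \<in> U" "u \<in> U \<Longrightarrow> k c * u \<in> U"
  using U by (auto simp: subspace_over_def)

lemma W_closed: "0 \<in> W" "u \<in> W \<Longrightarrow> u' \<in> W \<Longrightarrow> u + u' \<in> W" "u \<in> W \<Longrightarrow> k c * u \<in> W"
  using W by (auto simp: subspace_over_def)

lemma W_sum: "(\<And>i. i \<in> I \<Longrightarrow> w i \<in> W) \<Longrightarrow> (\<Sum>i\<in>I. w i) \<in> W"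
  by (induction I rule: infinite_finite_induct) (auto intro: W_closed)

abbreviation pure :: "'a \<Rightarrow> 'a \<Rightarrow> ('a \<times> 'a \<Rightarrow>\<^sub>0 complex)" where
  "pure u w \<equiv> Poly_Mapping.single (u, w) 1"

lemma pure_add_left: "u \<in> U \<Longrightarrow> u' \<in> U \<Longrightarrow> w \<in> W \<Longrightarrow> eqv (pure (u + u') w) (pure u w + pure u' w)"
  unfolding eqv_def using tensor_relations.add_left[of u U u' w W k] by (simp add: diff_diff_eq)

lemma pure_add_right: "u \<in> U \<Longrightarrow> w \<in> W \<Longrightarrow> w' \<in> W \<Longrightarrow> eqv (pure u (w + w')) (pure u w + pure u w')"
  unfolding eqv_def using tensor_relations.add_right[of u U w W w' k] by (simp add: diff_diff_eq)

lemma pure_scale_left: "u \<in> U \<Longrightarrow> w \<in> W \<Longrightarrow> eqv (pure (k c * u) w) (Poly_Mapping.single (u, w) c)"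
  unfolding eqv_def by (rule tensor_relations.scale_left)

lemma pure_scale_right: "u \<in> U \<Longrightarrow> w \<in> W \<Longrightarrow> eqv (pure u (k c * w)) (Poly_Mapping.single (u, w) c)"
  unfolding eqv_def by (rule tensor_relations.scale_right)

lemma pure_zero_left: "w \<in> W \<Longrightarrow> eqv (pure 0 w) 0"
  using pure_scale_left[of 0 w 0] U_closed by simp

lemma pure_zero_right: "u \<in> U \<Longrightarrow> eqv (pure u 0) 0"
  using pure_scale_right[of u 0 0] W_closed by simp

lemma pure_swap: "u \<in> U \<Longrightarrow> w \<in> W \<Longrightarrow> eqv (pure u (k c * w)) (pure (k c * u) w)"
  using eqv_trans[OF pure_scale_right eqv_sym[OF pure_scale_left]] by blast

lemma pure_sum_right:
  "u \<in> U \<Longrightarrow> (\<And>i. i \<in> I \<Longrightarrow> w i \<in> W) \<Longrightarrow> eqv (pure u (\<Sum>i\<in>I. w i)) (\<Sum>i\<in>I. pure u (w i))"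
proof (induction I rule: infinite_finite_induct)
  case (insert i I)
  then have "eqv (pure u (w i + (\<Sum>i\<in>I. w i))) (pure u (w i) + pure u (\<Sum>i\<in>I. w i))"
    by (intro pure_add_right W_sum) auto
  also have "eqv (pure u (w i) + pure u (\<Sum>i\<in>I. w i)) (pure u (w i) + (\<Sum>i\<in>I. pure u (w i)))"
    using insert by (intro eqv_add) auto
  finally show ?case using insert by simp
qed (simp_all add: pure_zero_right)

lemma pure_expansion:
  assumes "Poly_Mapping.keys x \<subseteq> U \<times> W"
  shows "eqv x (\<Sum>p\<in>Poly_Mapping.keys x. pure (k (Poly_Mapping.lookup x p) * fst p) (snd p))"
proof -
  have "x = (\<Sum>p\<in>Poly_Mapping.keys x. Poly_Mapping.single p (Poly_Mapping.lookup x p))"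
    by (rule poly_mapping_eqI)
      (auto simp: lookup_sum lookup_single when_def in_keys_iff if_distrib sum.delta cong: if_cong)
  moreover have "eqv (\<Sum>p\<in>Poly_Mapping.keys x. Poly_Mapping.single p (Poly_Mapping.lookup x p))
    (\<Sum>p\<in>Poly_Mapping.keys x. pure (k (Poly_Mapping.lookup x p) * fst p) (snd p))"
  proof (rule eqv_sum)
    fix p assume "p \<in> Poly_Mapping.keys x"
    then have "fst p \<in> U" "snd p \<in> W" using assms by auto
    from eqv_sym[OF pure_scale_left[OF this, of "Poly_Mapping.lookup x p"]]
    show "eqv (Poly_Mapping.single p (Poly_Mapping.lookup x p)) (pure (k (Poly_Mapping.lookup x p) * fst p) (snd p))" by simp
  qed
  ultimately show ?thesis by metis
qed

text \<open>A representation by a minimal number of pure tensors has linearly independent second factors.\<close>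

lemma kernel_in_relations:
  assumes free: "\<And>(J :: ('a \<times> 'a) set) u w. finite J \<Longrightarrow> (\<And>j. j \<in> J \<Longrightarrow> u j \<in> U) \<Longrightarrow> (\<And>j. j \<in> J \<Longrightarrow> w j \<in> W) \<Longrightarrow>
      (\<Sum>j\<in>J. u j * w j) = 0 \<Longrightarrow> (\<And>z. (\<Sum>j\<in>J. k (z j) * w j) = 0 \<Longrightarrow> \<forall>j\<in>J. z j = 0) \<Longrightarrow> \<forall>j\<in>J. u j = 0"
    and x: "Poly_Mapping.keys x \<subseteq> U \<times> W" "mult_map k x = 0"
  shows "x \<in> T"
proof -
  \<comment> \<open>The index set consists of pairs because the first representation is indexed by
    the keys of \<open>x\<close>.\<close>
  define R where "R (J :: ('a \<times> 'a) set) u w \<longleftrightarrow> finite J \<and> (\<forall>j\<in>J. u j \<in> U) \<and> (\<forall>j\<in>J. w j \<in> W) \<and>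
    eqv x (\<Sum>j\<in>J. pure (u j) (w j))" for J u w
  have "R (Poly_Mapping.keys x) (\<lambda>p. k (Poly_Mapping.lookup x p) * fst p) snd"
  proof -
    have "k (Poly_Mapping.lookup x p) * fst p \<in> U" "snd p \<in> W" if "p \<in> Poly_Mapping.keys x" for p
      using subsetD[OF x(1) that] by (auto intro: U_closed)
    then show ?thesis unfolding R_def using pure_expansion[OF x(1)] by simp
  qed
  then have ex: "\<exists>n J u w. R J u w \<and> card J = n" by blast
  define n where "n = (LEAST n. \<exists>J u w. R J u w \<and> card J = n)"
  obtain J u w where J: "R J u w" "card J = n" using LeastI_ex[OF ex] unfolding n_def by blast
  have fin: "finite J" and uU: "\<And>j. j \<in> J \<Longrightarrow> u j \<in> U" and wW: "\<And>j. j \<in> J \<Longrightarrow> w j \<in> W"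
    and e: "eqv x (\<Sum>j\<in>J. pure (u j) (w j))" using J(1) by (auto simp: R_def)
  have ind: "\<forall>j\<in>J. z j = 0" if z: "(\<Sum>j\<in>J. k (z j) * w j) = 0" for z
  proof (rule ccontr)
    assume "\<not> (\<forall>j\<in>J. z j = 0)"
    then obtain i where i: "i \<in> J" "z i \<noteq> 0" by blast
    have ui: "u i \<in> U" using uU i(1) by blast
    define c where "c j = - z j / z i" for j
    let ?I = "J - {i}"
    have "k (z i) * w i + (\<Sum>j\<in>?I. k (z j) * w j) = 0" using z sum.remove[OF fin i(1), of "\<lambda>j. k (z j) * w j"] by simp
    then have "k (z i) * w i = - (\<Sum>j\<in>?I. k (z j) * w j)"
      by (simp only: eq_neg_iff_add_eq_0)
    then have "k (1 / z i) * (k (z i) * w i) = k (1 / z i) * - (\<Sum>j\<in>?I. k (z j) * w j)"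
      by (simp only:)
    moreover have "k (1 / z i) * (k (z i) * w i) = w i"
      using i(2) by (simp add: mult.assoc[symmetric] k_1 flip: k_mult)
    moreover have "k (1 / z i) * - (\<Sum>j\<in>?I. k (z j) * w j) = (\<Sum>j\<in>?I. k (c j) * w j)"
    proof -
      have "k (c j) = k (1 / z i) * - k (z j)" for j
        by (simp add: c_def flip: k_mult k_minus)
      then show ?thesis by (simp add: sum_distrib_left mult.assoc flip: sum_negf)
    qed
    ultimately have wi: "w i = (\<Sum>j\<in>?I. k (c j) * w j)" by simp
    have "eqv (pure (u i) (w i)) (\<Sum>j\<in>?I. pure (u i) (k (c j) * w j))"
      unfolding wi by (rule pure_sum_right) (use uU wW i in \<open>auto intro: W_closed\<close>)
    also have "eqv (\<Sum>j\<in>?I. pure (u i) (k (c j) * w j)) (\<Sum>j\<in>?I. pure (k (c j) * u i) (w j))"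
      by (intro eqv_sum pure_swap) (use uU wW i in auto)
    finally have pi: "eqv (pure (u i) (w i)) (\<Sum>j\<in>?I. pure (k (c j) * u i) (w j))" .
    have "eqv x (pure (u i) (w i) + (\<Sum>j\<in>?I. pure (u j) (w j)))"
      using e sum.remove[OF fin i(1), of "\<lambda>j. pure (u j) (w j)"] by simp
    also have "eqv (pure (u i) (w i) + (\<Sum>j\<in>?I. pure (u j) (w j)))
      ((\<Sum>j\<in>?I. pure (k (c j) * u i) (w j)) + (\<Sum>j\<in>?I. pure (u j) (w j)))"
      by (intro eqv_add pi eqv_refl)
    also have "eqv ((\<Sum>j\<in>?I. pure (k (c j) * u i) (w j)) + (\<Sum>j\<in>?I. pure (u j) (w j)))
      (\<Sum>j\<in>?I. pure (k (c j) * u i + u j) (w j))"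
      unfolding sum.distrib[symmetric]
      by (intro eqv_sum eqv_sym[OF pure_add_left]) (use uU wW ui in \<open>auto intro: U_closed\<close>)
    finally have "R ?I (\<lambda>j. k (c j) * u i + u j) w"
      unfolding R_def using fin uU wW ui by (auto intro: U_closed)
    then have "n \<le> card ?I" unfolding n_def by (intro Least_le) blast
    moreover have "card ?I < n" using card_Diff1_less[OF fin i(1)] J(2) by simp
    ultimately show False by simp
  qed
  have "x - (\<Sum>j\<in>J. pure (u j) (w j)) \<in> T" using e by (simp add: eqv_def)
  from relations_in_kernel[OF this] have "mult_map k x = mult_map k (\<Sum>j\<in>J. pure (u j) (w j))"
    by (simp add: mult_map_diff)
  also have "\<dots> = (\<Sum>j\<in>J. u j * w j)"
    using fin by (induction J rule: finite_induct) (simp_all add: mult_map_0 mult_map_add mult_map_single k_1)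
  finally have "(\<Sum>j\<in>J. u j * w j) = 0" using x(2) by simp
  then have "\<forall>j\<in>J. u j = 0" using free[of J u w, OF fin uU wW _ ind] by blast
  then have "eqv (\<Sum>j\<in>J. pure (u j) (w j)) (\<Sum>j\<in>J. 0)"
    using wW by (intro eqv_sum) (auto intro: pure_zero_left)
  then have "eqv x 0" using eqv_trans[OF e] by simp
  then show ?thesis by (simp add: eqv_def)
qed

end

lemma SL_harmonic_subspace: "subspace_over SL_const (SL_harmonic :: ('n::finite) SL_fun set)"
  unfolding subspace_over_def SL_harmonic_def
  by (auto simp: sl_harmonic_closed simp flip: pullback_simps)

lemma SL_tensor: "tensor SL_const (SL_invariants :: ('n::finite) SL_fun set) SL_harmonic"
proof
  show "subspace_over SL_const (SL_invariants :: 'n SL_fun set)"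
    unfolding subspace_over_def by (auto intro: SL_invariants_closed)
qed (auto simp: SL_const_simps SL_harmonic_subspace)

lemma SL_tensor_decomposition:
  "is_tensor_product_via_mult SL_const (UNIV :: ('n::finite) SL_fun set) SL_invariants SL_harmonic"
proof -
  interpret tensor SL_const "SL_invariants :: 'n SL_fun set" SL_harmonic by (rule SL_tensor)
  let ?M = "mult_map SL_const ` {x. Poly_Mapping.keys x \<subseteq> (SL_invariants :: 'n SL_fun set) \<times> SL_harmonic}"
  have M_add: "f + g \<in> ?M" if "f \<in> ?M" "g \<in> ?M" for f g
  proof -
    obtain x y where *: "f = mult_map SL_const x" "Poly_Mapping.keys x \<subseteq> SL_invariants \<times> SL_harmonic"
      "g = mult_map SL_const y" "Poly_Mapping.keys y \<subseteq> SL_invariants \<times> SL_harmonic" using \<open>f \<in> ?M\<close> \<open>g \<in> ?M\<close> by blast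
    then have "Poly_Mapping.keys (x + y) \<subseteq> SL_invariants \<times> SL_harmonic" using keys_add[of x y] by blast
    then show ?thesis using * by (intro image_eqI[of _ _ "x + y"]) (auto simp: mult_map_add)
  qed
  have M_0: "0 \<in> ?M" by (intro image_eqI[of _ _ 0]) (auto simp: mult_map_0)
  have M_mult: "u * w \<in> ?M" if "u \<in> SL_invariants" "w \<in> SL_harmonic" for u w
    using that by (intro image_eqI[of _ _ "pure u w"]) (auto simp: mult_map_single SL_const_simps)
  have M_pb: "pullback f * chi ^ i \<in> ?M" for f and i
    using inv_harm_UNIV[of f]
  proof (induction rule: inv_harm.induct)
    case zero
    then show ?case using M_0 by (simp add: pullback_simps)
  next
    case (add a h f)
    have "pullback a * chi ^ i \<in> SL_invariants" "pullback h \<in> SL_harmonic"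
      using add by (auto intro!: SL_invariants_closed SL_invariants_power simp: SL_harmonic_def)
    then have "(pullback a * chi ^ i) * pullback h + pullback f * chi ^ i \<in> ?M"
      by (intro M_add[OF M_mult add.IH])
    then show ?case by (simp add: pullback_simps algebra_simps)
  qed
  have "F \<in> ?M" for F
  proof -
    obtain f where f: "F = (\<Sum>i<CARD('n). pullback (f i) * chi ^ i)" by (rule SL_fun_expansion)
    have "(\<Sum>i\<in>I. pullback (f i) * chi ^ i) \<in> ?M" for I
      by (induction I rule: infinite_finite_induct) (use M_0 M_add M_pb in auto)
    then show ?thesis by (simp only: f)
  qed
  then have "?M = UNIV" by blast
  moreover have "{x. Poly_Mapping.keys x \<subseteq> SL_invariants \<times> SL_harmonic \<and> mult_map SL_const x = 0} = T"
  proof (intro equalityI subsetI)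
    fix x assume x: "x \<in> {x. Poly_Mapping.keys x \<subseteq> (SL_invariants :: 'n SL_fun set) \<times> SL_harmonic \<and> mult_map SL_const x = 0}"
    show "x \<in> T"
    proof (rule kernel_in_relations)
      fix J :: "('n SL_fun \<times> 'n SL_fun) set" and u w :: "'n SL_fun \<times> 'n SL_fun \<Rightarrow> 'n SL_fun"
      assume *: "finite J" "\<And>j. j \<in> J \<Longrightarrow> u j \<in> SL_invariants" "\<And>j. j \<in> J \<Longrightarrow> w j \<in> SL_harmonic"
        "(\<Sum>j\<in>J. u j * w j) = 0" "\<And>z. (\<Sum>j\<in>J. SL_const (z j) * w j) = 0 \<Longrightarrow> \<forall>j\<in>J. z j = 0"
      show "\<forall>j\<in>J. u j = 0"
      proof
        fix j assume "j \<in> J"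
        from * this show "u j = 0" by (rule SL_harmonic_independent)
      qed
    qed (use x in simp_all)
  qed (use relations_in_kernel in blast)
  ultimately show ?thesis using U W unfolding is_tensor_product_via_mult_def by blast
qed

section \<open>Fields of fractions\<close>

text \<open>Applied to the pullback and to the conjugations, and by \<open>mf_hom\<close> a second
  time to the maps they induce on fraction fields.\<close>

locale inj_ring_hom =
  fixes h :: "'a::idom \<Rightarrow> 'b::idom"
  assumes h_add: "h (a + b) = h a + h b" and h_mult: "h (a * b) = h a * h b" and h_1: "h 1 = 1"
    and h_inj: "inj h"
begin

lemma h_0: "h 0 = 0"
  using h_add[of 0 0] by (simp only: add_0_left add_cancel_right_right)

lemma h_eq_0: "h a = 0 \<longleftrightarrow> a = 0"
  using h_inj h_0 by (metis injD)

lemma mf_Fract: "b \<noteq> 0 \<Longrightarrow> map_fract h (Fract a b) = Fract (h a) (h b)"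
  using h_mult h_inj h_0 by (rule map_fract_Fract)

lemma mf_hom: "inj_ring_hom (map_fract h)"
proof
  fix x y :: "'a fract"
  obtain a b where x: "x = Fract a b" "b \<noteq> 0" by (rule Fract_cases)
  obtain c d where y: "y = Fract c d" "d \<noteq> 0" by (rule Fract_cases)
  show "map_fract h (x + y) = map_fract h x + map_fract h y"
    using x y by (simp add: mf_Fract h_eq_0 h_add h_mult)
  show "map_fract h (x * y) = map_fract h x * map_fract h y"
    using x y by (simp add: mf_Fract h_eq_0 h_mult)
next
  show "map_fract h 1 = 1" by (simp add: One_fract_def mf_Fract h_1)
next
  show "inj (map_fract h)"
  proof (rule injI)
    fix x y :: "'a fract" assume e: "map_fract h x = map_fract h y"
    obtain a b where x: "x = Fract a b" "b \<noteq> 0" by (rule Fract_cases)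
    obtain c d where y: "y = Fract c d" "d \<noteq> 0" by (rule Fract_cases)
    have "h (a * d) = h (c * b)" using e x y by (simp add: mf_Fract eq_fract h_eq_0 h_mult)
    then show "x = y" using x y h_inj by (simp add: eq_fract inj_eq)
  qed
qed

lemma h_sum: "h (\<Sum>i\<in>I. f i) = (\<Sum>i\<in>I. h (f i))"
  by (induction I rule: infinite_finite_induct) (simp_all add: h_0 h_add)

lemma h_power: "h (a ^ k) = h a ^ k"
  by (induction k) (simp_all add: h_1 h_mult)

definition ev :: "'b \<Rightarrow> 'a poly \<Rightarrow> 'b" where
  "ev x p = poly (map_poly h p) x"

lemma ev_add: "ev x (p + q) = ev x p + ev x q"
proof -
  have "map_poly h (p + q) = map_poly h p + map_poly h q"
    by (rule poly_eqI) (simp add: coeff_map_poly h_0 h_add)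
  then show ?thesis by (simp add: ev_def)
qed

lemma ev_mult: "ev x (p * q) = ev x p * ev x q"
proof -
  have "map_poly h (p * q) = map_poly h p * map_poly h q"
    by (rule poly_eqI) (simp add: coeff_map_poly h_0 coeff_mult h_sum h_mult)
  then show ?thesis by (simp add: ev_def)
qed

lemma ev_const: "ev x [:a:] = h a"
  using h_0 by (simp add: ev_def map_poly_pCons)

lemma ev_0: "ev x 0 = 0"
  by (simp add: ev_def)

lemma ev_uminus: "ev x (- p) = - ev x p"
  using ev_add[of x "- p" p] by (simp add: ev_0 eq_neg_iff_add_eq_0)

lemma ev_eq_sum: "degree p < n \<Longrightarrow> ev x p = (\<Sum>i<n. h (coeff p i) * x ^ i)"
proof -
  assume d: "degree p < n"
  have "ev x p = (\<Sum>i\<le>degree (map_poly h p). h (coeff p i) * x ^ i)"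
    unfolding ev_def poly_altdef by (simp add: coeff_map_poly h_0)
  also have "\<dots> = (\<Sum>i<n. h (coeff p i) * x ^ i)"
  proof (rule sum.mono_neutral_left)
    have "degree (map_poly h p) \<le> degree p" by (rule degree_le) (simp add: coeff_map_poly h_0 coeff_eq_0)
    then show "{..degree (map_poly h p)} \<subseteq> {..<n}" using d by auto
    show "\<forall>i\<in>{..<n} - {..degree (map_poly h p)}. h (coeff p i) * x ^ i = 0"
      using coeff_eq_0[of "map_poly h p"] by (auto simp: coeff_map_poly h_0)
  qed simp
  finally show ?thesis .
qed

end

text \<open>Euclid's algorithm modulo \<open>m\<close>. If \<open>p\<close> does not divide
  \<open>m\<close>, the nonzero remainder \<open>m mod p\<close> has smaller degree and agrees at
  \<open>x\<close> with a multiple of \<open>p\<close>, so an inverse of its value gives one for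
  \<open>p\<close>. If \<open>p\<close> divides \<open>m\<close>, the quotient vanishes at
  \<open>x\<close>, and minimality of \<open>m\<close> forces \<open>p\<close> to be
  constant.\<close>

lemma simple_extension_inverse:
  fixes h :: "'a::field \<Rightarrow> 'b::field"
  assumes "inj_ring_hom h" and m: "inj_ring_hom.ev h x m = 0"
    and min: "\<And>p. degree p < degree m \<Longrightarrow> inj_ring_hom.ev h x p = 0 \<Longrightarrow> p = 0"
    and p: "p \<noteq> 0" "degree p < degree m"
  shows "\<exists>q. inj_ring_hom.ev h x q * inj_ring_hom.ev h x p = 1"
proof -
  interpret inj_ring_hom h by fact
  show ?thesis using p
  proof (induction "degree p" arbitrary: p rule: less_induct)
    case less
    have mp: "ev x m = ev x (m div p) * ev x p + ev x (m mod p)"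
      by (metis div_mult_mod_eq ev_add ev_mult)
    have m0: "m \<noteq> 0" using less.prems by auto
    show ?case
    proof (cases "m mod p = 0")
      case True
      then have mm: "m = (m div p) * p" by (metis add.right_neutral div_mult_mod_eq)
      then have q0: "m div p \<noteq> 0" using m0 by auto
      have dm: "degree m = degree (m div p) + degree p"
        by (subst mm) (rule degree_mult_eq[OF q0 less.prems(1)])
      have "ev x p \<noteq> 0" using min less.prems by blast
      then have "ev x (m div p) = 0" using mp m True by (simp add: ev_0)
      then have "\<not> degree (m div p) < degree m" using min q0 by blast
      then have "degree p = 0" using dm by simp
      then obtain c where c: "p = [:c:]" by (rule degree_eq_zeroE)
      then have "h (inverse c) * h c = 1" using less.prems(1) by (simp add: h_1 flip: h_mult)
      then have "ev x [:inverse c:] * ev x p = 1" by (simp add: c ev_const)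
      then show ?thesis by blast
    next
      case False
      then have d: "degree (m mod p) < degree p" using degree_mod_less_degree[of p m] less.prems(1) by (cases "p dvd m") (auto simp: dvd_eq_mod_eq_0)
      then obtain s where s: "ev x s * ev x (m mod p) = 1" using less.hyps[of "m mod p"] False less.prems by auto
      have "ev x (m mod p) = - (ev x (m div p) * ev x p)" using mp m by (simp add: eq_neg_iff_add_eq_0 add.commute)
      then have "ev x (- (s * (m div p))) * ev x p = 1"
        using s by (simp add: ev_mult ev_uminus mult.assoc)
      then show ?thesis by blast
    qed
  qed
qed

lemma common_denominator:
  fixes q :: "nat \<Rightarrow> 'a::idom fract"
  shows "\<exists>b a. b \<noteq> 0 \<and> (\<forall>i<n. q i = Fract (a i) b)"
proof (induction n)
  case 0
  show ?case by (intro exI[of _ 1]) simp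
next
  case (Suc n)
  then obtain b a where *: "b \<noteq> 0" "\<forall>i<n. q i = Fract (a i) b" by blast
  obtain c d where cd: "q n = Fract c d" "d \<noteq> 0" by (rule Fract_cases)
  show ?case
  proof (intro exI conjI allI impI)
    show "b * d \<noteq> 0" using * cd by simp
    fix i assume "i < Suc n"
    then show "q i = Fract (if i = n then c * b else a i * d) (b * d)"
      using * cd by (auto simp: eq_fract less_Suc_eq)
  qed
qed

section \<open>The fraction field of the group as an extension generated by
  \<open>chi\<close>\<close>

lemma pullback_hom: "inj_ring_hom pullback"
  by unfold_locales (simp_all add: pullback_simps inj_pullback)

interpretation pb: inj_ring_hom pullback
  by (rule pullback_hom)

interpretation pbq: inj_ring_hom "map_fract pullback"
  by (rule pb.mf_hom)

lemma SL_act_hom: "g \<in> SL \<Longrightarrow> inj_ring_hom (SL_act g)"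
  by unfold_locales (simp_all add: SL_act_simps inj_SL_act)

lemma sl_act_hom: "g \<in> SL \<Longrightarrow> inj_ring_hom (sl_act g)"
  by unfold_locales (simp_all add: sl_act_simps inj_sl_act)

definition qchi :: "('n::finite) SL_fun fract" where
  "qchi = Fract chi 1"

abbreviation evq :: "('n::finite) sl_fun fract poly \<Rightarrow> 'n SL_fun fract" where
  "evq \<equiv> pbq.ev qchi"

lemma Fract_1_hom:
  "Fract (a + b) 1 = Fract a 1 + Fract b 1" "Fract (a * b) 1 = Fract a 1 * Fract b 1"
  "Fract (a ^ k) 1 = Fract a 1 ^ k" for a b :: "'a::idom"
proof -
  show "Fract (a + b) 1 = Fract a 1 + Fract b 1" "Fract (a * b) 1 = Fract a 1 * Fract b 1" by simp_all
  show "Fract (a ^ k) 1 = Fract a 1 ^ k"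
  proof (induction k)
    case (Suc k)
    show ?case by (simp only: power_Suc Suc[symmetric]) simp
  qed (simp add: One_fract_def)
qed

lemma Fract_1_sum: "Fract (\<Sum>i\<in>I. f i) 1 = (\<Sum>i\<in>I. Fract (f i) 1)" for f :: "'i \<Rightarrow> 'a::idom"
proof (induction I rule: infinite_finite_induct)
  case (insert i I)
  show ?case by (simp only: sum.insert[OF insert.hyps] Fract_1_hom insert.IH)
qed (simp_all add: Zero_fract_def)

lemma map_fract_pullback_1: "map_fract pullback (Fract a 1) = Fract (pullback a) 1"
  by (simp add: pb.mf_Fract pullback_simps)

lemma coeff_sum_monom: "coeff (\<Sum>i<n. monom (f i) i) j = (if j < n then f j else 0)"
  by (simp add: coeff_sum)

lemma degree_sum_monom: "0 < n \<Longrightarrow> degree (\<Sum>i<n. monom (f i) i) < n"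
  by (intro degree_sum_less) (auto intro: le_less_trans[OF degree_monom_le])

lemma evq_of_SL_fun:
  fixes F :: "('n::finite) SL_fun"
  obtains p where "degree p < CARD('n)" "Fract F 1 = evq p"
proof -
  obtain f where f: "F = (\<Sum>i<CARD('n). pullback (f i) * chi ^ i)" by (rule SL_fun_expansion)
  define p where "p = (\<Sum>i<CARD('n). monom (Fract (f i) 1) i)"
  have d: "degree p < CARD('n)" unfolding p_def by (rule degree_sum_monom) simp
  have "evq p = (\<Sum>i<CARD('n). map_fract pullback (coeff p i) * qchi ^ i)" by (rule pbq.ev_eq_sum[OF d])
  also have "\<dots> = (\<Sum>i<CARD('n). Fract (pullback (f i) * chi ^ i) 1)"
    by (rule sum.cong) (simp_all only: p_def coeff_sum_monom lessThan_iff if_True map_fract_pullback_1 qchi_def Fract_1_hom)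
  also have "\<dots> = Fract F 1" by (simp only: f Fract_1_sum)
  finally show thesis using that[OF d] by simp
qed

text \<open>A common denominator turns the relation into one between regular functions, where the
  powers of \<open>chi\<close> are independent.\<close>

lemma evq_injective:
  fixes p :: "('n::finite) sl_fun fract poly"
  assumes "degree p < CARD('n)" "evq p = 0" shows "p = 0"
proof -
  obtain b a where ba: "b \<noteq> 0" "\<forall>i<CARD('n). coeff p i = Fract (a i) b" using common_denominator by blast
  have b: "pullback b \<noteq> 0" using ba(1) pb.h_eq_0 by blast
  have c: "Fract (pullback b) 1 * map_fract pullback (coeff p i) = Fract (pullback (a i)) 1" if "i < CARD('n)" for i
    using ba that b by (simp add: pb.mf_Fract eq_fract)
  have "0 = Fract (pullback b) 1 * evq p" by (simp add: assms(2))
  also have "\<dots> = (\<Sum>i<CARD('n). Fract (pullback b) 1 * map_fract pullback (coeff p i) * qchi ^ i)"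
    by (simp only: pbq.ev_eq_sum[OF assms(1)] sum_distrib_left mult.assoc)
  also have "\<dots> = (\<Sum>i<CARD('n). Fract (pullback (a i) * chi ^ i) 1)"
    by (rule sum.cong) (simp_all only: lessThan_iff c qchi_def Fract_1_hom)
  also have "\<dots> = Fract (\<Sum>i<CARD('n). pullback (a i) * chi ^ i) 1" by (simp only: Fract_1_sum)
  finally have z: "(\<Sum>i<CARD('n). pullback (a i) * chi ^ i) = 0" by (simp add: Zero_fract_def eq_fract)
  have "coeff p i = 0" for i
  proof (cases "i < CARD('n)")
    case True
    then show ?thesis using SL_fun_independent[OF z True] ba by (simp add: fract_collapse)
  next
    case False
    then show ?thesis using assms(1) by (simp add: coeff_eq_0)
  qed
  then show ?thesis by (simp add: poly_eq_iff)
qed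

text \<open>The relation subtracts from t^n the expansion of the n-th power of \<open>chi\<close> in
  lower powers; \<open>evq_injective\<close> makes it minimal.\<close>

lemma evq_minimal_poly:
  obtains m :: "('n::finite) sl_fun fract poly" where "degree m = CARD('n)" "evq m = 0"
proof -
  obtain p :: "'n sl_fun fract poly" where p: "degree p < CARD('n)" "Fract (chi ^ CARD('n)) 1 = evq p"
    by (rule evq_of_SL_fun)
  define X :: "'n sl_fun fract poly" where "X = monom 1 CARD('n)"
  have X: "degree X = CARD('n)" by (simp add: X_def degree_monom_eq)
  have "degree (X + (- p)) = CARD('n)" using p(1) X by (subst degree_add_eq_left) simp_all
  moreover have "evq X = qchi ^ CARD('n)"
    by (subst pbq.ev_eq_sum[of _ "Suc CARD('n)"]) (simp_all add: X pbq.h_0 pbq.h_1, simp add: X_def pbq.h_0 pbq.h_1)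
  moreover have "evq (X + (- p)) + evq p = evq X" by (simp flip: pbq.ev_add)
  ultimately show thesis using that p(2) by (simp add: Fract_1_hom qchi_def)
qed

text \<open>A denominator is a nonzero polynomial of degree less than n in \<open>chi\<close>, so it
  has an inverse polynomial in \<open>chi\<close>; reduction modulo \<open>m\<close> restores the
  degree bound.\<close>

lemma evq_surj:
  fixes y :: "('n::finite) SL_fun fract"
  obtains p where "degree p < CARD('n)" "y = evq p"
proof -
  obtain m :: "'n sl_fun fract poly" where m: "degree m = CARD('n)" "evq m = 0" by (rule evq_minimal_poly)
  have m0: "m \<noteq> 0" using m(1) by auto
  obtain a b where y: "y = Fract a b" "b \<noteq> 0" by (rule Fract_cases)
  obtain pa where pa: "degree pa < CARD('n)" "Fract a 1 = evq pa" by (rule evq_of_SL_fun)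
  obtain pb where pb: "degree pb < CARD('n)" "Fract b 1 = evq pb" by (rule evq_of_SL_fun)
  have "Fract b 1 \<noteq> 0" using y(2) by (simp add: Zero_fract_def eq_fract)
  then have "pb \<noteq> 0" using pb(2) pbq.ev_0 by metis
  then obtain q where q: "evq q * evq pb = 1"
    using simple_extension_inverse[OF pbq.inj_ring_hom_axioms m(2), of pb] evq_injective m(1) pb(1) by auto
  have "Fract a b * Fract b 1 = Fract a 1" using y(2) by (simp add: eq_fract)
  then have "y * (evq q * evq pb) = evq pa * evq q"
    by (simp only: y(1) flip: pa(2) pb(2)) (simp add: mult.left_commute mult.commute)
  then have y1: "y = evq (pa * q)" by (simp add: q pbq.ev_mult)
  let ?r = "(pa * q) mod m"
  have "evq (pa * q) = evq ((pa * q) div m) * evq m + evq ?r" by (metis div_mult_mod_eq pbq.ev_add pbq.ev_mult)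
  then have "y = evq ?r" by (simp add: y1 m(2))
  moreover have "degree ?r < CARD('n)"
    using degree_mod_less_degree[OF m0, of "pa * q"] m(1) by (cases "m dvd pa * q") (auto simp: dvd_eq_mod_eq_0)
  ultimately show thesis using that by blast
qed

lemma evq_adjoin:
  assumes "\<And>i. coeff p i \<in> K" shows "evq p \<in> adjoin (map_fract pullback ` K) qchi"
  unfolding adjoin_def pbq.ev_def using assms
  by (intro CollectI exI[of _ "map_poly (map_fract pullback) p"]) (simp add: coeff_map_poly pbq.h_0)

lemma SL_fract_eq: "(UNIV :: ('n::finite) SL_fun fract set) = adjoin (range (map_fract pullback)) (Fract chi 1)"
proof -
  have "y \<in> adjoin (range (map_fract pullback)) (Fract chi 1)" for y :: "'n SL_fun fract"
  proof -
    obtain p where "y = evq p" by (rule evq_surj)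
    then show ?thesis using evq_adjoin[of p UNIV] by (simp add: qchi_def)
  qed
  then show ?thesis by blast
qed

lemma map_fract_SL_act:
  assumes g: "g \<in> SL"
  shows "map_fract (SL_act g) qchi = qchi"
    "map_fract (SL_act g) (map_fract pullback z) = map_fract pullback (map_fract (sl_act g) z)"
proof -
  interpret A: inj_ring_hom "SL_act g" by (rule SL_act_hom[OF g])
  interpret B: inj_ring_hom "sl_act g" by (rule sl_act_hom[OF g])
  show "map_fract (SL_act g) qchi = qchi" by (simp add: qchi_def A.mf_Fract SL_act_simps[OF g])
  obtain a b where z: "z = Fract a b" "b \<noteq> 0" by (rule Fract_cases)
  then have "pullback b \<noteq> 0" "sl_act g b \<noteq> 0" using pb.h_eq_0 B.h_eq_0 by auto
  then show "map_fract (SL_act g) (map_fract pullback z) = map_fract pullback (map_fract (sl_act g) z)"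
    using z by (simp add: A.mf_Fract B.mf_Fract pb.mf_Fract SL_act_simps[OF g])
qed

text \<open>Conjugation fixes \<open>chi\<close> and acts on an expansion through its coefficients
  alone, so uniqueness of the expansion makes the coefficients of an invariant invariant.\<close>

lemma SL_fract_invariants_eq:
  "(SL_fract_invariants :: ('n::finite) SL_fun fract set) =
    adjoin (map_fract pullback ` sl_fract_invariants) (Fract chi 1)"
proof (intro equalityI subsetI)
  fix y :: "'n SL_fun fract" assume y: "y \<in> SL_fract_invariants"
  obtain p where p: "degree p < CARD('n)" "y = evq p" by (rule evq_surj)
  have "coeff p i \<in> sl_fract_invariants" for i
    unfolding sl_fract_invariants_def
  proof (intro CollectI ballI)
    fix g :: "complex^'n^'n" assume g: "g \<in> SL"
    interpret A: inj_ring_hom "SL_act g" by (rule SL_act_hom[OF g])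
    interpret B: inj_ring_hom "sl_act g" by (rule sl_act_hom[OF g])
    interpret Aq: inj_ring_hom "map_fract (SL_act g)" by (rule A.mf_hom)
    interpret Bq: inj_ring_hom "map_fract (sl_act g)" by (rule B.mf_hom)
    let ?p = "map_poly (map_fract (sl_act g)) p"
    have c: "coeff ?p i = map_fract (sl_act g) (coeff p i)" for i by (simp add: coeff_map_poly Bq.h_0)
    have d: "degree ?p < CARD('n)"
      using p(1) by (intro le_less_trans[OF degree_le p(1)]) (simp add: c coeff_eq_0 Bq.h_0)
    have "map_fract (SL_act g) y = (\<Sum>i<CARD('n). map_fract pullback (coeff ?p i) * qchi ^ i)"
      by (simp add: p(2) pbq.ev_eq_sum[OF p(1)] Aq.h_sum Aq.h_mult Aq.h_power map_fract_SL_act[OF g] c)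
    also have "\<dots> = evq ?p" by (rule pbq.ev_eq_sum[OF d, symmetric])
    finally have "evq ?p = evq p" using y g by (simp add: SL_fract_invariants_def p(2))
    moreover have "evq ?p = evq (?p - p) + evq p" by (simp flip: pbq.ev_add)
    ultimately have "evq (?p - p) = 0" by simp
    moreover have "degree (?p - p) < CARD('n)" using d p(1) by (rule degree_diff_less)
    ultimately have "?p - p = 0" by (intro evq_injective)
    then show "map_fract (sl_act g) (coeff p i) = coeff p i" using c[of i] by simp
  qed
  then show "y \<in> adjoin (map_fract pullback ` sl_fract_invariants) (Fract chi 1)"
    unfolding p(2) qchi_def[symmetric] by (rule evq_adjoin)
next
  fix y :: "'n SL_fun fract" assume "y \<in> adjoin (map_fract pullback ` sl_fract_invariants) (Fract chi 1)"
  then obtain P where P: "y = poly P qchi" "\<And>i. coeff P i \<in> map_fract pullback ` sl_fract_invariants"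
    unfolding adjoin_def qchi_def by blast
  show "y \<in> SL_fract_invariants" unfolding SL_fract_invariants_def
  proof (intro CollectI ballI)
    fix g :: "complex^'n^'n" assume g: "g \<in> SL"
    interpret A: inj_ring_hom "SL_act g" by (rule SL_act_hom[OF g])
    interpret Aq: inj_ring_hom "map_fract (SL_act g)" by (rule A.mf_hom)
    have "map_fract (SL_act g) (coeff P i) = coeff P i" for i
    proof -
      obtain z where z: "coeff P i = map_fract pullback z" "z \<in> sl_fract_invariants" using P(2)[of i] by blast
      then show ?thesis using g by (simp add: map_fract_SL_act sl_fract_invariants_def)
    qed
    then show "map_fract (SL_act g) y = y"
      by (simp add: P(1) poly_altdef Aq.h_sum Aq.h_mult Aq.h_power map_fract_SL_act[OF g])
  qed
qed

theorem mainTheorem9: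
  shows
    "(\<forall>A\<in>(SL :: (complex^'n^'n) set). cayley A = A - mat (1 / of_nat CARD('n) * trace A)) \<and>
     has_mapping_degree cayley (SL :: (complex^'n^'n) set) sl CARD('n) \<and>
     smooth_hypersurface_of_degree (SL :: (complex^'n^'n) set) CARD('n) \<and>
     (\<forall>Orb \<in> regular_orbits (SL :: (complex^'n^'n) set). cayley ` Orb \<in> regular_orbits sl) \<and>
     is_tensor_product_via_mult SL_const (UNIV :: 'n SL_fun set) SL_invariants SL_harmonic \<and>
     {A \<in> (SL :: (complex^'n^'n) set). singular_differential cayley SL sl A} = matrix_inv ` (SL \<inter> sl) \<and>
     matrix_inv ` (SL \<inter> sl) = {A \<in> (SL :: (complex^'n^'n) set). trace (matrix_inv A) = 0} \<and>
     (SL_invariants :: 'n SL_fun set) = adjoin (pullback ` sl_invariants) chi \<and>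
     (SL_fract_invariants :: 'n SL_fun fract set) =
       adjoin (map_fract pullback ` sl_fract_invariants) (Fract chi 1) \<and>
     (UNIV :: 'n SL_fun fract set) = adjoin (range (map_fract pullback)) (Fract chi 1)"
proof (intro conjI ballI)
  show "{A \<in> (SL :: (complex^'n^'n) set). singular_differential cayley SL sl A} = matrix_inv ` (SL \<inter> sl)"
    unfolding matrix_inv_SL_sl using cayley_singular_iff by blast
qed (rule cayley_eq cayley_mapping_degree SL_smooth_hypersurface cayley_regular_orbits SL_tensor_decomposition
    matrix_inv_SL_sl SL_invariants_eq SL_fract_invariants_eq SL_fract_eq | assumption)+

end
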